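(* Let $p\ge 1$. Suppose that $X_i=\mu_0+\epsilon_i$ for all $1\le i\le N$ and all $N$ (no change in the mean), where $\mu_0\in\mathbb{R}$ and $E\epsilon_i=0$. Suppose that there are constants $\sigma>0$ and $\zeta<1/2$ such that for each $N$ there are two independent Wiener processes $\{W_{N,1}(t),0\le t\le N/2\}$ and $\{W_{N,2}(t),0\le t\le N/2\}$ with $$\sup_{1\le k\le N/2}k^{-\zeta}\left|\sum_{i=1}^{k}\epsilon_i-\sigma W_{N,1}(k)\right|=O_P(1)$$ and $$\sup_{N/2<k<N}(N-k)^{-\zeta}\left|\sum_{i=k+1}^{N}\epsilon_i-\sigma W_{N,2}(N-k)\right|=O_P(1)$$ as $N\to\infty$. Then, as $N\to\infty$, $$\left(\frac{1}{4a(p)\log N}\right)^{1/2}\left\{\frac{1}{\sigma^p}\int_0^1\frac{|Z_N(t)|^p}{(t(1-t))^{1+p/2}}\,dt-2b(p)\log N\right\}\ \stackrel{\mathcal D}{\to}\ \mathcal N,$$ where $\mathcal N$ denotes a standard normal random variable.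
   Context: $X_1,X_2,\ldots$ are real-valued random variables (observations) and $\epsilon_1,\epsilon_2,\ldots$ are the corresponding error random variables (one fixed sequence, not depending on $N$). The Wiener processes $W_{N,1},W_{N,2}$ are defined on the same probability space as the errors (suitably enlarged if necessary). The cumulative sum (CUSUM) process is $$Z(x)=\sum_{i=1}^{\lfloor x\rfloor}X_i-\frac{\lfloor x\rfloor}{N}\sum_{i=1}^N X_i,\qquad 0\le x<N+1,$$ where $\lfloor x\rfloor$ is the integer part of $x$, and $$Z_N(t)=N^{-1/2}Z((N+1)t),\quad 0\le t<1,\qquad Z_N(1)=0.$$ Thus $Z_N(t)=0$ for $t\notin[1/(N+1),N/(N+1))$. With $\phi(x)=(2\pi)^{-1/2}\exp(-x^2/2)$ the standard normal density, the constants are $$a(p)=\int_{-\infty}^\infty\int_{-\infty}^\infty\int_{-\infty}^\infty|xy|^p\left\{\frac{1}{2\pi(1-e^{-2|u|})^{1/2}}\exp\left(-\frac{x^2+y^2-2e^{-|u|}xy}{2(1-e^{-2|u|})}\right)-\phi(x)\phi(y)\right\}dx\,dy\,du$$ and $$b(p)=\int_{-\infty}^\infty|x|^p\phi(x)\,dx.$$ $\stackrel{\mathcal D}{\to}$ denotes convergence in distribution, and $O_P(1)$ means bounded in probability as $N\to\infty$. *)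

theory Defs
  imports "HOL-Probability.Probability"
begin

text \<open>Continuity of paths and \<open>W 0 = 0\<close> are only required almost surely.\<close>

definition wiener_process_on :: "'a measure \<Rightarrow> real \<Rightarrow> (real \<Rightarrow> 'a \<Rightarrow> real) \<Rightarrow> bool" where
  "wiener_process_on M T W \<longleftrightarrow>
     (\<forall>t\<in>{0..T}. W t \<in> borel_measurable M) \<and>
     (AE \<omega> in M. W 0 \<omega> = 0) \<and>
     (AE \<omega> in M. continuous_on {0..T} (\<lambda>t. W t \<omega>)) \<and>
     (\<forall>s t. 0 \<le> s \<and> s < t \<and> t \<le> T \<longrightarrow>
        distributed M lborel (\<lambda>\<omega>. W t \<omega> - W s \<omega>) (\<lambda>x. ennreal (normal_density 0 (sqrt (t - s)) x))) \<and>
     (\<forall>(n::nat) (\<tau>::nat \<Rightarrow> real).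
        0 \<le> \<tau> 0 \<and> (\<forall>i<n. \<tau> i \<le> \<tau> (Suc i)) \<and> \<tau> n \<le> T \<longrightarrow>
        prob_space.indep_vars M (\<lambda>_. borel) (\<lambda>i \<omega>. W (\<tau> (Suc i)) \<omega> - W (\<tau> i) \<omega>) {..<n})"

text \<open>Independence of two processes as random elements of the product space over the
  time set, i.e. independence of the \<open>\<sigma>\<close>-algebras they generate.\<close>

definition indep_processes_on ::
    "'a measure \<Rightarrow> real \<Rightarrow> (real \<Rightarrow> 'a \<Rightarrow> real) \<Rightarrow> (real \<Rightarrow> 'a \<Rightarrow> real) \<Rightarrow> bool" where
  "indep_processes_on M T V W \<longleftrightarrow>
     prob_space.indep_var M
       (PiM {0..T} (\<lambda>_. borel)) (\<lambda>\<omega>. \<lambda>t\<in>{0..T}. V t \<omega>)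
       (PiM {0..T} (\<lambda>_. borel)) (\<lambda>\<omega>. \<lambda>t\<in>{0..T}. W t \<omega>)"

definition bounded_in_probability :: "'a measure \<Rightarrow> (nat \<Rightarrow> 'a \<Rightarrow> real) \<Rightarrow> bool" where
  "bounded_in_probability M Y \<longleftrightarrow>
     (\<forall>\<delta>>0. \<exists>C. \<forall>\<^sub>F N in sequentially. measure M {\<omega>\<in>space M. \<bar>Y N \<omega>\<bar> > C} < \<delta>)"

text \<open>Here \<open>x\<close> is a sample \<open>x 1, x 2, \<dots>\<close>; the value \<open>x 0\<close> is never used.\<close>

definition cusum :: "(nat \<Rightarrow> real) \<Rightarrow> nat \<Rightarrow> real \<Rightarrow> real" where
  "cusum x N s = (\<Sum>i=1..nat \<lfloor>s\<rfloor>. x i) - real_of_int \<lfloor>s\<rfloor> / real N * (\<Sum>i=1..N. x i)"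

definition cusum_process :: "(nat \<Rightarrow> real) \<Rightarrow> nat \<Rightarrow> real \<Rightarrow> real" where
  "cusum_process x N t =
     (if 0 \<le> t \<and> t < 1 then real N powr (-1/2) * cusum x N ((real N + 1) * t) else 0)"

text \<open>The integrand of \<open>a\<close> is absolutely integrable over \<open>\<real>\<^sup>3\<close> for \<open>p \<ge> 1\<close>, so the triple integral
  agrees with this iterated one; the slice \<open>u = 0\<close>, where HOL's division by zero
  convention applies, is a null set.\<close>

definition a_const :: "real \<Rightarrow> real" where
  "a_const p =
     (LBINT u. (LBINT y. (LBINT x.
        \<bar>x * y\<bar> powr p *
        (1 / (2 * pi * sqrt (1 - exp (-2 * \<bar>u\<bar>))) *
           exp (- ((x\<^sup>2 + y\<^sup>2 - 2 * exp (- \<bar>u\<bar>) * x * y) / (2 * (1 - exp (-2 * \<bar>u\<bar>)))))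
         - std_normal_density x * std_normal_density y))))"

definition b_const :: "real \<Rightarrow> real" where
  "b_const p = (LBINT x. \<bar>x\<bar> powr p * std_normal_density x)"

end

theory Submission
  imports Defs "HOL-Real_Asymp.Real_Asymp"
begin

text \<open>
  Near the left end point the weight turns the integral into \<open>\<Sum>\<^sub>k \<bar>W k / \<surd>k\<bar>\<^sup>p / k\<close> for the Gaussian
  random walk \<open>W k\<close> obtained by sampling the Wiener process at integer times, and likewise near the
  right end point with the second, independent process. The invariance principle, the rounding of
  the weight and the bridge term \<open>(k / N) \<Sum>\<^sub>i \<epsilon>\<^sub>i\<close> only contribute errors that stay bounded in
  probability, which vanish after division by \<open>\<surd>(ln N)\<close>. On the logarithmic scale the
  summands are nearly stationary: the correlation of \<open>W j / \<surd>j\<close> and \<open>W k / \<surd>k\<close> is \<open>\<surd>(j / k)\<close>, so the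
  variance is a Riemann sum for \<open>a_const p\<close>, and the sums over dyadic blocks of \<open>k\<close> become independent
  exponentially fast, because \<open>W k\<close> may be replaced by \<open>W k - W (2\<^sup>r)\<close> at relative cost \<open>\<surd>(2\<^sup>r / k)\<close>.
  Bernstein's method of big and small blocks then yields the central limit theorem.
\<close>

subsection \<open>Square-integrable random variables\<close>

text \<open>The Wiener processes for different \<open>N\<close> come without any joint law, so no
  single sequence of variables can be followed. Characteristic functions avoid this: for fixed
  \<open>N\<close>, that of a power sum over \<open>W1 N\<close> depends only on the number of
  terms, hence equals that of a walk on one canonical space, where the limit is proved once. The
  constants in the hypotheses are bounded only in probability; they are gathered into one random
  factor \<open>(1 + B N \<omega>) powr p\<close> multiplying a sum of bounded expectation. Neither
  hypothesis at \<open>N\<close> reaches the sum of all \<open>N\<close> errors, which enters every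
  bridge term; its size is read off the first hypothesis at \<open>2 * N\<close>. Dyadic blocks are
  the right unit because the weights \<open>1 / k\<close> add up to at most 1 on each, so block
  moments are uniformly bounded. Each end contributes a variance of about
  \<open>2 * a_const p * ln N\<close>, whence the factor 4. Since the statistic is divided by the
  root of it, \<open>a_const p > 0\<close> has to be proved; this rests on the monotonicity of a
  Gaussian conditional expectation.\<close>

lemma norm_iexp_diff: "cmod (iexp a - iexp b) \<le> \<bar>a - b\<bar>"
proof -
  have "iexp a - iexp b = iexp b * (iexp (a - b) - 1)"
    by (simp add: right_diff_distrib exp_add[symmetric] algebra_simps)
  then have "cmod (iexp a - iexp b) = cmod (iexp (a - b) - 1)"
    by (simp add: norm_mult)
  also have "\<dots> \<le> \<bar>a - b\<bar>" using iexp_approx1[of "a - b" 0] by simp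
  finally show ?thesis .
qed

context prob_space
begin

definition L2 :: "('a \<Rightarrow> real) \<Rightarrow> bool" where
  "L2 f \<longleftrightarrow> f \<in> borel_measurable M \<and> integrable M (\<lambda>x. (f x)\<^sup>2)"

text \<open>A Bochner integral that does not exist has value 0, so this behaves as a norm only where
  \<open>L2\<close> holds; the triangle inequalities below carry \<open>L2\<close> as a
  hypothesis.\<close>

definition L2norm :: "('a \<Rightarrow> real) \<Rightarrow> real" where
  "L2norm f = sqrt (expectation (\<lambda>x. (f x)\<^sup>2))"

lemma L2_measurable: "L2 f \<Longrightarrow> f \<in> borel_measurable M"
  and L2_integrable_sq: "L2 f \<Longrightarrow> integrable M (\<lambda>x. (f x)\<^sup>2)"
  by (auto simp: L2_def)

lemma L2_integrable: "L2 f \<Longrightarrow> integrable M f"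
  unfolding L2_def by (rule square_integrable_imp_integrable) auto

lemma L2_integrable_mult:
  assumes "L2 f" "L2 g"
  shows "integrable M (\<lambda>x. f x * g x)"
proof (rule Bochner_Integration.integrable_bound)
  show "integrable M (\<lambda>x. (f x)\<^sup>2 + (g x)\<^sup>2)"
    using assms by (simp add: L2_def)
  show "(\<lambda>x. f x * g x) \<in> borel_measurable M"
    using assms[THEN L2_measurable] by simp
  show "AE x in M. norm (f x * g x) \<le> norm ((f x)\<^sup>2 + (g x)\<^sup>2)"
  proof (rule AE_I2)
    fix x
    have "2 * (\<bar>f x\<bar> * \<bar>g x\<bar>) \<le> (f x)\<^sup>2 + (g x)\<^sup>2"
      using sum_squares_bound[of "\<bar>f x\<bar>" "\<bar>g x\<bar>"] by simp
    moreover have "0 \<le> \<bar>f x\<bar> * \<bar>g x\<bar>" by simp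
    ultimately show "norm (f x * g x) \<le> norm ((f x)\<^sup>2 + (g x)\<^sup>2)"
      unfolding real_norm_def abs_mult by linarith
  qed
qed

lemma L2_add: assumes "L2 f" "L2 g" shows "L2 (\<lambda>x. f x + g x)"
proof -
  have [measurable]: "f \<in> borel_measurable M" "g \<in> borel_measurable M"
    using assms by (simp_all add: L2_def)
  have "integrable M (\<lambda>x. (f x)\<^sup>2 + (g x)\<^sup>2 + 2 * (f x * g x))"
    using assms L2_integrable_mult[OF assms] by (simp add: L2_def)
  then show ?thesis by (simp add: L2_def power2_sum mult.assoc)
qed

lemma L2_cmult: "L2 f \<Longrightarrow> L2 (\<lambda>x. c * f x)"
  by (auto simp: L2_def power_mult_distrib)

lemma L2_const: "L2 (\<lambda>x. c)"
  by (auto simp: L2_def)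

lemma L2_diff: assumes "L2 f" "L2 g" shows "L2 (\<lambda>x. f x - g x)"
  using L2_add[OF assms(1) L2_cmult[OF assms(2), of "-1"]] by simp

lemma L2_sum: "(\<And>i. i \<in> A \<Longrightarrow> L2 (f i)) \<Longrightarrow> L2 (\<lambda>x. \<Sum>i\<in>A. f i x)"
proof (induction A rule: infinite_finite_induct)
  case (insert i A)
  then show ?case using L2_add[of "f i" "\<lambda>x. \<Sum>i\<in>A. f i x"] by simp
qed (simp_all add: L2_const)

lemma L2_abs: "L2 f \<Longrightarrow> L2 (\<lambda>x. \<bar>f x\<bar>)"
  by (auto simp: L2_def)

lemma L2norm_nonneg: "0 \<le> L2norm f"
  by (simp add: L2norm_def)

lemma L2norm_sq: "(L2norm f)\<^sup>2 = expectation (\<lambda>x. (f x)\<^sup>2)"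
  by (simp add: L2norm_def)

lemma L2norm_abs: "L2norm (\<lambda>x. \<bar>f x\<bar>) = L2norm f"
  by (simp add: L2norm_def)

lemma L2norm_leI: "expectation (\<lambda>x. (f x)\<^sup>2) \<le> c\<^sup>2 \<Longrightarrow> 0 \<le> c \<Longrightarrow> L2norm f \<le> c"
  unfolding L2norm_def by (rule real_le_lsqrt) auto

lemma L2norm_cmult: "L2norm (\<lambda>x. c * f x) = \<bar>c\<bar> * L2norm f"
  by (simp add: L2norm_def power_mult_distrib real_sqrt_mult)

text \<open>Nonnegativity of the quadratic \<open>s \<mapsto> E (f + s g)\<^sup>2\<close> gives the discriminant inequality.\<close>

lemma expectation_mult_le:
  assumes "L2 f" "L2 g"
  shows "\<bar>expectation (\<lambda>x. f x * g x)\<bar> \<le> L2norm f * L2norm g"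
proof -
  define a b c where "a = expectation (\<lambda>x. (f x)\<^sup>2)" and "b = expectation (\<lambda>x. f x * g x)"
    and "c = expectation (\<lambda>x. (g x)\<^sup>2)"
  have q: "0 \<le> a + s * 2 * b + s\<^sup>2 * c" for s
  proof -
    have "0 \<le> expectation (\<lambda>x. (f x + s * g x)\<^sup>2)" by simp
    also have "(\<lambda>x. (f x + s * g x)\<^sup>2) = (\<lambda>x. (f x)\<^sup>2 + s * 2 * (f x * g x) + s\<^sup>2 * (g x)\<^sup>2)"
      by (auto simp: fun_eq_iff power2_eq_square algebra_simps)
    also have "expectation \<dots> = a + s * 2 * b + s\<^sup>2 * c"
      using assms L2_integrable_mult[OF assms] by (simp add: a_def b_def c_def L2_def)
    finally show ?thesis .
  qed
  have c0: "0 \<le> c" and a0: "0 \<le> a" by (simp_all add: c_def a_def)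
  have "b\<^sup>2 \<le> a * c"
  \<comment> \<open>For \<open>c = 0\<close> the quadratic is affine in \<open>s\<close>, and a
    nonzero \<open>b\<close> would let \<open>s = -(a+1)/(2*b)\<close> push it to -1. Otherwise its
    minimiser \<open>s = -b/c\<close> yields the bound.\<close>
  proof (cases "c = 0")
    case True
    have "b = 0"
    proof (rule ccontr)
      assume "b \<noteq> 0"
      then have "(-(a+1)/(2*b)) * 2 * b = -(a+1)" by simp
      with q[of "-(a+1)/(2*b)"] True show False by simp
    qed
    with True show ?thesis by simp
  next
    case False
    with c0 have c: "0 < c" by simp
    have "0 \<le> a - b\<^sup>2 / c"
      using q[of "-b/c"] c by (simp add: power2_eq_square field_simps)
    with c show ?thesis by (simp add: field_simps)
  qed
  then have "\<bar>b\<bar> \<le> sqrt (a * c)"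
    using real_le_rsqrt[of "\<bar>b\<bar>" "a * c"] by simp
  then show ?thesis by (simp add: L2norm_def real_sqrt_mult a_def b_def c_def)
qed

lemma expectation_abs_le:
  assumes "L2 f" shows "expectation (\<lambda>x. \<bar>f x\<bar>) \<le> L2norm f"
proof -
  have "L2norm (\<lambda>x. 1) = 1" by (simp add: L2norm_def prob_space)
  then show ?thesis
    using expectation_mult_le[OF L2_abs[OF assms] L2_const[of 1]] by (simp add: L2norm_abs)
qed

lemma L2norm_add:
  assumes "L2 f" "L2 g"
  shows "L2norm (\<lambda>x. f x + g x) \<le> L2norm f + L2norm g"
proof (rule L2norm_leI)
  have "expectation (\<lambda>x. (f x + g x)\<^sup>2) = expectation (\<lambda>x. (f x)\<^sup>2 + 2 * (f x * g x) + (g x)\<^sup>2)"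
    by (simp add: power2_sum algebra_simps)
  also have "\<dots> = (L2norm f)\<^sup>2 + 2 * expectation (\<lambda>x. f x * g x) + (L2norm g)\<^sup>2"
    using assms L2_integrable_mult[OF assms] by (simp add: L2norm_sq L2_def)
  also have "\<dots> \<le> (L2norm f + L2norm g)\<^sup>2"
    using expectation_mult_le[OF assms] by (simp add: power2_sum)
  finally show "expectation (\<lambda>x. (f x + g x)\<^sup>2) \<le> (L2norm f + L2norm g)\<^sup>2" .
qed (simp add: L2norm_nonneg)

lemma L2norm_diff:
  assumes "L2 f" "L2 g"
  shows "L2norm (\<lambda>x. f x - g x) \<le> L2norm f + L2norm g"
  using L2norm_add[OF assms(1) L2_cmult[OF assms(2), of "-1"]] L2norm_cmult[of "-1" g] by simp

lemma L2norm_diff_abs: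
  assumes "L2 f" "L2 g"
  shows "\<bar>L2norm f - L2norm g\<bar> \<le> L2norm (\<lambda>x. f x - g x)"
  using L2norm_add[OF L2_diff[OF assms] assms(2)] L2norm_diff[OF assms(1) L2_diff[OF assms]]
  by simp

lemma L2norm_sum:
  assumes "\<And>i. i \<in> A \<Longrightarrow> L2 (f i)"
  shows "L2norm (\<lambda>x. \<Sum>i\<in>A. f i x) \<le> (\<Sum>i\<in>A. L2norm (f i))"
  using assms
proof (induction A rule: infinite_finite_induct)
  case (insert i A)
  have "L2norm (\<lambda>x. \<Sum>i\<in>insert i A. f i x) \<le> L2norm (f i) + L2norm (\<lambda>x. \<Sum>i\<in>A. f i x)"
    using insert by (simp add: L2norm_add L2_sum)
  with insert show ?case by force
qed (auto simp: L2norm_def)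

lemma integrable_iexp_real:
  "f \<in> borel_measurable M \<Longrightarrow> integrable M (\<lambda>x. iexp (u * f x))"
  by (intro integrable_const_bound[of _ 1]) auto

text \<open>Since \<open>iexp\<close> is 1-Lipschitz, closeness in mean becomes closeness of
  characteristic functions. Every replacement inside the central limit theorem (dropping gaps,
  restarting a block, completing a dyadic level) is paid for with this bound.\<close>

lemma norm_expectation_iexp_diff:
  assumes "integrable M f" "integrable M g"
  shows "cmod ((CLINT x|M. iexp (u * f x)) - (CLINT x|M. iexp (u * g x)))
         \<le> \<bar>u\<bar> * expectation (\<lambda>x. \<bar>f x - g x\<bar>)"
proof -
  have I: "integrable M (\<lambda>x. iexp (u * f x))" "integrable M (\<lambda>x. iexp (u * g x))"
    by (intro integrable_iexp_real borel_measurable_integrable assms)+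
  have "cmod ((CLINT x|M. iexp (u * f x)) - (CLINT x|M. iexp (u * g x)))
      = cmod (CLINT x|M. iexp (u * f x) - iexp (u * g x))"
    using I by simp
  also have "\<dots> \<le> expectation (\<lambda>x. cmod (iexp (u * f x) - iexp (u * g x)))"
    by (rule integral_norm_bound)
  also have "\<dots> \<le> expectation (\<lambda>x. \<bar>u\<bar> * \<bar>f x - g x\<bar>)"
  proof (rule integral_mono)
    show "integrable M (\<lambda>x. cmod (iexp (u * f x) - iexp (u * g x)))" using I by simp
    show "integrable M (\<lambda>x. \<bar>u\<bar> * \<bar>f x - g x\<bar>)" using assms by simp
    show "cmod (iexp (u * f x) - iexp (u * g x)) \<le> \<bar>u\<bar> * \<bar>f x - g x\<bar>" for x
      using norm_iexp_diff[of "u * f x" "u * g x"] by (simp add: abs_mult[symmetric] algebra_simps)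
  qed
  also have "\<dots> = \<bar>u\<bar> * expectation (\<lambda>x. \<bar>f x - g x\<bar>)" by simp
  finally show ?thesis .
qed

lemma norm_expectation_iexp_le_1:
  assumes "f \<in> borel_measurable M"
  shows "cmod (CLINT x|M. iexp (u * f x)) \<le> 1"
proof -
  have "cmod (CLINT x|M. iexp (u * f x)) \<le> expectation (\<lambda>x. cmod (iexp (u * f x)))"
    by (rule integral_norm_bound)
  also have "\<dots> = 1" by (simp add: prob_space)
  finally show ?thesis .
qed

lemma expectation_iexp_indep:
  assumes "indep_var borel f borel g"
  shows "(CLINT x|M. iexp (u * (f x + g x))) = (CLINT x|M. iexp (u * f x)) * (CLINT x|M. iexp (u * g x))"
proof -
  have [measurable]: "f \<in> borel_measurable M" "g \<in> borel_measurable M"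
    using assms indep_var_rv1 indep_var_rv2 by auto
  show ?thesis using char_distr_add[OF assms, of u] by (simp add: char_def integral_distr)
qed

end

text \<open>Cauchy-Schwarz twice, with each weight split as \<open>sqrt (w i) * sqrt (w i)\<close>.
  It serves with weights 1 for sums over blocks and with weights \<open>1 / k\<close> inside a
  dyadic level.\<close>

lemma power4_sum_le:
  fixes x :: "'i \<Rightarrow> real"
  assumes "finite A" "\<And>i. i \<in> A \<Longrightarrow> 0 \<le> w i"
  shows "(\<Sum>i\<in>A. w i * x i) ^ 4 \<le> (\<Sum>i\<in>A. w i) ^ 3 * (\<Sum>i\<in>A. w i * x i ^ 4)"
proof -
  have cs: "(\<Sum>i\<in>A. w i * y i)\<^sup>2 \<le> (\<Sum>i\<in>A. w i) * (\<Sum>i\<in>A. w i * (y i)\<^sup>2)" for y :: "'i \<Rightarrow> real"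
  proof -
    have "(\<Sum>i\<in>A. w i * y i)\<^sup>2 = (\<Sum>i\<in>A. sqrt (w i) * (sqrt (w i) * y i))\<^sup>2"
      using assms(2) by (simp add: mult.assoc[symmetric])
    also have "\<dots> \<le> (\<Sum>i\<in>A. (sqrt (w i))\<^sup>2) * (\<Sum>i\<in>A. (sqrt (w i) * y i)\<^sup>2)"
      by (rule Cauchy_Schwarz_ineq_sum)
    also have "\<dots> = (\<Sum>i\<in>A. w i) * (\<Sum>i\<in>A. w i * (y i)\<^sup>2)"
      using assms by (simp add: power_mult_distrib)
    finally show ?thesis .
  qed
  have W: "0 \<le> (\<Sum>i\<in>A. w i)" using assms by (simp add: sum_nonneg)
  have "(\<Sum>i\<in>A. w i * x i) ^ 4 = ((\<Sum>i\<in>A. w i * x i)\<^sup>2)\<^sup>2" by simp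
  also have "\<dots> \<le> ((\<Sum>i\<in>A. w i) * (\<Sum>i\<in>A. w i * (x i)\<^sup>2))\<^sup>2"
    by (intro power_mono cs) auto
  also have "\<dots> = (\<Sum>i\<in>A. w i)\<^sup>2 * (\<Sum>i\<in>A. w i * (x i)\<^sup>2)\<^sup>2" by (simp add: power_mult_distrib)
  also have "\<dots> \<le> (\<Sum>i\<in>A. w i)\<^sup>2 * ((\<Sum>i\<in>A. w i) * (\<Sum>i\<in>A. w i * ((x i)\<^sup>2)\<^sup>2))"
    by (intro mult_left_mono cs) auto
  also have "\<dots> = (\<Sum>i\<in>A. w i) ^ 3 * (\<Sum>i\<in>A. w i * x i ^ 4)"
    by (simp add: power2_eq_square power3_eq_cube power4_eq_xxxx mult.assoc)
  finally show ?thesis .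
qed

subsection \<open>A central limit theorem for geometrically mixing sequences\<close>

text \<open>Distinct exponents make this a subsum of the geometric series. The form with an
  injective \<open>h\<close> fits distances from a fixed index to the members of an arbitrary finite
  set.\<close>

lemma sum_geometric_inj_le:
  fixes \<theta> :: real
  assumes "0 \<le> \<theta>" "\<theta> < 1" "finite A" "inj_on h A"
  shows "(\<Sum>s\<in>A. \<theta> ^ (h s :: nat)) \<le> 1 / (1 - \<theta>)"
proof -
  have "(\<Sum>s\<in>A. \<theta> ^ h s) = (\<Sum>i\<in>h ` A. \<theta> ^ i)"
    using assms by (simp add: sum.reindex)
  also have "\<dots> \<le> (\<Sum>i. \<theta> ^ i)"
    using assms by (intro sum_le_suminf) auto
  also have "\<dots> = 1 / (1 - \<theta>)" using assms by (simp add: suminf_geometric)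
  finally show ?thesis .
qed

text \<open>The upper half comes from \<open>(1 - x + x^2/2) * (1 + x + x^2/2) = 1 + x^4/4\<close>,
  which is at least 1, together with the quadratic lower bound for \<open>exp x\<close>.\<close>

lemma abs_exp_minus_le:
  fixes x :: real
  assumes "0 \<le> x"
  shows "\<bar>exp (-x) - (1 - x)\<bar> \<le> x\<^sup>2 / 2"
proof -
  have "exp x \<ge> 1 + x + x\<^sup>2 / 2"
    by (rule exp_lower_Taylor_quadratic[OF assms])
  moreover have "0 < 1 - x + x\<^sup>2 / 2"
  proof -
    have "1 - x + x\<^sup>2 / 2 = ((1 - x)\<^sup>2 + 1) / 2" by (simp add: power2_eq_square field_simps)
    also have "\<dots> > 0" by (simp add: add_nonneg_pos)
    finally show ?thesis .
  qed
  ultimately have "(1 - x + x\<^sup>2 / 2) * exp x \<ge> (1 - x + x\<^sup>2 / 2) * (1 + x + x\<^sup>2 / 2)"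
    by (intro mult_left_mono) auto
  moreover have "(1 - x + x\<^sup>2 / 2) * (1 + x + x\<^sup>2 / 2) = 1 + (x\<^sup>2)\<^sup>2 / 4"
    by (simp add: power2_eq_square field_simps)
  ultimately have "1 \<le> (1 - x + x\<^sup>2 / 2) * exp x"
    by (smt (verit) zero_le_power2 divide_nonneg_nonneg)
  then have "exp (-x) \<le> 1 - x + x\<^sup>2 / 2" by (simp add: exp_minus field_simps)
  moreover have "1 - x \<le> exp (-x)" using exp_ge_add_one_self[of "-x"] by simp
  ultimately show ?thesis by simp
qed

text \<open>Both functions are compared with \<open>1 - u^2 * v / 2\<close>, where \<open>v\<close>
  is the variance. The third moment in the Taylor error is traded for the fourth by
  \<open>|X|^3 \<le> 1 + X^4\<close>, because only fourth moments are tracked; numerical factors are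
  rounded up to 1.\<close>

lemma (in prob_space) norm_expectation_iexp_gaussian:
  assumes [measurable]: "X \<in> borel_measurable M"
    and X4: "integrable M (\<lambda>x. X x ^ 4)" and mean: "expectation X = 0"
  shows "cmod ((CLINT x|M. iexp (u * X x)) - exp (- (u\<^sup>2 * expectation (\<lambda>x. (X x)\<^sup>2) / 2)))
    \<le> \<bar>u\<bar> ^ 3 * (1 + expectation (\<lambda>x. X x ^ 4)) + u ^ 4 * (expectation (\<lambda>x. (X x)\<^sup>2))\<^sup>2"
proof -
  define v where "v = expectation (\<lambda>x. (X x)\<^sup>2)"
  have v0: "0 \<le> v" by (simp add: v_def)
  have X2: "integrable M (\<lambda>x. (X x)\<^sup>2)"
    by (rule square_integrable_imp_integrable[of "\<lambda>x. (X x)\<^sup>2"]) (use X4 in \<open>simp_all add: power_mult[symmetric]\<close>)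
  have X1: "integrable M X"
    using X2 by (rule square_integrable_imp_integrable[of X, rotated]) auto
  have var: "variance X = v" using mean by (simp add: v_def)
  have "cmod (char (distr M borel X) u - (1 - u\<^sup>2 * v / 2)) \<le>
    (u\<^sup>2 / 6) * expectation (\<lambda>x. min (6 * (X x)\<^sup>2) (\<bar>u\<bar> * \<bar>X x\<bar>^3))"
    by (rule char_approx3'[OF _ X1 X2 mean var refl]) simp
  also have "\<dots> \<le> (u\<^sup>2 / 6) * expectation (\<lambda>x. \<bar>u\<bar> * (1 + X x ^ 4))"
  proof (intro mult_left_mono integral_mono)
    show "integrable M (\<lambda>x. min (6 * (X x)\<^sup>2) (\<bar>u\<bar> * \<bar>X x\<bar>^3))"
      by (rule Bochner_Integration.integrable_bound[where f="\<lambda>x. 6 * (X x)\<^sup>2"]) (auto simp: X2)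
    show "integrable M (\<lambda>x. \<bar>u\<bar> * (1 + X x ^ 4))" using X4 by auto
    fix x
    have "\<bar>X x\<bar> ^ 3 \<le> 1 + X x ^ 4"
    proof (cases "\<bar>X x\<bar> \<le> 1")
      case True
      then have "\<bar>X x\<bar> ^ 3 \<le> 1" by (simp add: power_le_one)
      then show ?thesis by (simp add: add_increasing2)
    next
      case False
      then have "\<bar>X x\<bar> ^ 3 \<le> \<bar>X x\<bar> ^ 4" by (intro power_increasing) auto
      then show ?thesis by (simp add: power_abs[symmetric] power_even_abs)
    qed
    then have "\<bar>u\<bar> * \<bar>X x\<bar> ^ 3 \<le> \<bar>u\<bar> * (1 + X x ^ 4)" by (intro mult_left_mono) auto
    then show "min (6 * (X x)\<^sup>2) (\<bar>u\<bar> * \<bar>X x\<bar>^3) \<le> \<bar>u\<bar> * (1 + X x ^ 4)" by linarith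
  qed auto
  also have "\<dots> = \<bar>u\<bar> ^ 3 * (1 + expectation (\<lambda>x. X x ^ 4)) / 6"
    using X4 by (simp add: prob_space power2_eq_square power3_eq_cube)
  also have "\<dots> \<le> \<bar>u\<bar> ^ 3 * (1 + expectation (\<lambda>x. X x ^ 4))"
  proof -
    have "0 \<le> \<bar>u\<bar> ^ 3 * (1 + expectation (\<lambda>x. X x ^ 4))"
      by (intro mult_nonneg_nonneg add_nonneg_nonneg integral_nonneg_AE) auto
    then show ?thesis by simp
  qed
  finally have 1: "cmod (char (distr M borel X) u - (1 - u\<^sup>2 * v / 2)) \<le> \<bar>u\<bar> ^ 3 * (1 + expectation (\<lambda>x. X x ^ 4))" .
  have 2: "cmod ((1 - u\<^sup>2 * v / 2) - exp (- (u\<^sup>2 * v / 2))) \<le> u ^ 4 * v\<^sup>2"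
  proof -
    have "cmod ((1 - u\<^sup>2 * v / 2) - exp (- (u\<^sup>2 * v / 2))) = \<bar>exp (- (u\<^sup>2 * v / 2)) - (1 - u\<^sup>2 * v / 2)\<bar>"
      by (metis norm_minus_commute norm_of_real of_real_1 of_real_diff)
    also have "\<dots> \<le> (u\<^sup>2 * v / 2)\<^sup>2 / 2" using v0 by (intro abs_exp_minus_le) simp
    also have "\<dots> = u ^ 4 * v\<^sup>2 / 8" by (simp add: power_mult_distrib power_divide)
    also have "\<dots> \<le> u ^ 4 * v\<^sup>2" by (simp add: field_simps)
    finally show ?thesis .
  qed
  have "char (distr M borel X) u = (CLINT x|M. iexp (u * X x))"
    by (simp add: char_def integral_distr)
  then show ?thesis
    using norm_triangle_ineq[of "(CLINT x|M. iexp (u * X x)) - (1 - u\<^sup>2 * v / 2)" "(1 - u\<^sup>2 * v / 2) - exp (- (u\<^sup>2 * v / 2))"] 1 2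
    by (simp add: v_def[symmetric])
qed

text \<open>\<open>V' r s\<close> stands for a version of \<open>V s\<close> that ignores what
  happened before time \<open>r\<close>; the cost of the exchange in mean square decays
  geometrically in \<open>s - r\<close>. Independence is asked directly of sums of original
  variables before \<open>r\<close> and of substituted ones from \<open>r\<close> on, the form in
  which blocks meet. One \<open>K\<close> bounds both the moments and the exchange.\<close>

locale geometric_mixing = prob_space +
  fixes V :: "nat \<Rightarrow> 'a \<Rightarrow> real" and V' :: "nat \<Rightarrow> nat \<Rightarrow> 'a \<Rightarrow> real" and K \<theta> :: real
  assumes V_measurable [measurable]: "V s \<in> borel_measurable M"
    and V'_measurable [measurable]: "V' r s \<in> borel_measurable M"
    and V_mean: "expectation (V s) = 0"
    and V_pow4: "integrable M (\<lambda>\<omega>. V s \<omega> ^ 4)" "expectation (\<lambda>\<omega>. V s \<omega> ^ 4) \<le> K ^ 4"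
    and V_approx: "r \<le> s \<Longrightarrow> integrable M (\<lambda>\<omega>. (V s \<omega> - V' r s \<omega>)\<^sup>2)"
      "r \<le> s \<Longrightarrow> expectation (\<lambda>\<omega>. (V s \<omega> - V' r s \<omega>)\<^sup>2) \<le> (K * \<theta> ^ (s - r))\<^sup>2"
    and K: "0 \<le> K" and \<theta>: "0 < \<theta>" "\<theta> < 1"
    and indep: "A \<subseteq> {..<r} \<Longrightarrow> B \<subseteq> {r..} \<Longrightarrow> finite B \<Longrightarrow>
      indep_var borel (\<lambda>\<omega>. \<Sum>s\<in>A. V s \<omega>) borel (\<lambda>\<omega>. \<Sum>s\<in>B. V' r s \<omega>)"
begin

text \<open>Variance bound per summand: \<open>K^2\<close> for the diagonal term and twice a
  geometric series for the covariances with all earlier indices.\<close>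

definition var_bound :: real where "var_bound = K\<^sup>2 + 2 * (K\<^sup>2 / (1 - \<theta>))"

text \<open>The cost in L2 norm of restarting a whole block whose first index lies at least
  \<open>l\<close> after the restart, whatever the length of the block.\<close>

definition mix_error :: "nat \<Rightarrow> real" where "mix_error l = K * (\<theta> ^ l / (1 - \<theta>))"

lemma var_bound_nonneg: "0 \<le> var_bound"
  using \<theta> by (simp add: var_bound_def)

lemma mix_error_nonneg: "0 \<le> mix_error l"
  using \<theta> K by (simp add: mix_error_def)

lemma L2_V: "L2 (V s)"
proof -
  have "integrable M (\<lambda>x. (V s x)\<^sup>2)"
    by (rule square_integrable_imp_integrable[of "\<lambda>x. (V s x)\<^sup>2"])
      (use V_pow4(1)[of s] in \<open>simp_all add: power_mult[symmetric]\<close>)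
  then show ?thesis by (simp add: L2_def)
qed

lemma L2_V': "r \<le> s \<Longrightarrow> L2 (V' r s)"
proof -
  assume "r \<le> s"
  then have "L2 (\<lambda>\<omega>. V s \<omega> - V' r s \<omega>)" using V_approx(1) by (simp add: L2_def)
  from L2_diff[OF L2_V[of s] this] show ?thesis by simp
qed

lemma L2_sum_V: "L2 (\<lambda>\<omega>. \<Sum>s\<in>A. V s \<omega>)"
  by (rule L2_sum) (rule L2_V)

lemma L2norm_V: "L2norm (V s) \<le> K"
proof -
  have L: "L2 (\<lambda>x. (V s x)\<^sup>2)" using V_pow4(1)[of s] by (simp add: L2_def power_mult[symmetric])
  have "expectation (\<lambda>x. \<bar>(V s x)\<^sup>2\<bar>) \<le> L2norm (\<lambda>x. (V s x)\<^sup>2)"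
    by (rule expectation_abs_le[OF L])
  also have "\<dots> \<le> K\<^sup>2"
    using V_pow4(2)[of s] by (intro L2norm_leI) (simp_all add: power_mult[symmetric])
  finally show ?thesis using K by (intro L2norm_leI) simp_all
qed

lemma L2norm_approx: "r \<le> s \<Longrightarrow> L2norm (\<lambda>\<omega>. V s \<omega> - V' r s \<omega>) \<le> K * \<theta> ^ (s - r)"
  using V_approx(2)[of r s] K \<theta> by (intro L2norm_leI) simp_all

lemma sum_V_mean: "expectation (\<lambda>\<omega>. \<Sum>s\<in>A. V s \<omega>) = 0"
  by (subst Bochner_Integration.integral_sum) (auto intro: L2_integrable L2_V simp: V_mean)

text \<open>Restarting \<open>V t\<close> right after time \<open>s\<close> makes it independent of
  the centred \<open>V s\<close>, so the product then has mean 0, and Cauchy-Schwarz bounds what the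
  exchange leaves over.\<close>

lemma covariance_le:
  assumes "s < t"
  shows "\<bar>expectation (\<lambda>\<omega>. V s \<omega> * V t \<omega>)\<bar> \<le> K\<^sup>2 * \<theta> ^ (t - Suc s)"
proof -
  have st: "Suc s \<le> t" using assms by simp
  have i: "indep_var borel (V s) borel (V' (Suc s) t)"
    using indep[of "{s}" "Suc s" "{t}"] st by simp
  have L': "L2 (\<lambda>\<omega>. V t \<omega> - V' (Suc s) t \<omega>)" by (intro L2_diff L2_V L2_V' st)
  have "expectation (\<lambda>\<omega>. V s \<omega> * V' (Suc s) t \<omega>) = expectation (V s) * expectation (V' (Suc s) t)"
    by (intro indep_var_lebesgue_integral i L2_integrable L2_V L2_V' st)
  then have 0: "expectation (\<lambda>\<omega>. V s \<omega> * V' (Suc s) t \<omega>) = 0" by (simp add: V_mean)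
  have "expectation (\<lambda>\<omega>. V s \<omega> * V t \<omega>)
    = expectation (\<lambda>\<omega>. V s \<omega> * (V t \<omega> - V' (Suc s) t \<omega>) + V s \<omega> * V' (Suc s) t \<omega>)"
    by (simp add: algebra_simps)
  also have "\<dots> = expectation (\<lambda>\<omega>. V s \<omega> * (V t \<omega> - V' (Suc s) t \<omega>))"
    using L2_integrable_mult[OF L2_V L'] L2_integrable_mult[OF L2_V L2_V'[OF st]] 0 by simp
  finally have "\<bar>expectation (\<lambda>\<omega>. V s \<omega> * V t \<omega>)\<bar> \<le> L2norm (V s) * L2norm (\<lambda>\<omega>. V t \<omega> - V' (Suc s) t \<omega>)"
    using expectation_mult_le[OF L2_V L'] by simp
  also have "\<dots> \<le> K * (K * \<theta> ^ (t - Suc s))"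
    by (intro mult_mono L2norm_V L2norm_approx st L2norm_nonneg K)
  finally show ?thesis by (simp add: power2_eq_square mult.assoc)
qed

text \<open>Elements are added in increasing order; the covariances of a new largest index with the
  earlier ones are summed by a geometric series, however \<open>A\<close> is spaced. Arbitrary
  finite sets are allowed because the bound is also applied to the indices left over between
  blocks.\<close>

lemma expectation_sum_sq_le:
  assumes "finite A"
  shows "expectation (\<lambda>\<omega>. (\<Sum>s\<in>A. V s \<omega>)\<^sup>2) \<le> var_bound * card A"
  using assms
proof (induction A rule: finite_linorder_max_induct)
  case (insert t A)
  let ?S = "\<lambda>\<omega>. \<Sum>s\<in>A. V s \<omega>"
  have t: "t \<notin> A" using insert by auto
  have "expectation (\<lambda>\<omega>. ?S \<omega> * V t \<omega>) = (\<Sum>s\<in>A. expectation (\<lambda>\<omega>. V s \<omega> * V t \<omega>))"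
    unfolding sum_distrib_right
    by (intro Bochner_Integration.integral_sum L2_integrable_mult L2_V)
  also have "\<dots> \<le> (\<Sum>s\<in>A. K\<^sup>2 * \<theta> ^ (t - Suc s))"
    using covariance_le insert by (intro sum_mono) (meson abs_le_D1)
  also have "\<dots> \<le> K\<^sup>2 * (1 / (1 - \<theta>))"
    unfolding sum_distrib_left[symmetric]
  proof (intro mult_left_mono sum_geometric_inj_le)
    \<comment> \<open>Truncated subtraction is injective here because all elements of
      \<open>A\<close> lie below \<open>t\<close>.\<close>
    show "inj_on (\<lambda>s. t - Suc s) A"
    proof (rule inj_onI)
      fix x y assume "x \<in> A" "y \<in> A" "t - Suc x = t - Suc y"
      moreover from this have "x < t" "y < t" using insert by auto
      ultimately show "x = y" by linarith
    qed
  qed (use insert \<theta> in auto)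
  finally have c: "expectation (\<lambda>\<omega>. ?S \<omega> * V t \<omega>) \<le> K\<^sup>2 / (1 - \<theta>)" by simp
  have "expectation (\<lambda>\<omega>. (\<Sum>s\<in>insert t A. V s \<omega>)\<^sup>2)
     = expectation (\<lambda>\<omega>. (V t \<omega>)\<^sup>2 + 2 * (?S \<omega> * V t \<omega>) + (?S \<omega>)\<^sup>2)"
    using insert t by (simp add: power2_sum algebra_simps)
  also have "\<dots> = (L2norm (V t))\<^sup>2 + 2 * expectation (\<lambda>\<omega>. ?S \<omega> * V t \<omega>) + expectation (\<lambda>\<omega>. (?S \<omega>)\<^sup>2)"
    using L2_integrable_mult[OF L2_sum_V L2_V] L2_integrable_sq[OF L2_V] L2_integrable_sq[OF L2_sum_V]
    by (simp add: L2norm_sq)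
  also have "\<dots> \<le> K\<^sup>2 + 2 * (K\<^sup>2 / (1 - \<theta>)) + var_bound * card A"
    using c insert.IH power_mono[OF L2norm_V L2norm_nonneg, of t 2] by linarith
  also have "\<dots> = var_bound * card (insert t A)"
    using insert.hyps t unfolding var_bound_def[symmetric] by (simp add: distrib_left)
  finally show ?case .
qed simp

lemma L2norm_sum_V_le:
  assumes "finite A" "real (card A) \<le> c"
  shows "L2norm (\<lambda>\<omega>. \<Sum>s\<in>A. V s \<omega>) \<le> sqrt (var_bound * c)"
  unfolding L2norm_def real_sqrt_le_iff
  using expectation_sum_sq_le[OF assms(1)] mult_left_mono[OF assms(2) var_bound_nonneg] by linarith

text \<open>No cancellation is exploited, so the bound grows like the fourth power of the number of
  terms. This is affordable because it is used only for blocks that are very short compared with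
  \<open>n\<close>.\<close>

lemma sum_V_pow4:
  assumes "finite A"
  shows "integrable M (\<lambda>\<omega>. (\<Sum>s\<in>A. V s \<omega>) ^ 4)"
    and "expectation (\<lambda>\<omega>. (\<Sum>s\<in>A. V s \<omega>) ^ 4) \<le> (card A * K) ^ 4"
proof -
  have b: "(\<Sum>s\<in>A. V s \<omega>) ^ 4 \<le> real (card A) ^ 3 * (\<Sum>s\<in>A. V s \<omega> ^ 4)" for \<omega>
    using power4_sum_le[OF assms, of "\<lambda>_. 1" "\<lambda>s. V s \<omega>"] by simp
  have i: "integrable M (\<lambda>\<omega>. real (card A) ^ 3 * (\<Sum>s\<in>A. V s \<omega> ^ 4))"
    using V_pow4(1) by auto
  show i4: "integrable M (\<lambda>\<omega>. (\<Sum>s\<in>A. V s \<omega>) ^ 4)"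
    by (rule Bochner_Integration.integrable_bound[OF i]) (use b in \<open>auto intro!: AE_I2 simp: sum_nonneg\<close>)
  have "expectation (\<lambda>\<omega>. (\<Sum>s\<in>A. V s \<omega>) ^ 4) \<le> expectation (\<lambda>\<omega>. real (card A) ^ 3 * (\<Sum>s\<in>A. V s \<omega> ^ 4))"
    by (intro integral_mono i i4 b)
  also have "\<dots> = real (card A) ^ 3 * (\<Sum>s\<in>A. expectation (\<lambda>\<omega>. V s \<omega> ^ 4))"
    using V_pow4(1) by simp
  also have "\<dots> \<le> real (card A) ^ 3 * (\<Sum>s\<in>A. K ^ 4)"
    by (intro mult_left_mono sum_mono V_pow4(2)) auto
  also have "\<dots> = (card A * K) ^ 4" by (simp add: power_mult_distrib power4_eq_xxxx power3_eq_cube)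
  finally show "expectation (\<lambda>\<omega>. (\<Sum>s\<in>A. V s \<omega>) ^ 4) \<le> (card A * K) ^ 4" .
qed

section \<open>Sums over blocks separated by gaps\<close>

context
  fixes r :: "nat \<Rightarrow> nat" and A :: "nat \<Rightarrow> nat set" and l :: nat and Y Y' :: "nat \<Rightarrow> 'a \<Rightarrow> real"
  assumes A_sub: "\<And>j. A j \<subseteq> {r j + l..<r (Suc j)}" and r_mono: "mono r"
  defines "Y \<equiv> \<lambda>j \<omega>. \<Sum>s\<in>A j. V s \<omega>" and "Y' \<equiv> \<lambda>j \<omega>. \<Sum>s\<in>A j. V' (r j) s \<omega>"
begin

lemma finite_block: "finite (A j)"
  by (rule finite_subset[OF A_sub]) simp

lemma block_less: "i < j \<Longrightarrow> A i \<subseteq> {..<r j}"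
  using A_sub[of i] monoD[OF r_mono, of "Suc i" j] by (auto simp: Suc_le_eq subset_iff)

lemma sum_blocks: "(\<Sum>j<q. Y j \<omega>) = (\<Sum>s\<in>(\<Union>j<q. A j). V s \<omega>)"
proof -
  have "A i \<inter> A j = {}" if "i < j" for i j
    using block_less[OF that] A_sub[of j] by fastforce
  then have "\<forall>i\<in>{..<q}. \<forall>j\<in>{..<q}. i \<noteq> j \<longrightarrow> A i \<inter> A j = {}"
    by (metis inf_commute nat_neq_iff)
  then show ?thesis
    unfolding Y_def by (subst sum.UNION_disjoint) (auto simp: finite_block)
qed

lemma Union_block_subset: "(\<Union>j<q. A j) \<subseteq> {..<r q}"
  using block_less by blast

lemma L2_block: "L2 (Y j)" and L2_block': "L2 (Y' j)"
proof -
  show "L2 (Y j)" unfolding Y_def by (rule L2_sum_V)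
  show "L2 (Y' j)" unfolding Y'_def by (rule L2_sum, rule L2_V') (use A_sub[of j] in auto)
qed

lemma L2_blocks: "L2 (\<lambda>\<omega>. \<Sum>j<q. Y j \<omega>)"
  by (intro L2_sum L2_block)

text \<open>The restart takes place at \<open>r j\<close> and the block begins \<open>l\<close>
  later: the gap contributes the factor \<open>\<theta> ^ l\<close>, and the remaining distances
  form a geometric series.\<close>

lemma L2norm_block_diff: "L2norm (\<lambda>\<omega>. Y j \<omega> - Y' j \<omega>) \<le> mix_error l"
proof -
  have ge: "r j + l \<le> s" if "s \<in> A j" for s using A_sub[of j] that by auto
  have "L2norm (\<lambda>\<omega>. Y j \<omega> - Y' j \<omega>) = L2norm (\<lambda>\<omega>. \<Sum>s\<in>A j. V s \<omega> - V' (r j) s \<omega>)"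
    by (simp add: Y_def Y'_def sum_subtractf)
  also have "\<dots> \<le> (\<Sum>s\<in>A j. L2norm (\<lambda>\<omega>. V s \<omega> - V' (r j) s \<omega>))"
    by (intro L2norm_sum L2_diff L2_V L2_V') (use ge in force)
  also have "\<dots> \<le> (\<Sum>s\<in>A j. K * \<theta> ^ (s - r j))"
    by (intro sum_mono L2norm_approx) (use ge in force)
  also have "\<dots> = (\<Sum>s\<in>A j. K * \<theta> ^ l * \<theta> ^ (s - (r j + l)))"
    by (intro sum.cong refl) (use ge in \<open>simp add: power_add[symmetric]\<close>)
  also have "\<dots> \<le> K * \<theta> ^ l * (1 / (1 - \<theta>))"
    unfolding sum_distrib_left[symmetric]
    using \<theta> K ge by (intro mult_left_mono sum_geometric_inj_le finite_block)
      (auto simp: inj_on_def intro: eq_diff_iff[THEN iffD1])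
  finally show ?thesis by (simp add: mix_error_def)
qed

lemma indep_blocks: "indep_var borel (\<lambda>\<omega>. \<Sum>j<q. Y j \<omega>) borel (Y' q)"
  unfolding sum_blocks unfolding Y'_def
  by (rule indep[OF Union_block_subset _ finite_block]) (use A_sub[of q] in auto)

text \<open>In the induction the last block is exchanged for its restarted version, the
  characteristic function factorises, and the restarted factor is exchanged back. Each of the two
  exchanges costs \<open>|u| * mix_error l\<close>, since the other factors have modulus at most
  1.\<close>

lemma iexp_blocks:
  "cmod ((CLINT \<omega>|M. iexp (u * (\<Sum>j<q. Y j \<omega>))) - (\<Prod>j<q. CLINT \<omega>|M. iexp (u * Y j \<omega>)))
    \<le> 2 * \<bar>u\<bar> * q * mix_error l"
proof (induction q)
  case 0
  show ?case by (simp add: prob_space)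
next
  case (Suc q)
  let ?S = "\<lambda>\<omega>. \<Sum>j<q. Y j \<omega>"
  let ?E = "\<lambda>f. CLINT \<omega>|M. iexp (u * f \<omega>)"
  let ?D = "\<bar>u\<bar> * mix_error l"
  have d: "\<bar>u\<bar> * expectation (\<lambda>\<omega>. \<bar>Y q \<omega> - Y' q \<omega>\<bar>) \<le> ?D"
    using expectation_abs_le[OF L2_diff[OF L2_block L2_block'], of q q] L2norm_block_diff[of q]
    by (intro mult_left_mono) auto
  have 1: "cmod (?E (\<lambda>\<omega>. ?S \<omega> + Y q \<omega>) - ?E (\<lambda>\<omega>. ?S \<omega> + Y' q \<omega>)) \<le> ?D"
    using norm_expectation_iexp_diff[of "\<lambda>\<omega>. ?S \<omega> + Y q \<omega>" "\<lambda>\<omega>. ?S \<omega> + Y' q \<omega>" u] d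
      L2_integrable[OF L2_add[OF L2_blocks L2_block]] L2_integrable[OF L2_add[OF L2_blocks L2_block']]
    by simp
  have 2: "?E (\<lambda>\<omega>. ?S \<omega> + Y' q \<omega>) = ?E ?S * ?E (Y' q)"
    by (rule expectation_iexp_indep[OF indep_blocks])
  have 3: "cmod (?E (Y q) - ?E (Y' q)) \<le> ?D"
    using norm_expectation_iexp_diff[OF L2_integrable[OF L2_block] L2_integrable[OF L2_block'], of u q q] d
    by linarith
  have n1: "cmod (?E ?S) \<le> 1" "cmod (?E (Y q)) \<le> 1"
    by (intro norm_expectation_iexp_le_1 L2_measurable L2_blocks L2_block)+
  have "?E (\<lambda>\<omega>. \<Sum>j<Suc q. Y j \<omega>) - (\<Prod>j<Suc q. ?E (Y j))
     = (?E (\<lambda>\<omega>. ?S \<omega> + Y q \<omega>) - ?E (\<lambda>\<omega>. ?S \<omega> + Y' q \<omega>)) + (?E ?S * (?E (Y' q) - ?E (Y q)))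
      + (?E ?S - (\<Prod>j<q. ?E (Y j))) * ?E (Y q)"
    using 2 by (simp add: algebra_simps del: of_real_add of_real_mult of_real_sum)
  also have "cmod \<dots> \<le> ?D + 1 * ?D + (2 * \<bar>u\<bar> * q * mix_error l) * 1"
    apply (intro order_trans[OF norm_triangle_ineq] add_mono 1)
    unfolding norm_mult
    using 3 n1 Suc.IH mix_error_nonneg
    by (intro mult_mono; simp add: norm_minus_commute)+
  also have "\<dots> = 2 * \<bar>u\<bar> * real (Suc q) * mix_error l" by (simp add: algebra_simps)
  finally show ?case .
qed

text \<open>The restarted last block is uncorrelated with the preceding sum, so the cross term only
  sees the restart error. Bounding the norm of the preceding sum by
  \<open>sqrt (var_bound * n)\<close> is crude, but \<open>mix_error l\<close> is exponentially
  small in \<open>l\<close>.\<close>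

lemma variance_blocks:
  assumes "r q \<le> n"
  shows "\<bar>expectation (\<lambda>\<omega>. (\<Sum>j<q. Y j \<omega>)\<^sup>2) - (\<Sum>j<q. expectation (\<lambda>\<omega>. (Y j \<omega>)\<^sup>2))\<bar>
    \<le> 2 * q * (sqrt (var_bound * n) * mix_error l)"
  using assms
proof (induction q)
  case (Suc q)
  let ?S = "\<lambda>\<omega>. \<Sum>j<q. Y j \<omega>"
  have rq: "r q \<le> n" using Suc.prems monoD[OF r_mono, of q "Suc q"] by simp
  have i: "integrable M (\<lambda>\<omega>. ?S \<omega> * Y q \<omega>)" by (intro L2_integrable_mult L2_blocks L2_block)
  have "expectation (\<lambda>\<omega>. ?S \<omega> * Y' q \<omega>) = expectation ?S * expectation (Y' q)"
    by (intro indep_var_lebesgue_integral indep_blocks L2_integrable L2_blocks L2_block')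
  also have "expectation ?S = 0" unfolding sum_blocks by (rule sum_V_mean)
  finally have 0: "expectation (\<lambda>\<omega>. ?S \<omega> * Y' q \<omega>) = 0" by simp
  have L: "L2 (\<lambda>\<omega>. Y q \<omega> - Y' q \<omega>)" by (intro L2_diff L2_block L2_block')
  have "expectation (\<lambda>\<omega>. ?S \<omega> * Y q \<omega>)
      = expectation (\<lambda>\<omega>. ?S \<omega> * (Y q \<omega> - Y' q \<omega>) + ?S \<omega> * Y' q \<omega>)"
    by (simp add: algebra_simps)
  also have "\<dots> = expectation (\<lambda>\<omega>. ?S \<omega> * (Y q \<omega> - Y' q \<omega>))"
    using L2_integrable_mult[OF L2_blocks L] L2_integrable_mult[OF L2_blocks L2_block'] 0 by simp
  finally have "\<bar>expectation (\<lambda>\<omega>. ?S \<omega> * Y q \<omega>)\<bar> \<le> L2norm ?S * L2norm (\<lambda>\<omega>. Y q \<omega> - Y' q \<omega>)"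
    using expectation_mult_le[OF L2_blocks L] by simp
  also have "L2norm ?S \<le> sqrt (var_bound * n)"
    unfolding sum_blocks
  proof (rule L2norm_sum_V_le)
    show "finite (\<Union>j<q. A j)" by (simp add: finite_block)
    show "real (card (\<Union>j<q. A j)) \<le> real n"
      using card_mono[OF _ Union_block_subset[of q]] rq by simp
  qed
  finally have c: "\<bar>expectation (\<lambda>\<omega>. ?S \<omega> * Y q \<omega>)\<bar> \<le> sqrt (var_bound * n) * mix_error l"
    using L2norm_block_diff[of q] var_bound_nonneg L2norm_nonneg
    by (meson order_trans mult_left_mono mult_right_mono real_sqrt_ge_zero mult_nonneg_nonneg of_nat_0_le_iff)
  have "expectation (\<lambda>\<omega>. (\<Sum>j<Suc q. Y j \<omega>)\<^sup>2)
      = expectation (\<lambda>\<omega>. (?S \<omega>)\<^sup>2 + 2 * (?S \<omega> * Y q \<omega>) + (Y q \<omega>)\<^sup>2)"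
    by (simp add: power2_sum algebra_simps)
  also have "\<dots> = expectation (\<lambda>\<omega>. (?S \<omega>)\<^sup>2) + 2 * expectation (\<lambda>\<omega>. ?S \<omega> * Y q \<omega>) + expectation (\<lambda>\<omega>. (Y q \<omega>)\<^sup>2)"
    using i L2_integrable_sq[OF L2_blocks] L2_integrable_sq[OF L2_block] by simp
  finally have eq: "expectation (\<lambda>\<omega>. (\<Sum>j<Suc q. Y j \<omega>)\<^sup>2) - (\<Sum>j<Suc q. expectation (\<lambda>\<omega>. (Y j \<omega>)\<^sup>2))
     = (expectation (\<lambda>\<omega>. (?S \<omega>)\<^sup>2) - (\<Sum>j<q. expectation (\<lambda>\<omega>. (Y j \<omega>)\<^sup>2))) + 2 * expectation (\<lambda>\<omega>. ?S \<omega> * Y q \<omega>)"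
    by simp
  have "2 * real (Suc q) * (sqrt (var_bound * n) * mix_error l)
     = 2 * q * (sqrt (var_bound * n) * mix_error l) + 2 * (sqrt (var_bound * n) * mix_error l)"
    by (simp add: algebra_simps)
  then show ?case unfolding eq using Suc.IH[OF rq] c by linarith
qed simp

text \<open>Products of factors of modulus at most 1 differ by at most the sum of the differences of
  the factors, and each factor is treated by the fourth-moment estimate; the Gaussian factors
  multiply to one exponential of the summed variances.\<close>

lemma iexp_blocks_gaussian:
  assumes card: "\<And>j. card (A j) \<le> L"
  shows "cmod ((\<Prod>j<q. CLINT \<omega>|M. iexp (u * Y j \<omega>))
      - exp (- (u\<^sup>2 * (\<Sum>j<q. expectation (\<lambda>\<omega>. (Y j \<omega>)\<^sup>2)) / 2)))
    \<le> q * (\<bar>u\<bar> ^ 3 * (1 + (L * K) ^ 4) + u ^ 4 * (var_bound * L)\<^sup>2)"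
proof -
  let ?v = "\<lambda>j. expectation (\<lambda>\<omega>. (Y j \<omega>)\<^sup>2)"
  let ?E = "\<lambda>f. CLINT \<omega>|M. iexp (u * f \<omega>)"
  have each: "cmod (?E (Y j) - exp (- (u\<^sup>2 * ?v j / 2))) \<le> \<bar>u\<bar> ^ 3 * (1 + (L * K) ^ 4) + u ^ 4 * (var_bound * L)\<^sup>2" for j
  proof -
    have m4: "integrable M (\<lambda>x. Y j x ^ 4)" unfolding Y_def by (rule sum_V_pow4[OF finite_block])
    have "expectation (\<lambda>x. Y j x ^ 4) \<le> (card (A j) * K) ^ 4"
      unfolding Y_def by (rule sum_V_pow4[OF finite_block])
    also have "\<dots> \<le> (L * K) ^ 4" using card[of j] K by (intro power_mono mult_right_mono) auto
    finally have b4: "expectation (\<lambda>x. Y j x ^ 4) \<le> (L * K) ^ 4" .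
    have "?v j \<le> var_bound * card (A j)" unfolding Y_def by (rule expectation_sum_sq_le[OF finite_block])
    also have "\<dots> \<le> var_bound * L" using card[of j] var_bound_nonneg by (intro mult_left_mono) auto
    finally have b2: "(?v j)\<^sup>2 \<le> (var_bound * L)\<^sup>2" by (intro power_mono) auto
    have mean: "expectation (Y j) = 0" unfolding Y_def by (rule sum_V_mean)
    have "cmod (?E (Y j) - exp (- (u\<^sup>2 * ?v j / 2))) \<le> \<bar>u\<bar> ^ 3 * (1 + expectation (\<lambda>x. Y j x ^ 4)) + u ^ 4 * (?v j)\<^sup>2"
      by (rule norm_expectation_iexp_gaussian[OF L2_measurable[OF L2_block] m4 mean])
    also have "\<dots> \<le> \<bar>u\<bar> ^ 3 * (1 + (L * K) ^ 4) + u ^ 4 * (var_bound * L)\<^sup>2"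
      using b4 b2 by (intro add_mono mult_left_mono) auto
    finally show ?thesis .
  qed
  have "complex_of_real (exp (- (u\<^sup>2 * (\<Sum>j<q. ?v j) / 2))) = (\<Prod>j<q. complex_of_real (exp (- (u\<^sup>2 * ?v j / 2))))"
    by (simp add: exp_sum[symmetric] sum_distrib_left sum_divide_distrib sum_negf
        flip: of_real_prod)
  then have "cmod ((\<Prod>j<q. ?E (Y j)) - exp (- (u\<^sup>2 * (\<Sum>j<q. ?v j) / 2)))
    = cmod ((\<Prod>j<q. ?E (Y j)) - (\<Prod>j<q. complex_of_real (exp (- (u\<^sup>2 * ?v j / 2)))))" by simp
  also have "\<dots> \<le> (\<Sum>j<q. cmod (?E (Y j) - exp (- (u\<^sup>2 * ?v j / 2))))"
    using norm_expectation_iexp_le_1[OF L2_measurable[OF L2_block], of u]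
    by (intro norm_prod_diff) auto
  also have "\<dots> \<le> (\<Sum>j<q. \<bar>u\<bar> ^ 3 * (1 + (L * K) ^ 4) + u ^ 4 * (var_bound * L)\<^sup>2)"
    by (intro sum_mono each)
  finally show ?thesis by simp
qed

end

end

section \<open>The limit theorem by big and small blocks\<close>

context geometric_mixing
begin

text \<open>Big blocks of length \<open>k\<^sup>2\<close> are separated by gaps of length \<open>k \<approx> n powr (1/20)\<close>: the gaps carry a
  share of order \<open>1 / k\<close> of the variance, the mixing error is of order \<open>sqrt n * \<theta> ^ k\<close>, and crude fourth
  moments bound the error of the Gaussian approximation by \<open>k ^ 8 / sqrt n\<close>.\<close>

lemma central_limit_level:
  fixes n k :: nat and t :: real
  assumes k: "1 \<le> k" "k ^ 20 \<le> n" "n < Suc k ^ 20"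
  defines "\<rho> \<equiv> 1 / (real k + 1) + (real k ^ 2 + real k) / real k ^ 20"
    and "\<delta> \<equiv> (real k + 1) ^ 10 * mix_error k"
  obtains x where
    "cmod ((CLINT \<omega>|M. iexp (t / sqrt n * (\<Sum>s<n. V s \<omega>))) - exp (- (t\<^sup>2 * x / 2)))
      \<le> \<bar>t\<bar> * sqrt (var_bound * \<rho>) + 2 * \<bar>t\<bar> * \<delta>
        + (\<bar>t\<bar> ^ 3 * (1 + (real (k\<^sup>2) * K) ^ 4) / real k ^ 10 + t ^ 4 * (var_bound * real (k\<^sup>2))\<^sup>2 / real k ^ 20)"
    and "\<exists>y. \<bar>x - y\<^sup>2\<bar> \<le> 2 * sqrt var_bound * \<delta> \<and> 0 \<le> y \<and>
      \<bar>y - sqrt (expectation (\<lambda>\<omega>. (\<Sum>s<n. V s \<omega>)\<^sup>2) / n)\<bar> \<le> sqrt (var_bound * \<rho>)"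
proof -
  define L where "L = k\<^sup>2"
  define q where "q = n div (L + k)"
  define r where "r = (\<lambda>j. j * (L + k))"
  define A where "A = (\<lambda>j. {r j + k..<r (Suc j)})"
  define Y where "Y = (\<lambda>j \<omega>. \<Sum>s\<in>A j. V s \<omega>)"
  define R where "R = {..<n} - (\<Union>j<q. A j)"
  have A_sub: "\<And>j. A j \<subseteq> {r j + k..<r (Suc j)}" by (simp add: A_def)
  have r_mono: "mono r" by (auto simp: r_def mono_def)
  have cA: "card (A j) = L" for j by (simp add: A_def r_def)
  have n0: "0 < n" using k by (meson less_le_trans zero_less_power zero_less_one)
  have rq: "r q \<le> n" by (simp add: r_def q_def)
  have qn: "q \<le> n" by (simp add: q_def)
  have U: "(\<Union>j<q. A j) \<subseteq> {..<n}" using Union_block_subset[OF A_sub r_mono, of q] rq by fastforce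
  have cU: "card (\<Union>j<q. A j) = q * L"
  proof -
    have "A i \<inter> A j = {}" if "i < j" for i j
      using block_less[OF A_sub r_mono that] A_sub[of j] by fastforce
    then have "\<forall>i\<in>{..<q}. \<forall>j\<in>{..<q}. i \<noteq> j \<longrightarrow> A i \<inter> A j = {}"
      by (metis inf_commute nat_neq_iff)
    then have "card (\<Union>j<q. A j) = (\<Sum>j<q. card (A j))"
      by (intro card_UN_disjoint) (auto simp: A_def)
    then show ?thesis by (simp add: cA)
  qed
  \<comment> \<open>The blocks leave out \<open>q\<close> gaps of length \<open>k\<close> and a
    final stretch shorter than \<open>L + k\<close>. The first share is at most
    \<open>1 / (k + 1)\<close> because \<open>q * k * (k + 1) \<le> n\<close>; the second is small
    because \<open>k ^ 20 \<le> n\<close>.\<close>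
  have cR: "real (card R) \<le> \<rho> * n"
  proof -
    have "card R = n - q * L" unfolding R_def using U cU by (simp add: card_Diff_subset finite_subset)
    moreover have "q * L \<le> n" using rq by (simp add: r_def algebra_simps)
    moreover have "n < (q + 1) * (L + k)"
      using k(1) dividend_less_times_div[of "L + k" n] by (simp add: q_def algebra_simps)
    ultimately have 1: "card R < q * k + (L + k)" by (simp add: algebra_simps)
    have "real (q * (L + k)) \<le> real n" unfolding of_nat_le_iff using rq by (simp add: r_def)
    then have "real q * real k * (real k + 1) \<le> real n" by (simp add: L_def power2_eq_square algebra_simps)
    then have 2: "real q * real k \<le> real n * (1 / (real k + 1))" by (simp add: field_simps)
    have "real k ^ 20 \<le> real n" using k(2) by (metis of_nat_le_iff of_nat_power)
    then have "1 \<le> real n / real k ^ 20" using k(1) by (simp add: field_simps)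
    then have "(real k ^ 2 + real k) * 1 \<le> (real k ^ 2 + real k) * (real n / real k ^ 20)"
      by (intro mult_left_mono) auto
    then have 3: "real (L + k) \<le> real n * ((real k ^ 2 + real k) / real k ^ 20)"
      by (simp add: L_def mult.commute)
    have "real (card R) \<le> real q * real k + real (L + k)" using 1 by (simp flip: of_nat_mult of_nat_add)
    then show ?thesis using 2 3 by (simp add: \<rho>_def algebra_simps)
  qed
  have \<rho>0: "0 \<le> \<rho>" by (simp add: \<rho>_def)
  have split: "(\<Sum>s<n. V s \<omega>) - (\<Sum>j<q. Y j \<omega>) = (\<Sum>s\<in>R. V s \<omega>)" for \<omega>
    unfolding Y_def sum_blocks[OF A_sub r_mono] R_def using U by (simp add: sum_diff)
  \<comment> \<open>The upper bound on \<open>n\<close> is needed where powers of \<open>n\<close>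
    multiply the mixing error, the lower bound where they divide moments. This expresses all errors
    in terms of \<open>k\<close> alone.\<close>
  have sn: "sqrt n \<le> (real k + 1) ^ 10"
  proof -
    have "real n \<le> real (Suc k ^ 20)" using k(3) by (simp del: of_nat_power of_nat_Suc)
    also have "\<dots> = ((real k + 1) ^ 10)\<^sup>2" by (simp add: power_mult[symmetric] add.commute)
    finally show ?thesis by (intro real_le_lsqrt) auto
  qed
  have sn': "real k ^ 10 \<le> sqrt n"
  proof -
    have "(real k ^ 10)\<^sup>2 \<le> real n" using k(2) by (simp add: power_mult[symmetric] flip: of_nat_power)
    then show ?thesis by (rule real_le_rsqrt)
  qed
  have kn: "real k ^ 20 \<le> real n" using k(2) by (metis of_nat_le_iff of_nat_power)
  have sn0: "0 < sqrt n" using n0 by simp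
  have snn: "sqrt n * sqrt n = n" by simp
  have cR': "L2norm (\<lambda>\<omega>. \<Sum>s\<in>R. V s \<omega>) \<le> sqrt (var_bound * \<rho>) * sqrt n"
    using L2norm_sum_V_le[of R, OF _ cR] by (simp add: R_def real_sqrt_mult mult.assoc)
  have LS: "L2 (\<lambda>\<omega>. \<Sum>s<n. V s \<omega>)" and LY: "L2 (\<lambda>\<omega>. \<Sum>j<q. Y j \<omega>)"
    using L2_sum_V L2_blocks[OF A_sub r_mono] by (auto simp: Y_def)
  define u where "u = t / sqrt n"
  have un: "\<bar>u\<bar> * sqrt n = \<bar>t\<bar>" "u\<^sup>2 * n = t\<^sup>2" using n0 by (simp_all add: u_def abs_divide power_divide)
  define v where "v = (\<Sum>j<q. expectation (\<lambda>\<omega>. (Y j \<omega>)\<^sup>2))"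
  let ?E = "\<lambda>f. CLINT \<omega>|M. iexp (u * f \<omega>)"
  have e1: "cmod (?E (\<lambda>\<omega>. \<Sum>s<n. V s \<omega>) - ?E (\<lambda>\<omega>. \<Sum>j<q. Y j \<omega>)) \<le> \<bar>t\<bar> * sqrt (var_bound * \<rho>)"
  proof -
    have "cmod (?E (\<lambda>\<omega>. \<Sum>s<n. V s \<omega>) - ?E (\<lambda>\<omega>. \<Sum>j<q. Y j \<omega>))
       \<le> \<bar>u\<bar> * expectation (\<lambda>\<omega>. \<bar>\<Sum>s\<in>R. V s \<omega>\<bar>)"
      using norm_expectation_iexp_diff[OF L2_integrable[OF LS] L2_integrable[OF LY], of u] split by simp
    also have "\<dots> \<le> \<bar>u\<bar> * (sqrt (var_bound * \<rho>) * sqrt n)"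
      using expectation_abs_le[OF L2_sum_V, of R] cR' by (intro mult_left_mono) auto
    also have "\<dots> = \<bar>t\<bar> * sqrt (var_bound * \<rho>)" using un(1) by (simp add: mult_ac)
    finally show ?thesis .
  qed
  have e2: "cmod (?E (\<lambda>\<omega>. \<Sum>j<q. Y j \<omega>) - (\<Prod>j<q. ?E (Y j))) \<le> 2 * \<bar>t\<bar> * \<delta>"
  proof -
    have "cmod (?E (\<lambda>\<omega>. \<Sum>j<q. Y j \<omega>) - (\<Prod>j<q. ?E (Y j))) \<le> 2 * \<bar>u\<bar> * q * mix_error k"
      unfolding Y_def by (rule iexp_blocks[OF A_sub r_mono])
    also have "\<dots> \<le> 2 * \<bar>u\<bar> * (sqrt n * sqrt n) * mix_error k"
      using qn mix_error_nonneg snn by (intro mult_left_mono mult_right_mono) auto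
    also have "\<dots> = 2 * \<bar>t\<bar> * (sqrt n * mix_error k)" by (simp only: un(1)[symmetric] mult_ac)
    also have "\<dots> \<le> 2 * \<bar>t\<bar> * \<delta>"
      unfolding \<delta>_def using sn mix_error_nonneg by (intro mult_left_mono mult_right_mono) auto
    finally show ?thesis .
  qed
  have e3: "cmod ((\<Prod>j<q. ?E (Y j)) - exp (- (u\<^sup>2 * v / 2))) \<le>
    \<bar>t\<bar> ^ 3 * (1 + (real (k\<^sup>2) * K) ^ 4) / real k ^ 10 + t ^ 4 * (var_bound * real (k\<^sup>2))\<^sup>2 / real k ^ 20"
  proof -
    have "cmod ((\<Prod>j<q. ?E (Y j)) - exp (- (u\<^sup>2 * v / 2)))
      \<le> q * (\<bar>u\<bar> ^ 3 * (1 + (L * K) ^ 4) + u ^ 4 * (var_bound * L)\<^sup>2)"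
      unfolding v_def Y_def by (rule iexp_blocks_gaussian[OF A_sub r_mono]) (simp add: cA)
    also have "\<dots> \<le> n * (\<bar>u\<bar> ^ 3 * (1 + (L * K) ^ 4) + u ^ 4 * (var_bound * L)\<^sup>2)"
      using qn K by (intro mult_right_mono) auto
    also have "\<dots> = \<bar>t\<bar> ^ 3 * (1 + (L * K) ^ 4) / sqrt n + t ^ 4 * (var_bound * L)\<^sup>2 / n"
    proof -
      have "n * \<bar>u\<bar> ^ 3 = \<bar>t\<bar> ^ 3 / sqrt n"
        using n0 by (simp add: u_def abs_divide power_divide power3_eq_cube)
      moreover have "n * u ^ 4 = t ^ 4 / n"
        using n0 by (simp add: u_def power_divide power4_eq_xxxx)
      ultimately show ?thesis by (metis (no_types, lifting) distrib_left mult.assoc times_divide_eq_left)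
    qed
    also have "\<dots> \<le> \<bar>t\<bar> ^ 3 * (1 + (L * K) ^ 4) / real k ^ 10 + t ^ 4 * (var_bound * L)\<^sup>2 / real k ^ 20"
      using sn' kn k(1) by (intro add_mono divide_left_mono mult_pos_pos sn0) (auto simp: n0)
    finally show ?thesis by (simp add: L_def)
  qed
  have v: "u\<^sup>2 * v = t\<^sup>2 * (v / n)" by (simp add: u_def power_divide)
  \<comment> \<open>\<open>y\<close> mediates between \<open>v / n\<close> and the true variance:
    \<open>y^2\<close> is near \<open>v / n\<close> because blocks are almost uncorrelated, and
    \<open>y\<close> is near the normalised norm of the full sum by the triangle inequality, which
    compares roots rather than variances.\<close>
  define y where "y = L2norm (\<lambda>\<omega>. \<Sum>j<q. Y j \<omega>) / sqrt n"
  show thesis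
  proof
    show "cmod ((CLINT \<omega>|M. iexp (t / sqrt n * (\<Sum>s<n. V s \<omega>))) - exp (- (t\<^sup>2 * (v / n) / 2)))
      \<le> \<bar>t\<bar> * sqrt (var_bound * \<rho>) + 2 * \<bar>t\<bar> * \<delta>
        + (\<bar>t\<bar> ^ 3 * (1 + (real (k\<^sup>2) * K) ^ 4) / real k ^ 10 + t ^ 4 * (var_bound * real (k\<^sup>2))\<^sup>2 / real k ^ 20)"
      unfolding v[symmetric] u_def[symmetric]
      using norm_triangle_le[OF add_mono[OF norm_triangle_le[OF add_mono[OF e1 e2]] e3]] by simp
    have y2: "y\<^sup>2 = expectation (\<lambda>\<omega>. (\<Sum>j<q. Y j \<omega>)\<^sup>2) / n"
      by (simp add: y_def power_divide L2norm_sq)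
    have "\<bar>expectation (\<lambda>\<omega>. (\<Sum>j<q. Y j \<omega>)\<^sup>2) - v\<bar> \<le> 2 * real q * (sqrt (var_bound * n) * mix_error k)"
      using variance_blocks[OF A_sub r_mono rq] by (simp add: v_def Y_def)
    also have "\<dots> \<le> 2 * real n * (sqrt (var_bound * n) * mix_error k)"
      using qn mix_error_nonneg var_bound_nonneg by (intro mult_right_mono mult_nonneg_nonneg) auto
    also have "\<dots> \<le> 2 * real n * (sqrt var_bound * \<delta>)"
      unfolding \<delta>_def real_sqrt_mult mult.assoc using sn mix_error_nonneg var_bound_nonneg
      by (intro mult_left_mono mult_right_mono) auto
    finally have "\<bar>expectation (\<lambda>\<omega>. (\<Sum>j<q. Y j \<omega>)\<^sup>2) - v\<bar> / n \<le> 2 * sqrt var_bound * \<delta>"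
      using n0 by (simp add: field_simps)
    moreover have "\<bar>expectation (\<lambda>\<omega>. (\<Sum>j<q. Y j \<omega>)\<^sup>2) - v\<bar> / n = \<bar>v / n - y\<^sup>2\<bar>"
      unfolding y2 by (simp add: abs_minus_commute flip: diff_divide_distrib)
    moreover have "\<bar>L2norm (\<lambda>\<omega>. \<Sum>j<q. Y j \<omega>) - L2norm (\<lambda>\<omega>. \<Sum>s<n. V s \<omega>)\<bar> \<le> sqrt (var_bound * \<rho>) * sqrt n"
      using L2norm_diff_abs[OF LS LY] cR' split by (simp add: abs_minus_commute)
    then have "\<bar>y - L2norm (\<lambda>\<omega>. \<Sum>s<n. V s \<omega>) / sqrt n\<bar> \<le> sqrt (var_bound * \<rho>)"
      using sn0 by (simp add: y_def diff_divide_distrib[symmetric] abs_divide pos_divide_le_eq)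
    moreover have "0 \<le> y" by (simp add: y_def L2norm_nonneg)
    ultimately show "\<exists>y. \<bar>v / n - y\<^sup>2\<bar> \<le> 2 * sqrt var_bound * \<delta> \<and> 0 \<le> y \<and>
      \<bar>y - sqrt (expectation (\<lambda>\<omega>. (\<Sum>s<n. V s \<omega>)\<^sup>2) / n)\<bar> \<le> sqrt (var_bound * \<rho>)"
      by (auto simp: L2norm_def real_sqrt_divide)
  qed
qed

text \<open>With \<open>k\<close> the integer part of the twentieth root of \<open>n\<close>, every
  error of the preceding estimate is a function of \<open>k\<close> tending to 0: the mixing term
  because exponential decay beats \<open>(k + 1) ^ 10\<close>, the others as negative powers. The
  variance of the blocks is then squeezed to \<open>v\<close>.\<close>

theorem central_limit:
  assumes var: "(\<lambda>n. expectation (\<lambda>\<omega>. (\<Sum>s<n. V s \<omega>)\<^sup>2) / n) \<longlonglongrightarrow> v"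
  shows "(\<lambda>n. CLINT \<omega>|M. iexp (t / sqrt n * (\<Sum>s<n. V s \<omega>))) \<longlonglongrightarrow> complex_of_real (exp (- (t\<^sup>2 * v / 2)))"
proof -
  define k where "k = (\<lambda>n::nat. nat \<lfloor>root 20 n\<rfloor>)"
  have k_le: "k n ^ 20 \<le> n" and k_gt: "n < Suc (k n) ^ 20" for n
  proof -
    have "real (k n) \<le> root 20 n" by (simp add: k_def)
    then have "real (k n) ^ 20 \<le> root 20 n ^ 20" by (intro power_mono) auto
    then have "real (k n ^ 20) \<le> real n" by simp
    then show "k n ^ 20 \<le> n" by (simp only: of_nat_le_iff)
    have "root 20 n < real (Suc (k n))" unfolding k_def by linarith
    then have "root 20 n ^ 20 < real (Suc (k n)) ^ 20" by (intro power_strict_mono) auto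
    then have "real n < real (Suc (k n) ^ 20)" by simp
    then show "n < Suc (k n) ^ 20" by (simp only: of_nat_less_iff)
  qed
  have k_lim: "filterlim k at_top sequentially"
  proof (rule filterlim_at_top[THEN iffD2], safe)
    fix Z :: nat
    have "Z \<le> k n" if "Z ^ 20 \<le> n" for n
    proof (rule ccontr)
      assume "\<not> Z \<le> k n"
      then have "Suc (k n) ^ 20 \<le> Z ^ 20" by (intro power_mono) auto
      with that k_gt[of n] show False by linarith
    qed
    then show "\<forall>\<^sub>F n in sequentially. Z \<le> k n"
      unfolding eventually_sequentially by blast
  qed
  define \<rho> where "\<rho> = (\<lambda>k::nat. 1 / (real k + 1) + (real k ^ 2 + real k) / real k ^ 20)"
  define \<delta> where "\<delta> = (\<lambda>k::nat. (real k + 1) ^ 10 * mix_error k)"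
  define \<eta> where "\<eta> = (\<lambda>k::nat. \<bar>t\<bar> * sqrt (var_bound * \<rho> k) + 2 * \<bar>t\<bar> * \<delta> k
     + (\<bar>t\<bar> ^ 3 * (1 + (real (k\<^sup>2) * K) ^ 4) / real k ^ 10 + t ^ 4 * (var_bound * real (k\<^sup>2))\<^sup>2 / real k ^ 20))"
  define S where "S = (\<lambda>n. expectation (\<lambda>\<omega>. (\<Sum>s<n. V s \<omega>)\<^sup>2) / real n)"
  have \<rho>_lim: "\<rho> \<longlonglongrightarrow> 0" unfolding \<rho>_def by real_asymp
  have "(\<lambda>k. (real k + 1) ^ 10 * \<theta> ^ k) \<longlonglongrightarrow> 0" using \<theta> by real_asymp
  then have "(\<lambda>k. K / (1 - \<theta>) * ((real k + 1) ^ 10 * \<theta> ^ k)) \<longlonglongrightarrow> K / (1 - \<theta>) * 0"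
    by (intro tendsto_mult tendsto_const)
  then have \<delta>_lim: "\<delta> \<longlonglongrightarrow> 0" by (simp add: \<delta>_def mix_error_def mult_ac)
  have l3: "(\<lambda>k::nat. (1 + (real (k\<^sup>2) * K) ^ 4) / real k ^ 10) \<longlonglongrightarrow> 0"
  proof -
    have "(\<lambda>k. 1 / real k ^ 10 + K ^ 4 * (1 / real k ^ 2)) \<longlonglongrightarrow> 0 + K ^ 4 * 0"
      by (intro tendsto_intros; real_asymp)
    moreover have "(1 + (real (k\<^sup>2) * K) ^ 4) / real k ^ 10 = 1 / real k ^ 10 + K ^ 4 * (1 / real k ^ 2)"
      if "k > 0" for k :: nat
      using that by (simp add: field_simps power_mult_distrib flip: power_mult power_add)
    ultimately show ?thesis
      by (subst filterlim_cong[OF refl refl, of _ "\<lambda>k. 1 / real k ^ 10 + K ^ 4 * (1 / real k ^ 2)"])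
        (auto intro: eventually_mono[OF eventually_gt_at_top[of 0]])
  qed
  have l4: "(\<lambda>k::nat. (var_bound * real (k\<^sup>2))\<^sup>2 / real k ^ 20) \<longlonglongrightarrow> 0"
  proof -
    have "(\<lambda>k. var_bound\<^sup>2 * (1 / real k ^ 16)) \<longlonglongrightarrow> var_bound\<^sup>2 * 0"
      by (intro tendsto_intros; real_asymp)
    moreover have "(var_bound * real (k\<^sup>2))\<^sup>2 / real k ^ 20 = var_bound\<^sup>2 * (1 / real k ^ 16)"
      if "k > 0" for k :: nat
      using that by (simp add: field_simps power_mult_distrib flip: power_mult power_add)
    ultimately show ?thesis
      by (subst filterlim_cong[OF refl refl, of _ "\<lambda>k. var_bound\<^sup>2 * (1 / real k ^ 16)"])
        (auto intro: eventually_mono[OF eventually_gt_at_top[of 0]])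
  qed
  have sr_lim: "(\<lambda>k. sqrt (var_bound * \<rho> k)) \<longlonglongrightarrow> 0"
    using tendsto_real_sqrt[OF tendsto_mult_right_zero[OF \<rho>_lim, of var_bound]] by simp
  have \<eta>_lim: "\<eta> \<longlonglongrightarrow> 0"
  proof -
    have "\<eta> \<longlonglongrightarrow> \<bar>t\<bar> * 0 + 2 * \<bar>t\<bar> * 0 + (\<bar>t\<bar> ^ 3 * 0 + t ^ 4 * 0)"
      unfolding \<eta>_def times_divide_eq_right[symmetric]
      by (intro tendsto_add tendsto_mult tendsto_const sr_lim \<delta>_lim l3 l4)
    then show ?thesis by simp
  qed
  have "\<exists>x y. cmod ((CLINT \<omega>|M. iexp (t / sqrt n * (\<Sum>s<n. V s \<omega>))) - exp (- (t\<^sup>2 * x / 2))) \<le> \<eta> (k n)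
      \<and> \<bar>x - y\<^sup>2\<bar> \<le> 2 * sqrt var_bound * \<delta> (k n) \<and> \<bar>y - sqrt (S n)\<bar> \<le> sqrt (var_bound * \<rho> (k n))"
    if "1 \<le> k n" for n
    using central_limit_level[OF that k_le k_gt, of t] unfolding \<eta>_def \<rho>_def \<delta>_def S_def by blast
  then obtain x y where xy: "\<And>n. 1 \<le> k n \<Longrightarrow> cmod ((CLINT \<omega>|M. iexp (t / sqrt n * (\<Sum>s<n. V s \<omega>))) - exp (- (t\<^sup>2 * x n / 2))) \<le> \<eta> (k n)"
    "\<And>n. 1 \<le> k n \<Longrightarrow> \<bar>x n - (y n)\<^sup>2\<bar> \<le> 2 * sqrt var_bound * \<delta> (k n)"
    "\<And>n. 1 \<le> k n \<Longrightarrow> \<bar>y n - sqrt (S n)\<bar> \<le> sqrt (var_bound * \<rho> (k n))"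
    by metis
  have ev: "\<forall>\<^sub>F n in sequentially. 1 \<le> k n"
    using k_lim by (simp add: filterlim_at_top)
  have k_comp: "(\<lambda>n. f (k n)) \<longlonglongrightarrow> 0" if "f \<longlonglongrightarrow> (0::real)" for f
    using filterlim_compose[OF that k_lim] .
  have "(\<lambda>n. y n - sqrt (S n)) \<longlonglongrightarrow> 0"
    by (rule Lim_null_comparison[OF _ k_comp[OF sr_lim]]) (use ev xy(3) in \<open>auto elim: eventually_mono\<close>)
  moreover have "(\<lambda>n. sqrt (S n)) \<longlonglongrightarrow> sqrt v"
    using var unfolding S_def by (intro tendsto_real_sqrt)
  ultimately have "(\<lambda>n. (y n - sqrt (S n)) + sqrt (S n)) \<longlonglongrightarrow> 0 + sqrt v" by (rule tendsto_add)
  then have "(\<lambda>n. (y n)\<^sup>2) \<longlonglongrightarrow> (sqrt v)\<^sup>2" by (intro tendsto_power) simp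
  moreover have "0 \<le> v"
    by (rule tendsto_lowerbound[OF var]) auto
  ultimately have y2: "(\<lambda>n. (y n)\<^sup>2) \<longlonglongrightarrow> v" by simp
  have "(\<lambda>n. x n - (y n)\<^sup>2) \<longlonglongrightarrow> 0"
    by (rule Lim_null_comparison[OF _ k_comp[OF tendsto_mult_right_zero[OF \<delta>_lim, of "2 * sqrt var_bound"]]])
      (use ev xy(2) in \<open>auto elim: eventually_mono\<close>)
  from tendsto_add[OF this y2] have x: "x \<longlonglongrightarrow> v" by simp
  have "(\<lambda>n. (CLINT \<omega>|M. iexp (t / sqrt n * (\<Sum>s<n. V s \<omega>))) - exp (- (t\<^sup>2 * x n / 2))) \<longlonglongrightarrow> 0"
    by (rule Lim_null_comparison[OF _ k_comp[OF \<eta>_lim]]) (use ev xy(1) in \<open>auto elim: eventually_mono\<close>)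
  moreover have "(\<lambda>n. complex_of_real (exp (- (t\<^sup>2 * x n / 2)))) \<longlonglongrightarrow> of_real (exp (- (t\<^sup>2 * v / 2)))"
    by (intro tendsto_intros x) auto
  ultimately show ?thesis using tendsto_add by fastforce
qed

end

subsection \<open>Powers of correlated Gaussian variables\<close>

text \<open>Mean value theorem, with the derivative \<open>p * z powr (p - 1)\<close> estimated at
  the larger end. An end point 0 is treated separately so that differentiation takes place on
  positive reals only.\<close>

lemma abs_powr_diff_le:
  fixes a b p :: real
  assumes "1 \<le> p"
  shows "\<bar>\<bar>a\<bar> powr p - \<bar>b\<bar> powr p\<bar> \<le> p * \<bar>a - b\<bar> * (\<bar>a\<bar> + \<bar>b\<bar>) powr (p - 1)"
proof -
  have main: "a powr p - b powr p \<le> p * (a - b) * (a + b) powr (p - 1)" if ba: "0 \<le> b" "b \<le> a" for a b :: real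
  proof -
    have "a powr p - b powr p \<le> p * (a - b) * a powr (p - 1)"
    proof (cases "b = 0 \<or> a = b")
      case True
      then consider "a = b" | "b = 0" "0 < a" using True ba by fastforce
      then show ?thesis
      proof cases
        case 2
        then have "a powr p = a * a powr (p - 1)" by (simp add: powr_mult_base)
        also have "\<dots> \<le> p * (a * a powr (p - 1))" using assms 2 mult_right_mono[of 1 p "a * a powr (p - 1)"] by simp
        finally show ?thesis using 2 assms by (simp add: mult.assoc)
      qed simp
    next
      case False
      with that have ab: "0 < b" "b < a" by auto
      have "\<exists>z. b < z \<and> z < a \<and> a powr p - b powr p = (a - b) * (p * z powr (p - 1))"
        using ab by (intro MVT2) (auto intro!: derivative_eq_intros)
      then obtain z where z: "b < z" "z < a" "a powr p - b powr p = (a - b) * (p * z powr (p - 1))" by blast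
      have "z powr (p - 1) \<le> a powr (p - 1)" using z ab assms by (intro powr_mono2) auto
      then show ?thesis using z ab assms by (simp add: mult_left_mono mult.assoc mult.left_commute)
    qed
    also have "\<dots> \<le> p * (a - b) * (a + b) powr (p - 1)"
      using that assms by (intro mult_left_mono powr_mono2) auto
    finally show ?thesis .
  qed
  have le: "\<bar>\<bar>a\<bar> powr p - \<bar>b\<bar> powr p\<bar> \<le> p * \<bar>a - b\<bar> * (\<bar>a\<bar> + \<bar>b\<bar>) powr (p - 1)" if "\<bar>b\<bar> \<le> \<bar>a\<bar>" for a b :: real
  proof -
    have "\<bar>b\<bar> powr p \<le> \<bar>a\<bar> powr p" using that assms by (intro powr_mono2) auto
    then have "\<bar>\<bar>a\<bar> powr p - \<bar>b\<bar> powr p\<bar> \<le> p * (\<bar>a\<bar> - \<bar>b\<bar>) * (\<bar>a\<bar> + \<bar>b\<bar>) powr (p - 1)"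
      using main[of "\<bar>b\<bar>" "\<bar>a\<bar>"] that by simp
    also have "\<dots> \<le> p * \<bar>a - b\<bar> * (\<bar>a\<bar> + \<bar>b\<bar>) powr (p - 1)"
      using assms by (intro mult_right_mono mult_left_mono) auto
    finally show ?thesis .
  qed
  show ?thesis
  proof (cases "\<bar>b\<bar> \<le> \<bar>a\<bar>")
    case False
    then show ?thesis using le[of a b] by (simp add: abs_minus_commute add.commute)
  qed (rule le)
qed

lemma add_powr_le:
  fixes x y p :: real
  assumes "0 \<le> x" "0 \<le> y" "0 \<le> p"
  shows "(x + y) powr p \<le> 2 powr p * (x powr p + y powr p)"
proof -
  have "(x + y) powr p \<le> (2 * max x y) powr p" using assms by (intro powr_mono2) auto
  also have "\<dots> = 2 powr p * max x y powr p" using assms by (simp add: powr_mult)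
  also have "max x y powr p \<le> x powr p + y powr p" by (auto simp: max_def)
  finally show ?thesis by simp
qed

text \<open>The triangle inequality reduces to nonnegative arguments. If one of them vanishes, the
  claim becomes \<open>s powr p \<le> s\<close> on the unit interval; otherwise convexity on
  positive reals applies.\<close>

lemma abs_powr_convex:
  fixes x y p t :: real
  assumes p: "1 \<le> p" and t: "0 \<le> t" "t \<le> 1"
  shows "\<bar>t * x + (1 - t) * y\<bar> powr p \<le> t * \<bar>x\<bar> powr p + (1 - t) * \<bar>y\<bar> powr p"
proof -
  have small: "s powr p \<le> s" if "0 \<le> s" "s \<le> 1" for s :: real
    using that p powr_mono'[of 1 p s] by (cases "s = 0") auto
  have "\<bar>t * x + (1 - t) * y\<bar> \<le> t * \<bar>x\<bar> + (1 - t) * \<bar>y\<bar>"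
    using abs_triangle_ineq[of "t * x" "(1 - t) * y"] t by (simp add: abs_mult)
  then have "\<bar>t * x + (1 - t) * y\<bar> powr p \<le> (t * \<bar>x\<bar> + (1 - t) * \<bar>y\<bar>) powr p"
    using p by (intro powr_mono2) auto
  also have "\<dots> \<le> t * \<bar>x\<bar> powr p + (1 - t) * \<bar>y\<bar> powr p"
  proof (cases "x = 0 \<or> y = 0")
    case True
    then show ?thesis using small[of t] small[of "1 - t"] t p
      by (auto simp: powr_mult intro!: mult_right_mono)
  next
    case False
    then show ?thesis using convex_onD[OF powr_convex[OF p], of "1 - t" "\<bar>x\<bar>" "\<bar>y\<bar>"] t by simp
  qed
  finally show ?thesis .
qed

section \<open>Moments and substitutions for the standard normal law\<close>

abbreviation (input) "\<N> \<equiv> std_normal_distribution"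

lemma integral_std_normal:
  fixes f :: "real \<Rightarrow> real"
  assumes [measurable]: "f \<in> borel_measurable borel"
  shows "(\<integral>x. f x \<partial>\<N>) = (LBINT x. f x * std_normal_density x)"
  by (subst integral_density) (auto simp: mult.commute)

lemma integrable_std_normal_iff:
  fixes f :: "real \<Rightarrow> real"
  assumes [measurable]: "f \<in> borel_measurable borel"
  shows "integrable \<N> f \<longleftrightarrow> integrable lborel (\<lambda>x. f x * std_normal_density x)"
  by (subst integrable_density) (auto simp: mult.commute)

lemma integrable_std_normal_powr:
  assumes "0 \<le> q"
  shows "integrable \<N> (\<lambda>x. \<bar>x\<bar> powr q)"
proof -
  interpret real_distribution \<N> by (rule real_dist_normal_dist)
  define m where "m = nat \<lceil>q\<rceil>"
  have m: "q \<le> real m" by (simp add: m_def of_nat_ceiling)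
  have "integrable lborel (\<lambda>x. \<bar>x\<bar> ^ m * std_normal_density x)"
    using integrable_std_normal_moment_abs[of m] by (simp add: mult.commute)
  then have "integrable \<N> (\<lambda>x. \<bar>x\<bar> ^ m)" by (simp add: integrable_std_normal_iff)
  then have i: "integrable \<N> (\<lambda>x. 1 + \<bar>x\<bar> ^ m)" by simp
  show ?thesis
  proof (rule Bochner_Integration.integrable_bound[OF i])
    show "AE x in \<N>. norm (\<bar>x\<bar> powr q) \<le> norm (1 + \<bar>x\<bar> ^ m)"
    proof (rule AE_I2)
      fix x :: real
      show "norm (\<bar>x\<bar> powr q) \<le> norm (1 + \<bar>x\<bar> ^ m)"
      proof (cases "\<bar>x\<bar> \<le> 1")
        case True
        then have "\<bar>x\<bar> powr q \<le> 1" using assms powr_mono2[of q "\<bar>x\<bar>" 1] by simp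
        then show ?thesis by (simp add: add_increasing2)
      next
        case False
        then have "\<bar>x\<bar> powr q \<le> \<bar>x\<bar> powr real m" using m by (intro powr_mono) auto
        also have "\<dots> = \<bar>x\<bar> ^ m" using False by (intro powr_realpow) auto
        finally show ?thesis by simp
      qed
    qed
  qed simp
qed

lemma b_const_eq: "b_const p = (\<integral>x. \<bar>x\<bar> powr p \<partial>\<N>)"
  by (simp add: b_const_def integral_std_normal)

lemma b_const_nonneg: "0 \<le> b_const p"
  by (simp add: b_const_eq)

lemma integral_std_normal_uminus:
  fixes f :: "real \<Rightarrow> real"
  assumes [measurable]: "f \<in> borel_measurable borel"
  shows "(\<integral>x. f (- x) \<partial>\<N>) = (\<integral>x. f x \<partial>\<N>)"
proof -
  have "std_normal_density (- x) = std_normal_density x" for x by (simp add: normal_density_def)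
  then show ?thesis
    using lborel_integral_real_affine[of "-1" "\<lambda>x. f x * std_normal_density x" 0]
    by (simp add: integral_std_normal)
qed

lemma integral_normal_density_affine:
  fixes f :: "real \<Rightarrow> real"
  assumes [measurable]: "f \<in> borel_measurable borel" and s: "0 < s"
  shows "(LBINT x. f x * normal_density m s x) = (\<integral>x. f (m + s * x) \<partial>\<N>)"
proof -
  have "s * normal_density m s (m + s * x) = std_normal_density x" for x
    using s by (simp add: normal_density_def real_sqrt_mult power_mult_distrib field_simps)
  then have eq: "s * (f (m + s * x) * normal_density m s (m + s * x)) = f (m + s * x) * std_normal_density x" for x
    by (metis mult.left_commute)
  have "(LBINT x. f x * normal_density m s x) = s * (LBINT x. f (m + s * x) * normal_density m s (m + s * x))"
    using s lborel_integral_real_affine[of s "\<lambda>x. f x * normal_density m s x" m] by simp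
  also have "\<dots> = (LBINT x. f (m + s * x) * std_normal_density x)"
    unfolding eq[symmetric] by simp
  also have "\<dots> = (\<integral>x. f (m + s * x) \<partial>\<N>)"
    by (simp add: integral_std_normal del: std_normal_density_def)
  finally show ?thesis .
qed

section \<open>The covariance of powers of two correlated normal variables\<close>

interpretation \<N>: real_distribution \<N> by (rule real_dist_normal_dist)

interpretation \<N>2: pair_prob_space \<N> \<N> ..

lemma integrable_\<N>2_mult:
  fixes f g :: "real \<Rightarrow> real"
  assumes f: "integrable \<N> f" and g: "integrable \<N> g"
  shows "integrable (\<N> \<Otimes>\<^sub>M \<N>) (\<lambda>(y, z). f y * g z)"
    and "(\<integral>(y, z). f y * g z \<partial>(\<N> \<Otimes>\<^sub>M \<N>)) = (\<integral>y. f y \<partial>\<N>) * (\<integral>z. g z \<partial>\<N>)"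
proof -
  have [measurable]: "f \<in> borel_measurable borel" "g \<in> borel_measurable borel"
    using borel_measurable_integrable[OF f] borel_measurable_integrable[OF g] by simp_all
  show I: "integrable (\<N> \<Otimes>\<^sub>M \<N>) (\<lambda>(y, z). f y * g z)"
  proof (rule \<N>2.Fubini_integrable)
    show "integrable \<N> (\<lambda>y. \<integral>z. norm (case (y, z) of (y, z) \<Rightarrow> f y * g z) \<partial>\<N>)"
      using f by (simp add: abs_mult)
    show "AE y in \<N>. integrable \<N> (\<lambda>z. case (y, z) of (y, z) \<Rightarrow> f y * g z)"
      using g by simp
  qed measurable
  show "(\<integral>(y, z). f y * g z \<partial>(\<N> \<Otimes>\<^sub>M \<N>)) = (\<integral>y. f y \<partial>\<N>) * (\<integral>z. g z \<partial>\<N>)"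
    using \<N>2.integral_fst'[OF I] by simp
qed

text \<open>For \<open>r\<close> between 0 and 1 this is the covariance of the \<open>p\<close>-th
  absolute powers of a standard normal pair with correlation \<open>r\<close>; the second variable
  is built from the first and an independent one.\<close>

definition cor_pow :: "real \<Rightarrow> real \<Rightarrow> real" where
  "cor_pow p r = (\<integral>(y, z). \<bar>y\<bar> powr p * \<bar>r * y + sqrt (1 - r\<^sup>2) * z\<bar> powr p \<partial>(\<N> \<Otimes>\<^sub>M \<N>)) - (b_const p)\<^sup>2"

lemma cor_pow_measurable [measurable]: "cor_pow p \<in> borel_measurable borel"
  unfolding cor_pow_def[abs_def] by measurable

text \<open>Rests on \<open>1 - r \<le> sqrt (1 - r^2)\<close>. The second estimate says that the
  correlated variable is within order \<open>r\<close> of the independent one, which becomes the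
  linear decay of the covariance.\<close>

lemma abs_correlated_le:
  fixes r y z :: real
  assumes "0 \<le> r" "r \<le> 1"
  shows "\<bar>r * y + sqrt (1 - r\<^sup>2) * z\<bar> \<le> \<bar>y\<bar> + \<bar>z\<bar>"
    and "\<bar>r * y + sqrt (1 - r\<^sup>2) * z - z\<bar> \<le> r * (\<bar>y\<bar> + \<bar>z\<bar>)"
proof -
  have r2: "r\<^sup>2 \<le> r" using assms by (simp add: power2_eq_square mult_left_le)
  have s: "0 \<le> sqrt (1 - r\<^sup>2)" "sqrt (1 - r\<^sup>2) \<le> 1" using assms r2 by auto
  have "1 - r \<le> sqrt (1 - r\<^sup>2)"
  proof (rule real_le_rsqrt)
    show "(1 - r)\<^sup>2 \<le> 1 - r\<^sup>2" using r2 by (simp add: power2_diff)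
  qed
  then have s2: "\<bar>sqrt (1 - r\<^sup>2) - 1\<bar> \<le> r" using s by simp
  show "\<bar>r * y + sqrt (1 - r\<^sup>2) * z\<bar> \<le> \<bar>y\<bar> + \<bar>z\<bar>"
  proof -
    have "\<bar>r * y + sqrt (1 - r\<^sup>2) * z\<bar> \<le> r * \<bar>y\<bar> + sqrt (1 - r\<^sup>2) * \<bar>z\<bar>"
      using abs_triangle_ineq[of "r * y" "sqrt (1 - r\<^sup>2) * z"] assms s by (simp add: abs_mult)
    also have "\<dots> \<le> 1 * \<bar>y\<bar> + 1 * \<bar>z\<bar>" using assms s by (intro add_mono mult_right_mono) auto
    finally show ?thesis by simp
  qed
  have "\<bar>r * y + sqrt (1 - r\<^sup>2) * z - z\<bar> = \<bar>r * y + (sqrt (1 - r\<^sup>2) - 1) * z\<bar>" by (simp add: algebra_simps)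
  also have "\<dots> \<le> r * \<bar>y\<bar> + \<bar>sqrt (1 - r\<^sup>2) - 1\<bar> * \<bar>z\<bar>"
    using abs_triangle_ineq[of "r * y" "(sqrt (1 - r\<^sup>2) - 1) * z"] assms by (simp add: abs_mult)
  also have "\<dots> \<le> r * \<bar>y\<bar> + r * \<bar>z\<bar>" using s2 by (intro add_mono mult_right_mono) auto
  finally show "\<bar>r * y + sqrt (1 - r\<^sup>2) * z - z\<bar> \<le> r * (\<bar>y\<bar> + \<bar>z\<bar>)" by (simp add: algebra_simps)
qed

lemma integrable_pow_bound:
  assumes "1 \<le> p"
  shows "integrable (\<N> \<Otimes>\<^sub>M \<N>) (\<lambda>(y, z). c * (\<bar>y\<bar> powr p * (\<bar>y\<bar> powr p + \<bar>z\<bar> powr p)))"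
proof -
  have "integrable (\<N> \<Otimes>\<^sub>M \<N>) (\<lambda>x. c * ((\<lambda>(y, z). \<bar>y\<bar> powr (2 * p) * 1) x + (\<lambda>(y, z). \<bar>y\<bar> powr p * \<bar>z\<bar> powr p) x))"
    using assms by (intro integrable_mult_right Bochner_Integration.integrable_add integrable_\<N>2_mult
        integrable_std_normal_powr) auto
  moreover have "\<bar>y\<bar> powr (2 * p) = \<bar>y\<bar> powr p * \<bar>y\<bar> powr p" for y :: real
    by (simp add: powr_add[symmetric])
  ultimately show ?thesis by (simp add: case_prod_unfold distrib_left)
qed

text \<open>The right-hand side does not involve \<open>r\<close>, so it yields integrability for
  each \<open>r\<close> and a common dominating function for the continuity in
  \<open>r\<close>.\<close>

lemma correlated_pow_le:
  fixes r y z p :: real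
  assumes "0 \<le> r" "r \<le> 1" "1 \<le> p"
  shows "\<bar>\<bar>y\<bar> powr p * \<bar>r * y + sqrt (1 - r\<^sup>2) * z\<bar> powr p\<bar> \<le> 2 powr p * (\<bar>y\<bar> powr p * (\<bar>y\<bar> powr p + \<bar>z\<bar> powr p))"
proof -
  have "\<bar>r * y + sqrt (1 - r\<^sup>2) * z\<bar> powr p \<le> (\<bar>y\<bar> + \<bar>z\<bar>) powr p"
    using abs_correlated_le(1)[OF assms(1,2)] assms by (intro powr_mono2) auto
  also have "\<dots> \<le> 2 powr p * (\<bar>y\<bar> powr p + \<bar>z\<bar> powr p)"
    using assms by (intro add_powr_le) auto
  finally have "\<bar>y\<bar> powr p * \<bar>r * y + sqrt (1 - r\<^sup>2) * z\<bar> powr p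
     \<le> \<bar>y\<bar> powr p * (2 powr p * (\<bar>y\<bar> powr p + \<bar>z\<bar> powr p))" by (intro mult_left_mono) auto
  then show ?thesis by (simp add: mult_ac)
qed

lemma integrable_correlated_pow:
  assumes "0 \<le> r" "r \<le> 1" "1 \<le> p"
  shows "integrable (\<N> \<Otimes>\<^sub>M \<N>) (\<lambda>(y, z). \<bar>y\<bar> powr p * \<bar>r * y + sqrt (1 - r\<^sup>2) * z\<bar> powr p)"
  by (rule Bochner_Integration.integrable_bound[OF integrable_pow_bound[OF assms(3), of "2 powr p"]])
    (use correlated_pow_le[OF assms] in \<open>auto intro!: AE_I2 order_trans[OF _ abs_ge_self]\<close>)

lemma cor_pow_tendsto:
  assumes p: "1 \<le> p" and r: "\<And>n. 0 \<le> r n" "\<And>n. r n \<le> 1" and lim: "r \<longlonglongrightarrow> s"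
  shows "(\<lambda>n. cor_pow p (r n)) \<longlonglongrightarrow> cor_pow p s"
  unfolding cor_pow_def
proof (intro tendsto_diff tendsto_const integral_dominated_convergence)
  show "integrable (\<N> \<Otimes>\<^sub>M \<N>) (\<lambda>(y, z). 2 powr p * (\<bar>y\<bar> powr p * (\<bar>y\<bar> powr p + \<bar>z\<bar> powr p)))"
    by (rule integrable_pow_bound[OF p])
  show "AE x in \<N> \<Otimes>\<^sub>M \<N>. (\<lambda>n. case x of (y, z) \<Rightarrow> \<bar>y\<bar> powr p * \<bar>r n * y + sqrt (1 - (r n)\<^sup>2) * z\<bar> powr p)
      \<longlonglongrightarrow> (case x of (y, z) \<Rightarrow> \<bar>y\<bar> powr p * \<bar>s * y + sqrt (1 - s\<^sup>2) * z\<bar> powr p)"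
    using p by (intro AE_I2) (auto intro!: tendsto_intros lim tendsto_powr2 simp: case_prod_unfold)
  show "AE x in \<N> \<Otimes>\<^sub>M \<N>. norm (case x of (y, z) \<Rightarrow> \<bar>y\<bar> powr p * \<bar>r n * y + sqrt (1 - (r n)\<^sup>2) * z\<bar> powr p)
      \<le> (case x of (y, z) \<Rightarrow> 2 powr p * (\<bar>y\<bar> powr p * (\<bar>y\<bar> powr p + \<bar>z\<bar> powr p)))" for n
    using correlated_pow_le[OF r p] by (intro AE_I2) auto
qed measurable

text \<open>At correlation 0 the integrand is a product of two independent powers with mean
  \<open>(b_const p)^2\<close>; the covariance is the integral of the pointwise difference from that
  product, which is of order \<open>r\<close>. With \<open>r = exp (- |u|)\<close> this provides the
  integrability and domination needed for \<open>a_const\<close>.\<close>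

lemma cor_pow_linear_bound:
  assumes p: "1 \<le> p"
  obtains K where "0 \<le> K" "\<And>r. 0 \<le> r \<Longrightarrow> r \<le> 1 \<Longrightarrow> \<bar>cor_pow p r\<bar> \<le> K * r"
proof -
  \<comment> \<open>The 4 is 2 times 2: one factor \<open>2 powr p\<close> comes from
    \<open>|w| + |z| \<le> 2 * s\<close>, the other from splitting the power of the sum
    \<open>s\<close>.\<close>
  define c where "c = p * 4 powr p"
  define B where "B = (\<lambda>(y::real, z::real). c * (\<bar>y\<bar> powr p * (\<bar>y\<bar> powr p + \<bar>z\<bar> powr p)))"
  have B0: "0 \<le> B x" for x using p by (auto simp: B_def c_def case_prod_unfold)
  have iB: "integrable (\<N> \<Otimes>\<^sub>M \<N>) B" unfolding B_def by (rule integrable_pow_bound[OF p])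
  have bound: "\<bar>cor_pow p r\<bar> \<le> (\<integral>x. B x \<partial>(\<N> \<Otimes>\<^sub>M \<N>)) * r" if r: "0 \<le> r" "r \<le> 1" for r
  proof -
    let ?f = "\<lambda>(y, z). \<bar>y\<bar> powr p * \<bar>r * y + sqrt (1 - r\<^sup>2) * z\<bar> powr p"
    let ?g = "\<lambda>(y::real, z::real). \<bar>y\<bar> powr p * \<bar>z\<bar> powr p"
    have if': "integrable (\<N> \<Otimes>\<^sub>M \<N>) ?f" by (rule integrable_correlated_pow[OF r p])
    have ig: "integrable (\<N> \<Otimes>\<^sub>M \<N>) ?g" "(\<integral>x. ?g x \<partial>(\<N> \<Otimes>\<^sub>M \<N>)) = (b_const p)\<^sup>2"
      using integrable_\<N>2_mult[of "\<lambda>y. \<bar>y\<bar> powr p" "\<lambda>y. \<bar>y\<bar> powr p"] integrable_std_normal_powr[of p] p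
      by (auto simp: b_const_eq power2_eq_square)
    have pt: "norm (?f x - ?g x) \<le> B x * r" for x
    proof -
      obtain y z where x: "x = (y, z)" by (cases x)
      define w where "w = r * y + sqrt (1 - r\<^sup>2) * z"
      define s where "s = \<bar>y\<bar> + \<bar>z\<bar>"
      have w: "\<bar>w\<bar> \<le> s" "\<bar>w - z\<bar> \<le> r * s" using abs_correlated_le[OF r] by (auto simp: w_def s_def)
      have s0: "0 \<le> s" "\<bar>z\<bar> \<le> s" by (auto simp: s_def)
      have "\<bar>\<bar>w\<bar> powr p - \<bar>z\<bar> powr p\<bar> \<le> p * \<bar>w - z\<bar> * (\<bar>w\<bar> + \<bar>z\<bar>) powr (p - 1)"
        by (rule abs_powr_diff_le[OF p])
      also have "\<dots> \<le> p * (r * s) * (2 * s) powr (p - 1)"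
        using w s0 p r by (intro mult_mono mult_left_mono powr_mono2) auto
      also have "\<dots> \<le> p * (r * (2 * s)) * (2 * s) powr (p - 1)"
        using s0 p r by (intro mult_right_mono mult_left_mono) auto
      also have "\<dots> = p * r * (2 * s) powr p"
      proof -
        have "(2 * s) * (2 * s) powr (p - 1) = (2 * s) powr p"
          using s0 powr_mult_base[of "2 * s" "p - 1"] by simp
        then show ?thesis by (metis mult.assoc)
      qed
      also have "\<dots> \<le> p * r * (2 powr p * (2 powr p * (\<bar>y\<bar> powr p + \<bar>z\<bar> powr p)))"
      proof (intro mult_left_mono)
        have "(2 * s) powr p = 2 powr p * s powr p" using s0 by (simp add: powr_mult)
        also have "\<dots> \<le> 2 powr p * (2 powr p * (\<bar>y\<bar> powr p + \<bar>z\<bar> powr p))"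
          unfolding s_def using p by (intro mult_left_mono add_powr_le) auto
        finally show "(2 * s) powr p \<le> 2 powr p * (2 powr p * (\<bar>y\<bar> powr p + \<bar>z\<bar> powr p))" .
      qed (use p r in auto)
      also have "\<dots> = c * (\<bar>y\<bar> powr p + \<bar>z\<bar> powr p) * r"
        using powr_mult[of 2 2 p] by (simp add: c_def mult_ac)
      finally have "\<bar>y\<bar> powr p * \<bar>\<bar>w\<bar> powr p - \<bar>z\<bar> powr p\<bar> \<le> \<bar>y\<bar> powr p * (c * (\<bar>y\<bar> powr p + \<bar>z\<bar> powr p) * r)"
        by (intro mult_left_mono) auto
      moreover have "?f x - ?g x = \<bar>y\<bar> powr p * (\<bar>w\<bar> powr p - \<bar>z\<bar> powr p)"
        by (simp add: x w_def right_diff_distrib)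
      ultimately show ?thesis by (simp add: x B_def abs_mult mult_ac)
    qed
    have cor: "cor_pow p r = (\<integral>x. ?f x - ?g x \<partial>(\<N> \<Otimes>\<^sub>M \<N>))"
      unfolding cor_pow_def ig(2)[symmetric] by (rule Bochner_Integration.integral_diff[OF if' ig(1), symmetric])
    have "\<bar>cor_pow p r\<bar> \<le> (\<integral>x. norm (?f x - ?g x) \<partial>(\<N> \<Otimes>\<^sub>M \<N>))"
      unfolding cor real_norm_def[symmetric] by (rule integral_norm_bound)
    also have "\<dots> \<le> (\<integral>x. B x * r \<partial>(\<N> \<Otimes>\<^sub>M \<N>))"
      by (rule integral_mono[OF integrable_norm[OF Bochner_Integration.integrable_diff[OF if' ig(1)]] integrable_mult_left[OF iB] pt])
    finally show ?thesis by (simp only: integral_mult_left_zero)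
  qed
  show thesis
    by (rule that[OF _ bound]) (simp add: B0)
qed

section \<open>Conditional expectations and strict positivity of the covariance\<close>

lemma (in prob_space) correlated_std_normal:
  assumes X: "distributed M lborel X std_normal_density" and Z: "distributed M lborel Z std_normal_density"
    and ind: "indep_var borel X borel Z" and r: "0 < r" "r < 1"
  shows "distributed M lborel (\<lambda>\<omega>. r * X \<omega> + sqrt (1 - r\<^sup>2) * Z \<omega>) std_normal_density"
proof -
  have "r\<^sup>2 < 1" using r by (simp add: power_less_one_iff)
  then have s: "0 < sqrt (1 - r\<^sup>2)" by simp
  have 1: "distributed M lborel (\<lambda>\<omega>. r * X \<omega>) (normal_density 0 r)"
    using normal_density_affine[OF X, of r 0] r by simp
  have 2: "distributed M lborel (\<lambda>\<omega>. sqrt (1 - r\<^sup>2) * Z \<omega>) (normal_density 0 (sqrt (1 - r\<^sup>2)))"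
    using normal_density_affine[OF Z, of "sqrt (1 - r\<^sup>2)" 0] s by simp
  have 3: "indep_var borel (\<lambda>\<omega>. r * X \<omega>) borel (\<lambda>\<omega>. sqrt (1 - r\<^sup>2) * Z \<omega>)"
    using indep_var_compose[OF ind, of "\<lambda>x. r * x" borel "\<lambda>x. sqrt (1 - r\<^sup>2) * x" borel] by (simp add: comp_def)
  show ?thesis
    using add_indep_normal[OF 3 r(1) s 1 2] \<open>r\<^sup>2 < 1\<close> by simp
qed

text \<open>The two coordinates of the product space are recognised as independent standard normal
  variables, so the combination with squared coefficients adding to 1 is standard normal too. Both
  coefficients must be positive for the scaled variables to have normal densities, hence the strict
  bounds on \<open>r\<close>.\<close>

lemma \<N>2_correlated:
  fixes f :: "real \<Rightarrow> real"
  assumes r: "0 < r" "r < 1" and [measurable]: "f \<in> borel_measurable borel"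
  shows "(\<integral>(y, z). f (r * y + sqrt (1 - r\<^sup>2) * z) \<partial>(\<N> \<Otimes>\<^sub>M \<N>)) = (\<integral>x. f x \<partial>\<N>)"
proof -
  have P: "prob_space (\<N> \<Otimes>\<^sub>M \<N>)" by (rule \<N>2.prob_space_axioms)
  have d1: "distr (\<N> \<Otimes>\<^sub>M \<N>) borel fst = \<N>"
  proof -
    have "distr (\<N> \<Otimes>\<^sub>M \<N>) borel fst = distr (\<N> \<Otimes>\<^sub>M \<N>) \<N> fst" by (rule distr_cong) auto
    then show ?thesis by (simp add: \<N>.distr_pair_fst)
  qed
  have d2: "distr (\<N> \<Otimes>\<^sub>M \<N>) borel snd = \<N>"
  proof (rule measure_eqI)
    fix A assume "A \<in> sets (distr (\<N> \<Otimes>\<^sub>M \<N>) borel snd)"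
    then have A: "A \<in> sets borel" by simp
    have "snd -` A \<inter> space (\<N> \<Otimes>\<^sub>M \<N>) = UNIV \<times> A" by (auto simp: space_pair_measure)
    then have "emeasure (distr (\<N> \<Otimes>\<^sub>M \<N>) borel snd) A = emeasure (\<N> \<Otimes>\<^sub>M \<N>) (UNIV \<times> A)"
      using A by (subst emeasure_distr) auto
    also have "\<dots> = emeasure \<N> UNIV * emeasure \<N> A"
      using A by (intro \<N>.emeasure_pair_measure_Times) auto
    finally show "emeasure (distr (\<N> \<Otimes>\<^sub>M \<N>) borel snd) A = emeasure \<N> A"
      using \<N>.emeasure_space_1 by simp
  qed simp
  have dd: "distr (\<N> \<Otimes>\<^sub>M \<N>) (borel \<Otimes>\<^sub>M borel) (\<lambda>x. (fst x, snd x)) = \<N> \<Otimes>\<^sub>M \<N>"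
  proof -
    have "distr (\<N> \<Otimes>\<^sub>M \<N>) (borel \<Otimes>\<^sub>M borel) (\<lambda>x. (fst x, snd x)) = distr (\<N> \<Otimes>\<^sub>M \<N>) (\<N> \<Otimes>\<^sub>M \<N>) (\<lambda>x. x)"
      by (rule distr_cong) (auto intro!: sets_pair_measure_cong)
    then show ?thesis by simp
  qed
  have ind: "prob_space.indep_var (\<N> \<Otimes>\<^sub>M \<N>) borel fst borel snd"
    unfolding prob_space.indep_var_distribution_eq[OF P] using d1 d2 dd by auto
  have X: "distributed (\<N> \<Otimes>\<^sub>M \<N>) lborel fst std_normal_density"
    unfolding distributed_def using d1 by (auto cong: distr_cong)
  have Z: "distributed (\<N> \<Otimes>\<^sub>M \<N>) lborel snd std_normal_density"
    unfolding distributed_def using d2 by (auto cong: distr_cong)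
  have "distributed (\<N> \<Otimes>\<^sub>M \<N>) lborel (\<lambda>\<omega>. r * fst \<omega> + sqrt (1 - r\<^sup>2) * snd \<omega>) std_normal_density"
    by (rule prob_space.correlated_std_normal[OF P X Z ind r])
  from distributed_integral[OF this, of f]
  show ?thesis by (simp add: integral_std_normal case_prod_unfold mult.commute)
qed

text \<open>The conditional expectation of the \<open>p\<close>-th absolute power of the second
  variable of a pair with correlation \<open>r\<close>, given that the first equals
  \<open>y\<close>.\<close>

definition slice_pow :: "real \<Rightarrow> real \<Rightarrow> real \<Rightarrow> real" where
  "slice_pow p r y = (\<integral>z. \<bar>r * y + sqrt (1 - r\<^sup>2) * z\<bar> powr p \<partial>\<N>)"

lemma slice_pow_measurable [measurable]: "slice_pow p r \<in> borel_measurable borel"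
  unfolding slice_pow_def[abs_def] by measurable

lemma integrable_affine_pow:
  assumes "1 \<le> p"
  shows "integrable \<N> (\<lambda>z. \<bar>a + s * z\<bar> powr p)"
proof (rule Bochner_Integration.integrable_bound)
  show "integrable \<N> (\<lambda>z. 2 powr p * (\<bar>a\<bar> powr p + \<bar>s\<bar> powr p * \<bar>z\<bar> powr p))"
    using assms integrable_std_normal_powr[of p] by simp
  show "AE z in \<N>. norm (\<bar>a + s * z\<bar> powr p) \<le> norm (2 powr p * (\<bar>a\<bar> powr p + \<bar>s\<bar> powr p * \<bar>z\<bar> powr p))"
  proof (rule AE_I2)
    fix z
    have "\<bar>a + s * z\<bar> powr p \<le> (\<bar>a\<bar> + \<bar>s\<bar> * \<bar>z\<bar>) powr p"
      using assms abs_triangle_ineq[of a "s * z"] by (intro powr_mono2) (auto simp: abs_mult)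
    also have "\<dots> \<le> 2 powr p * (\<bar>a\<bar> powr p + (\<bar>s\<bar> * \<bar>z\<bar>) powr p)"
      using assms by (intro add_powr_le) auto
    finally show "norm (\<bar>a + s * z\<bar> powr p) \<le> norm (2 powr p * (\<bar>a\<bar> powr p + \<bar>s\<bar> powr p * \<bar>z\<bar> powr p))"
      by (simp add: powr_mult)
  qed
qed simp

lemma slice_pow_even: "slice_pow p r (- y) = slice_pow p r y"
proof -
  have "slice_pow p r (- y) = (\<integral>z. \<bar>r * - y + sqrt (1 - r\<^sup>2) * - z\<bar> powr p \<partial>\<N>)"
    unfolding slice_pow_def
    by (rule integral_std_normal_uminus[symmetric, of "\<lambda>z. \<bar>r * - y + sqrt (1 - r\<^sup>2) * z\<bar> powr p"]) simp
  also have "(\<lambda>z. \<bar>r * - y + sqrt (1 - r\<^sup>2) * - z\<bar> powr p) = (\<lambda>z. \<bar>r * y + sqrt (1 - r\<^sup>2) * z\<bar> powr p)"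
  proof
    fix z
    have "r * - y + sqrt (1 - r\<^sup>2) * - z = - (r * y + sqrt (1 - r\<^sup>2) * z)" by simp
    then show "\<bar>r * - y + sqrt (1 - r\<^sup>2) * - z\<bar> powr p = \<bar>r * y + sqrt (1 - r\<^sup>2) * z\<bar> powr p"
      by (simp only: abs_minus_cancel)
  qed
  finally show ?thesis by (simp add: slice_pow_def)
qed

lemma slice_pow_convex:
  assumes p: "1 \<le> p" and t: "0 \<le> t" "t \<le> 1"
  shows "slice_pow p r (t * x + (1 - t) * y) \<le> t * slice_pow p r x + (1 - t) * slice_pow p r y"
proof -
  let ?s = "sqrt (1 - r\<^sup>2)"
  have "slice_pow p r (t * x + (1 - t) * y)
    \<le> (\<integral>z. t * \<bar>r * x + ?s * z\<bar> powr p + (1 - t) * \<bar>r * y + ?s * z\<bar> powr p \<partial>\<N>)"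
    unfolding slice_pow_def
  proof (rule integral_mono)
    fix z
    have "r * (t * x + (1 - t) * y) + ?s * z = t * (r * x + ?s * z) + (1 - t) * (r * y + ?s * z)"
      by (simp add: algebra_simps)
    then show "\<bar>r * (t * x + (1 - t) * y) + ?s * z\<bar> powr p
      \<le> t * \<bar>r * x + ?s * z\<bar> powr p + (1 - t) * \<bar>r * y + ?s * z\<bar> powr p"
      using abs_powr_convex[OF p t] by simp
  qed (use p in \<open>auto intro!: integrable_affine_pow\<close>)
  also have "\<dots> = t * slice_pow p r x + (1 - t) * slice_pow p r y"
    unfolding slice_pow_def using p
    by (subst Bochner_Integration.integral_add) (auto intro!: integrable_affine_pow)
  finally show ?thesis .
qed

text \<open>An even convex function increases with the modulus of its argument: \<open>a\<close> is
  a convex combination of \<open>b\<close> and \<open>- b\<close>, at which the function takes the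
  same value.\<close>

lemma slice_pow_mono:
  assumes p: "1 \<le> p" and le: "\<bar>a\<bar> \<le> \<bar>b\<bar>"
  shows "slice_pow p r a \<le> slice_pow p r b"
proof (cases "b = 0")
  case False
  define c where "c = a / b"
  define t where "t = (1 + c) / 2"
  have "\<bar>c\<bar> \<le> 1" using le False by (simp add: c_def abs_divide)
  then have t: "0 \<le> t" "t \<le> 1" by (auto simp: t_def)
  have "t * b + (1 - t) * - b = a" using False by (simp add: t_def c_def field_simps)
  then have "slice_pow p r a \<le> t * slice_pow p r b + (1 - t) * slice_pow p r (- b)"
    using slice_pow_convex[OF p t, of r b "- b"] by simp
  then show ?thesis by (simp add: slice_pow_even algebra_simps)
qed (use le in simp)

text \<open>Jensen's inequality in elementary form: \<open>r * y\<close> is the midpoint of the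
  values at \<open>z\<close> and \<open>- z\<close>, which are equally likely. It shows that the
  conditional expectation is unbounded, which makes the positivity below strict.\<close>

lemma slice_pow_ge:
  assumes p: "1 \<le> p"
  shows "\<bar>r * y\<bar> powr p \<le> slice_pow p r y"
proof -
  let ?s = "sqrt (1 - r\<^sup>2)"
  have "\<bar>r * y\<bar> powr p = (\<integral>z. \<bar>r * y\<bar> powr p \<partial>\<N>)" using \<N>.prob_space by simp
  also have "\<dots> \<le> (\<integral>z. 1/2 * \<bar>r * y + ?s * z\<bar> powr p + 1/2 * \<bar>r * y + ?s * - z\<bar> powr p \<partial>\<N>)"
  proof (rule integral_mono)
    show "integrable \<N> (\<lambda>z. 1/2 * \<bar>r * y + ?s * z\<bar> powr p + 1/2 * \<bar>r * y + ?s * - z\<bar> powr p)"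
      using integrable_affine_pow[OF p, of "r * y" "?s"] integrable_affine_pow[OF p, of "r * y" "- ?s"] by simp
    fix z
    show "\<bar>r * y\<bar> powr p \<le> 1/2 * \<bar>r * y + ?s * z\<bar> powr p + 1/2 * \<bar>r * y + ?s * - z\<bar> powr p"
    proof -
      have "1/2 * (r * y + ?s * z) + (1 - 1/2) * (r * y + ?s * - z) = r * y"
        by (simp flip: add_divide_distrib)
      then show ?thesis
        using abs_powr_convex[OF p, of "1/2" "r * y + ?s * z" "r * y + ?s * - z"] by simp
    qed
  qed simp
  also have "\<dots> = 1/2 * slice_pow p r y + 1/2 * (\<integral>z. \<bar>r * y + ?s * - z\<bar> powr p \<partial>\<N>)"
    unfolding slice_pow_def using integrable_affine_pow[OF p, of "r * y" "?s"] integrable_affine_pow[OF p, of "r * y" "- ?s"] by simp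
  also have "(\<integral>z. \<bar>r * y + ?s * - z\<bar> powr p \<partial>\<N>) = slice_pow p r y"
    unfolding slice_pow_def by (rule integral_std_normal_uminus[of "\<lambda>z. \<bar>r * y + ?s * z\<bar> powr p"]) simp
  finally show ?thesis by simp
qed

lemma cor_pow_slice:
  assumes "0 \<le> r" "r \<le> 1" "1 \<le> p"
  shows "integrable \<N> (\<lambda>y. \<bar>y\<bar> powr p * slice_pow p r y)"
    and "cor_pow p r = (\<integral>y. \<bar>y\<bar> powr p * slice_pow p r y \<partial>\<N>) - (b_const p)\<^sup>2"
  using \<N>2.integrable_fst'[OF integrable_correlated_pow[OF assms]] \<N>2.integral_fst'[OF integrable_correlated_pow[OF assms]]
  by (simp_all add: cor_pow_def slice_pow_def)

text \<open>The law of total expectation, the second variable being standard normal itself.\<close>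

lemma integral_slice_pow:
  assumes r: "0 < r" "r < 1" and p: "1 \<le> p"
  shows "integrable \<N> (slice_pow p r)" "(\<integral>y. slice_pow p r y \<partial>\<N>) = b_const p"
proof -
  let ?f = "\<lambda>(y, z). \<bar>r * y + sqrt (1 - r\<^sup>2) * z\<bar> powr p"
  have I: "integrable (\<N> \<Otimes>\<^sub>M \<N>) ?f"
  proof (rule Bochner_Integration.integrable_bound)
    show "integrable (\<N> \<Otimes>\<^sub>M \<N>) (\<lambda>x. 2 powr p * ((\<lambda>(y, z). \<bar>y\<bar> powr p * 1) x + (\<lambda>(y, z). 1 * \<bar>z\<bar> powr p) x))"
      using p by (intro integrable_mult_right Bochner_Integration.integrable_add integrable_\<N>2_mult
          integrable_std_normal_powr) auto
    show "AE x in \<N> \<Otimes>\<^sub>M \<N>. norm (?f x) \<le> norm (2 powr p * ((\<lambda>(y, z). \<bar>y\<bar> powr p * 1) x + (\<lambda>(y, z). 1 * \<bar>z\<bar> powr p) x))"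
    proof (rule AE_I2)
      fix x :: "real \<times> real"
      obtain y z where x: "x = (y, z)" by (cases x)
      have "\<bar>r * y + sqrt (1 - r\<^sup>2) * z\<bar> powr p \<le> (\<bar>y\<bar> + \<bar>z\<bar>) powr p"
        using abs_correlated_le(1)[of r y z] r p by (intro powr_mono2) auto
      also have "\<dots> \<le> 2 powr p * (\<bar>y\<bar> powr p + \<bar>z\<bar> powr p)" using p by (intro add_powr_le) auto
      finally show "norm (?f x) \<le> norm (2 powr p * ((\<lambda>(y, z). \<bar>y\<bar> powr p * 1) x + (\<lambda>(y, z). 1 * \<bar>z\<bar> powr p) x))"
        by (simp add: x)
    qed
  qed measurable
  show "integrable \<N> (slice_pow p r)"
    using \<N>2.integrable_fst'[OF I] by (simp add: slice_pow_def[abs_def])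
  show "(\<integral>y. slice_pow p r y \<partial>\<N>) = b_const p"
    using \<N>2.integral_fst'[OF I] \<N>2_correlated[OF r, of "\<lambda>x. \<bar>x\<bar> powr p"] by (simp add: slice_pow_def b_const_eq)
qed

text \<open>Both \<open>\<bar>y\<bar> powr p\<close> and the conditional expectation \<open>slice_pow p r y\<close> increase with \<open>\<bar>y\<bar>\<close>, so
  their centred product, with the second one recentred at the level where the first equals its mean,
  is pointwise nonnegative.\<close>

lemma cor_pow_pos:
  assumes r: "0 < r" "r < 1" and p: "1 \<le> p"
  shows "0 < cor_pow p r"
proof -
  define b where "b = b_const p"
  define y0 where "y0 = b powr (1 / p)"
  have b0: "0 \<le> b" by (simp add: b_def b_const_nonneg)
  have y0: "0 \<le> y0" "y0 powr p = b" using b0 p by (auto simp: y0_def powr_powr)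
  let ?h = "slice_pow p r"
  define f where "f = (\<lambda>y. (\<bar>y\<bar> powr p - b) * (?h y - ?h y0))"
  have [measurable]: "f \<in> borel_measurable borel" by (simp add: f_def)
  have f_nonneg: "0 \<le> f y" for y
  proof (cases "\<bar>y\<bar> \<le> y0")
    case True
    then have "\<bar>y\<bar> powr p \<le> b" "?h y \<le> ?h y0"
      using y0 p powr_mono2[of p "\<bar>y\<bar>" y0] slice_pow_mono[OF p, of y y0 r] by auto
    then show ?thesis by (simp add: f_def mult_nonpos_nonpos)
  next
    case False
    then have "b \<le> \<bar>y\<bar> powr p" "?h y0 \<le> ?h y"
      using y0 p powr_mono2[of p y0 "\<bar>y\<bar>"] slice_pow_mono[OF p, of y0 y r] by auto
    then show ?thesis by (simp add: f_def)
  qed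
  \<comment> \<open>The term with \<open>?h y0\<close> integrates to 0, because
    \<open>|y| powr p - b\<close> has mean 0; the recentring therefore does not change the integral,
    which is the covariance.\<close>
  have expand: "f = (\<lambda>y. \<bar>y\<bar> powr p * ?h y - b * ?h y - ?h y0 * \<bar>y\<bar> powr p + b * ?h y0)"
    by (auto simp: f_def fun_eq_iff algebra_simps)
  have i: "integrable \<N> (\<lambda>y. \<bar>y\<bar> powr p * ?h y)" "integrable \<N> ?h" "integrable \<N> (\<lambda>y. \<bar>y\<bar> powr p)"
    using cor_pow_slice(1)[of r p] integral_slice_pow(1)[of r p] r p by (auto intro: integrable_std_normal_powr)
  have fi: "integrable \<N> f" unfolding expand using i by (intro Bochner_Integration.integrable_add Bochner_Integration.integrable_diff) auto
  have "(\<integral>y. f y \<partial>\<N>) = (\<integral>y. \<bar>y\<bar> powr p * ?h y \<partial>\<N>) - b * b - ?h y0 * b + b * ?h y0"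
    unfolding expand using i integral_slice_pow(2)[OF r p] \<N>.prob_space by (simp add: b_def b_const_eq)
  then have cor: "cor_pow p r = (\<integral>y. f y \<partial>\<N>)"
    using cor_pow_slice(2)[of r p] r p by (simp add: b_def power2_eq_square)
  have "(\<integral>y. f y \<partial>\<N>) \<noteq> 0"
  proof
    assume "(\<integral>y. f y \<partial>\<N>) = 0"
    then have "AE y in \<N>. f y = 0"
      using integral_nonneg_eq_0_iff_AE[OF fi] f_nonneg by simp
    then have ae: "AE y in lborel. f y = 0"
      by (subst (asm) AE_density) (auto simp: normal_density_pos)
    \<comment> \<open>Beyond \<open>c\<close> both factors of \<open>f\<close> are strictly
      positive: \<open>y > y0\<close> settles the first, and \<open>r * y > |?h y0| + 1\<close>
      together with \<open>slice_pow_ge\<close> the second. So \<open>f\<close> cannot vanish almost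
      everywhere.\<close>
    define c where "c = y0 + 1 + (\<bar>?h y0\<bar> + 1) / r"
    have c_pos: "f y \<noteq> 0" if "c < y" for y
    proof -
      have c0: "0 \<le> (\<bar>?h y0\<bar> + 1) / r" using r by simp
      have y: "y0 < y" "(\<bar>?h y0\<bar> + 1) / r < y" using that c0 y0 by (auto simp: c_def)
      have "b < \<bar>y\<bar> powr p" using y y0 p powr_less_mono2[of p y0 y] by auto
      moreover have "?h y0 < ?h y"
      proof -
        have "\<bar>?h y0\<bar> + 1 < r * y" using y(2) r by (simp add: field_simps)
        then have 1: "1 \<le> r * y" "?h y0 < r * y" by auto
        then have "r * y \<le> \<bar>r * y\<bar> powr p" using p powr_mono[of 1 p "r * y"] by auto
        also have "\<dots> \<le> ?h y" by (rule slice_pow_ge[OF p])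
        finally show ?thesis using 1 by simp
      qed
      ultimately show ?thesis by (simp add: f_def)
    qed
    have "AE y in lborel. y \<notin> {c<..c + 1}"
      using ae by eventually_elim (use c_pos in auto)
    then have "emeasure lborel {c<..c + 1} = 0"
      by (subst (asm) AE_iff_measurable[of "{c<..c + 1}"]) auto
    then show False by simp
  qed
  then show ?thesis unfolding cor using f_nonneg by (simp add: less_le integral_nonneg_AE)
qed

subsection \<open>The variance constant\<close>

text \<open>For \<open>u\<close> other than 0 the first summand in the braces is the bivariate
  normal density with correlation \<open>r = exp (- |u|)\<close>; it factors into the density of
  \<open>y\<close> and the conditional density of \<open>x\<close>, normal with mean
  \<open>r * y\<close> and variance \<open>1 - r^2\<close>. The double integral is then the
  covariance written through \<open>slice_pow\<close>.\<close>

lemma a_const_eq: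
  assumes p: "1 \<le> p"
  shows "a_const p = (LBINT u. cor_pow p (exp (- \<bar>u\<bar>)))"
proof -
  have inner: "(LBINT y. (LBINT x.
        \<bar>x * y\<bar> powr p *
        (1 / (2 * pi * sqrt (1 - exp (-2 * \<bar>u\<bar>))) *
           exp (- ((x\<^sup>2 + y\<^sup>2 - 2 * exp (- \<bar>u\<bar>) * x * y) / (2 * (1 - exp (-2 * \<bar>u\<bar>)))))
         - std_normal_density x * std_normal_density y))) = cor_pow p (exp (- \<bar>u\<bar>))" (is "(LBINT y. ?J y) = _") if "u \<noteq> 0" for u
  proof -
    define r where "r = exp (- \<bar>u\<bar>)"
    define s where "s = sqrt (1 - r\<^sup>2)"
    have r: "0 < r" "r < 1" using that by (auto simp: r_def)
    have r2: "exp (-2 * \<bar>u\<bar>) = r\<^sup>2" by (simp add: r_def power2_eq_square flip: exp_add)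
    have "r\<^sup>2 < 1" using r by (simp add: power_less_one_iff)
    then have s: "0 < s" "s\<^sup>2 = 1 - r\<^sup>2" by (auto simp: s_def)
    \<comment> \<open>Completing the square in \<open>x\<close>.\<close>
    have dens: "1 / (2 * pi * s) * exp (- ((x\<^sup>2 + y\<^sup>2 - 2 * r * x * y) / (2 * s\<^sup>2)))
       = std_normal_density y * normal_density (r * y) s x" for x y
    proof -
      have "- ((x\<^sup>2 + y\<^sup>2 - 2 * r * x * y) / (2 * s\<^sup>2)) = - (y\<^sup>2 / 2) + - ((x - r * y)\<^sup>2 / (2 * s\<^sup>2))"
      proof -
        have "x\<^sup>2 + y\<^sup>2 - 2 * r * x * y = y\<^sup>2 * s\<^sup>2 + (x - r * y)\<^sup>2"
          unfolding s(2) by (simp add: power2_eq_square algebra_simps)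
        then show ?thesis using s(1) by (simp add: field_simps)
      qed
      moreover have "sqrt (2 * pi * s\<^sup>2) = sqrt (2 * pi) * s" using s(1) by (simp add: real_sqrt_mult)
      moreover have "sqrt (2 * pi) * sqrt (2 * pi) = 2 * pi" by simp
      ultimately have "1 / (2 * pi * s) * exp (- ((x\<^sup>2 + y\<^sup>2 - 2 * r * x * y) / (2 * s\<^sup>2)))
        = 1 / (sqrt (2 * pi) * sqrt (2 * pi * s\<^sup>2)) * (exp (- (y\<^sup>2 / 2)) * exp (- ((x - r * y)\<^sup>2 / (2 * s\<^sup>2))))"
        by (simp only: exp_add[symmetric]) (simp only: mult.assoc[symmetric])
      then show ?thesis by (simp add: normal_density_def)
    qed
    have J: "?J y = (\<bar>y\<bar> powr p * slice_pow p r y - b_const p * \<bar>y\<bar> powr p) * std_normal_density y" for y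
    proof -
      have i1: "integrable lborel (\<lambda>x. \<bar>x\<bar> powr p * normal_density (r * y) s x)"
      proof -
        have "integrable lborel (\<lambda>x. \<bar>r * y + s * x\<bar> powr p * std_normal_density x)"
          using integrable_affine_pow[OF p, of "r * y" s] by (simp add: integrable_std_normal_iff)
        moreover have "normal_density (r * y) s (r * y + s * x) = std_normal_density x / s" for x
          using s(1) by (simp add: normal_density_def real_sqrt_mult power_mult_distrib)
        ultimately have "integrable lborel (\<lambda>x. \<bar>r * y + s * x\<bar> powr p * normal_density (r * y) s (r * y + s * x))"
          by simp
        then show ?thesis
          using s lborel_integrable_real_affine_iff[of s "\<lambda>x. \<bar>x\<bar> powr p * normal_density (r * y) s x" "r * y"] by simp
      qed
      have i2: "integrable lborel (\<lambda>x. \<bar>x\<bar> powr p * std_normal_density x)"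
        using integrable_std_normal_powr[of p] p by (simp add: integrable_std_normal_iff)
      have pt: "\<bar>x * y\<bar> powr p * (std_normal_density y * normal_density (r * y) s x - std_normal_density x * std_normal_density y)
        = \<bar>y\<bar> powr p * std_normal_density y * (\<bar>x\<bar> powr p * normal_density (r * y) s x)
          - \<bar>y\<bar> powr p * std_normal_density y * (\<bar>x\<bar> powr p * std_normal_density x)" for x
      proof -
        have "\<bar>x * y\<bar> powr p = \<bar>x\<bar> powr p * \<bar>y\<bar> powr p" by (simp add: abs_mult powr_mult)
        then show ?thesis by (simp only: right_diff_distrib mult_ac)
      qed
      have "?J y = (LBINT x. \<bar>x * y\<bar> powr p * (1 / (2 * pi * s) * exp (- ((x\<^sup>2 + y\<^sup>2 - 2 * r * x * y) / (2 * s\<^sup>2)))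
          - std_normal_density x * std_normal_density y))"
        unfolding r2 s(2) unfolding s_def r_def by (rule refl)
      also have "\<dots> = (LBINT x. \<bar>y\<bar> powr p * std_normal_density y * (\<bar>x\<bar> powr p * normal_density (r * y) s x)
          - \<bar>y\<bar> powr p * std_normal_density y * (\<bar>x\<bar> powr p * std_normal_density x))"
        unfolding dens pt by (rule refl)
      also have "\<dots> = \<bar>y\<bar> powr p * std_normal_density y * slice_pow p r y - \<bar>y\<bar> powr p * std_normal_density y * b_const p"
        using i1 i2 integral_normal_density_affine[OF _ s(1), of "\<lambda>x. \<bar>x\<bar> powr p" "r * y"]
        by (simp add: b_const_def slice_pow_def s_def)
      also have "\<dots> = (\<bar>y\<bar> powr p * slice_pow p r y - b_const p * \<bar>y\<bar> powr p) * std_normal_density y"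
        by (simp only: left_diff_distrib) (simp only: mult_ac)
      finally show ?thesis .
    qed
    have i: "integrable \<N> (\<lambda>y. \<bar>y\<bar> powr p * slice_pow p r y)" "integrable \<N> (\<lambda>y. \<bar>y\<bar> powr p)"
      using cor_pow_slice(1)[of r p] r p by (auto intro: integrable_std_normal_powr)
    have "(LBINT y. ?J y) = (\<integral>y. \<bar>y\<bar> powr p * slice_pow p r y - b_const p * \<bar>y\<bar> powr p \<partial>\<N>)"
      unfolding J by (subst integral_std_normal) auto
    also have "\<dots> = (\<integral>y. \<bar>y\<bar> powr p * slice_pow p r y \<partial>\<N>) - b_const p * b_const p"
      using i by (simp add: b_const_eq)
    also have "\<dots> = cor_pow p r" using cor_pow_slice(2)[of r p] r p by (simp add: power2_eq_square)
    finally show ?thesis by (simp add: r_def)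
  qed
  have ae: "AE u::real in lborel. u \<noteq> 0" by (rule AE_lborel_singleton)
  show ?thesis
    unfolding a_const_def
  proof (rule integral_cong_AE)
    show "(\<lambda>u. cor_pow p (exp (- \<bar>u\<bar>))) \<in> borel_measurable lborel" by measurable
    show "AE u in lborel. (LBINT y. (LBINT x.
        \<bar>x * y\<bar> powr p *
        (1 / (2 * pi * sqrt (1 - exp (-2 * \<bar>u\<bar>))) *
           exp (- ((x\<^sup>2 + y\<^sup>2 - 2 * exp (- \<bar>u\<bar>) * x * y) / (2 * (1 - exp (-2 * \<bar>u\<bar>)))))
         - std_normal_density x * std_normal_density y))) = cor_pow p (exp (- \<bar>u\<bar>))"
      using ae by eventually_elim (rule inner)
  qed measurable
qed

lemma integrable_exp_minus_abs: "integrable lborel (\<lambda>u::real. exp (- \<bar>u\<bar>))"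
proof -
  have 1: "integrable lborel (\<lambda>u::real. indicator {0<..} u * exp (- u))"
    using integrable_I0i_exp_mscale[of 1] by (simp add: set_integrable_def)
  then have 2: "integrable lborel (\<lambda>u::real. indicator {0<..} (- u) * exp u)"
    using lborel_integrable_real_affine[OF 1, of "-1" 0] by simp
  have "integrable lborel (\<lambda>u::real. indicator {0<..} u * exp (- u) + indicator {0<..} (- u) * exp u)"
    using 1 2 by (rule Bochner_Integration.integrable_add)
  moreover have "AE u::real in lborel. indicator {0<..} u * exp (- u) + indicator {0<..} (- u) * exp u = exp (- \<bar>u\<bar>)"
    using AE_lborel_singleton[of "0::real"] by eventually_elim (auto simp: indicator_def)
  ultimately show ?thesis by (subst (asm) integrable_cong_AE) auto
qed

lemma integrable_cor_pow:
  assumes p: "1 \<le> p"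
  shows "integrable lborel (\<lambda>u. cor_pow p (exp (- \<bar>u\<bar>)))"
proof -
  obtain K where K: "0 \<le> K" "\<And>r. 0 \<le> r \<Longrightarrow> r \<le> 1 \<Longrightarrow> \<bar>cor_pow p r\<bar> \<le> K * r"
    using cor_pow_linear_bound[OF p] by blast
  show ?thesis
  proof (rule Bochner_Integration.integrable_bound)
    show "integrable lborel (\<lambda>u::real. K * exp (- \<bar>u\<bar>))" by (intro integrable_mult_right integrable_exp_minus_abs)
    show "AE u in lborel. norm (cor_pow p (exp (- \<bar>u\<bar>))) \<le> norm (K * exp (- \<bar>u\<bar>))"
      using K by (intro AE_I2) (simp add: abs_mult)
  qed measurable
qed

text \<open>The integrand is strictly positive off the null set \<open>u = 0\<close>. The
  normalisation of the statistic divides by the root of this constant.\<close>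

lemma a_const_pos:
  assumes p: "1 \<le> p"
  shows "0 < a_const p"
proof -
  have pos: "0 < cor_pow p (exp (- \<bar>u\<bar>))" if "u \<noteq> 0" for u :: real
    using that by (intro cor_pow_pos p) auto
  have ae: "AE u::real in lborel. u \<noteq> 0" by (rule AE_lborel_singleton)
  have nonneg: "AE u in lborel. 0 \<le> cor_pow p (exp (- \<bar>u\<bar>))"
    using ae by eventually_elim (rule less_imp_le[OF pos])
  have "a_const p \<noteq> 0"
  proof
    assume "a_const p = 0"
    then have "AE u in lborel. cor_pow p (exp (- \<bar>u\<bar>)) = 0"
      using integral_nonneg_eq_0_iff_AE[OF integrable_cor_pow[OF p] nonneg] by (simp add: a_const_eq[OF p])
    with ae have "AE u::real in lborel. False" by eventually_elim (metis pos less_irrefl)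
    then have "emeasure lborel (UNIV :: real set) = 0" by (subst (asm) AE_iff_measurable[of UNIV]) auto
    then show False by simp
  qed
  moreover have "0 \<le> a_const p" unfolding a_const_eq[OF p] by (rule integral_nonneg_AE[OF nonneg])
  ultimately show ?thesis by simp
qed

section \<open>Logarithmic averages and the limit of the covariance sums\<close>

lemma weighted_cesaro_null:
  fixes c w :: "nat \<Rightarrow> real"
  assumes c: "c \<longlonglongrightarrow> 0" and w: "\<And>k. 0 \<le> w k"
    and L: "filterlim (\<lambda>m. \<Sum>k<m. w k) at_top sequentially"
  shows "(\<lambda>m. (\<Sum>k<m. w k * c k) / (\<Sum>k<m. w k)) \<longlonglongrightarrow> 0"
proof (rule LIMSEQ_I)
  fix e :: real assume e: "0 < e"
  obtain k0 where k0: "\<And>k. k0 \<le> k \<Longrightarrow> \<bar>c k\<bar> < e / 2"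
    using LIMSEQ_D[OF c, of "e / 2"] e by auto
  define B where "B = (\<Sum>k<k0. w k * \<bar>c k\<bar>)"
  \<comment> \<open>Once the total weight exceeds \<open>2 * B / e\<close>, the finite head costs
    less than half of the allowed \<open>e\<close>; the tail, where \<open>|c k| < e / 2\<close>,
    costs at most the other half.\<close>
  have "\<forall>\<^sub>F m in sequentially. max 1 (2 * B / e + 1) \<le> (\<Sum>k<m. w k)"
    using L unfolding filterlim_at_top by blast
  then obtain m0 where m0: "\<And>m. m0 \<le> m \<Longrightarrow> max 1 (2 * B / e + 1) \<le> (\<Sum>k<m. w k)"
    by (auto simp: eventually_sequentially)
  show "\<exists>no. \<forall>m\<ge>no. norm ((\<Sum>k<m. w k * c k) / (\<Sum>k<m. w k) - 0) < e"
  proof (intro exI allI impI)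
    fix m assume m: "max k0 m0 \<le> m"
    let ?L = "\<Sum>k<m. w k"
    have L1: "1 \<le> ?L" "2 * B / e + 1 \<le> ?L" using m0[of m] m by auto
    have "\<bar>\<Sum>k<m. w k * c k\<bar> \<le> (\<Sum>k<m. w k * \<bar>c k\<bar>)"
      using sum_abs[of "\<lambda>k. w k * c k" "{..<m}"] w by (simp add: abs_mult)
    also have "\<dots> = B + (\<Sum>k\<in>{k0..<m}. w k * \<bar>c k\<bar>)"
      using m unfolding B_def lessThan_atLeast0 by (subst sum.atLeastLessThan_concat[symmetric, of 0 k0 m]) auto
    also have "\<dots> \<le> B + (\<Sum>k\<in>{k0..<m}. w k * (e / 2))"
      using w k0 by (intro add_left_mono sum_mono mult_left_mono) (auto intro: less_imp_le)
    also have "\<dots> \<le> B + ?L * (e / 2)"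
      unfolding sum_distrib_right[symmetric] using w e by (intro add_left_mono mult_right_mono sum_mono2) auto
    also have "\<dots> < ?L * e"
    proof -
      have "2 * B / e < ?L" using L1 by simp
      then have "B < ?L * (e / 2)" using e by (simp add: field_simps)
      then show ?thesis by simp
    qed
    finally show "norm ((\<Sum>k<m. w k * c k) / ?L - 0) < e"
      using L1 by (simp add: abs_divide field_simps)
  qed
qed

lemma sum_inverse_nat: "(\<Sum>k\<in>{1..<Suc m}. 1 / real k) = harm m"
  by (simp add: harm_def atLeastLessThanSuc_atLeastAtMost inverse_eq_divide)

lemma harm_div_ln: "(\<lambda>m. harm m / ln (real m) :: real) \<longlonglongrightarrow> 1"
proof -
  have "(\<lambda>m. (harm m - ln (real m)) * (1 / ln (real m)) + 1 :: real) \<longlonglongrightarrow> euler_mascheroni * 0 + 1"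
    by (intro tendsto_intros euler_mascheroni_LIMSEQ) real_asymp
  moreover have "(harm m - ln (real m)) * (1 / ln (real m)) + 1 = harm m / ln (real m)" if "2 \<le> m" for m
    using that by (simp add: field_simps)
  ultimately show ?thesis
    by (auto elim!: Lim_transform_eventually intro: eventually_mono[OF eventually_ge_at_top[of 2]])
qed

text \<open>A weighted Cesaro mean with weights \<open>1 / k\<close>, whose total is the harmonic
  number; replacing that by \<open>ln m\<close> is harmless because their ratio tends to 1.\<close>

lemma log_cesaro:
  fixes c :: "nat \<Rightarrow> real"
  assumes c: "c \<longlonglongrightarrow> a"
  shows "(\<lambda>m. (\<Sum>k\<in>{1..<Suc m}. c k / k) / ln (real m)) \<longlonglongrightarrow> a"
proof -
  have c0: "(\<lambda>k. c (Suc k) - a) \<longlonglongrightarrow> 0"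
    using LIMSEQ_Suc[OF c] by (simp add: LIM_zero)
  have L: "(\<Sum>k<m. 1 / real (Suc k)) = harm m" for m
    by (simp add: harm_def inverse_eq_divide sum.atLeast_Suc_atMost_Suc_shift sum.atLeast1_atMost_eq)
  have at: "filterlim (harm :: nat \<Rightarrow> real) at_top sequentially" by (rule harm_at_top)
  have "(\<lambda>m. (\<Sum>k<m. 1 / real (Suc k) * (c (Suc k) - a)) / harm m) \<longlonglongrightarrow> 0"
    using weighted_cesaro_null[OF c0, of "\<lambda>k. 1 / real (Suc k)"] at unfolding L by simp
  from tendsto_mult[OF this harm_div_ln]
  have "(\<lambda>m. (\<Sum>k<m. 1 / real (Suc k) * (c (Suc k) - a)) / harm m * (harm m / ln m) + a * (harm m / ln m)) \<longlonglongrightarrow> 0 * 1 + a * 1"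
    by (rule tendsto_add) (intro tendsto_mult tendsto_const harm_div_ln)
  moreover have "(\<Sum>k<m. 1 / real (Suc k) * (c (Suc k) - a)) / harm m * (harm m / ln m) + a * (harm m / ln m)
     = (\<Sum>k\<in>{1..<Suc m}. c k / k) / ln (real m)" if "1 \<le> m" for m
  proof -
    have h: "harm m \<noteq> (0::real)" using harm_pos[of m] that by (metis less_irrefl less_le_trans zero_less_one)
    have "(\<Sum>k<m. 1 / real (Suc k) * (c (Suc k) - a)) = (\<Sum>k<m. c (Suc k) / Suc k) - a * harm m"
      by (simp add: L[symmetric] right_diff_distrib sum_subtractf sum_distrib_left)
    moreover have "(\<Sum>k<m. c (Suc k) / Suc k) = (\<Sum>k\<in>{1..<Suc m}. c k / k)"
      by (simp add: atLeastLessThanSuc_atLeastAtMost sum.atLeast1_atMost_eq)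
    moreover have "(S - a * h) / h * (h / l) + a * (h / l) = S / l" if "h \<noteq> 0" for S h l :: real
    proof -
      have "(S - a * h) / h * (h / l) = (S - a * h) / l" using that by simp
      then show ?thesis by (simp add: diff_divide_distrib)
    qed
    ultimately show ?thesis using h by metis
  qed
  ultimately show ?thesis
    by (auto elim!: Lim_transform_eventually intro: eventually_mono[OF eventually_ge_at_top[of 1]])
qed

text \<open>A Riemann sum in the variable \<open>u = ln (k / j) / 2\<close>, for which \<open>sqrt (j / k) = exp (- u)\<close>.\<close>

lemma cor_pow_riemann_sum:
  assumes p: "1 \<le> p"
  shows "(\<lambda>k. \<Sum>j\<in>{1..<k}. cor_pow p (sqrt (real j / real k)) / real j) \<longlonglongrightarrow> a_const p"
proof -
  obtain K where K: "0 \<le> K" "\<And>r. 0 \<le> r \<Longrightarrow> r \<le> 1 \<Longrightarrow> \<bar>cor_pow p r\<bar> \<le> K * r"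
    using cor_pow_linear_bound[OF p] by blast
  \<comment> \<open>Points \<open>u\<close> with \<open>ln (k / j) / 2\<close> as the next grid
    point to the right, equivalently those for which \<open>j\<close> is the integer part of
    \<open>k * exp (- 2 * u)\<close>. On the grid the correlation \<open>sqrt (j / k)\<close> is
    \<open>exp (- u)\<close>.\<close>
  define I where "I = (\<lambda>(k::nat) (j::nat). {ln (k / (j + 1)) / 2<..ln (k / j) / 2})"
  \<comment> \<open>The interval has length \<open>ln ((j + 1) / j) / 2\<close>, and this height
    makes the integral of the step exactly half of the \<open>j\<close>-th summand.\<close>
  define h where "h = (\<lambda>(k::nat) (j::nat). cor_pow p (sqrt (real j / real k)) / (j * ln ((j + 1) / j)))"
  define F where "F = (\<lambda>(k::nat) u. \<Sum>j\<in>{1..<k}. h k j * indicator (I k j) u)"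
  define g where "g = (\<lambda>u. indicator {0<..} u * cor_pow p (exp (- \<bar>u\<bar>)))"
  have I_iff: "u \<in> I k j \<longleftrightarrow> real j \<le> k * exp (- 2 * u) \<and> k * exp (- 2 * u) < real j + 1"
    if "1 \<le> j" "j < k" for u k j
  proof -
    have "ln (k / (j + 1)) < 2 * u \<longleftrightarrow> k / (j + 1) < exp (2 * u)"
    proof -
      have "0 < k / (real j + 1)" using that by simp
      then show ?thesis using exp_less_cancel_iff[of "ln (k / (real j + 1))" "2 * u"] by (simp add: add.commute)
    qed
    moreover have "2 * u \<le> ln (k / j) \<longleftrightarrow> exp (2 * u) \<le> k / j"
      using that by (intro ln_ge_iff) simp
    ultimately show ?thesis
      using that by (auto simp: I_def exp_minus field_simps)
  qed
  \<comment> \<open>The intervals are disjoint, so at most one step is active at \<open>u\<close>,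
    the one numbered by the integer part.\<close>
  have disj: "F k u = (let N = nat \<lfloor>k * exp (- 2 * u)\<rfloor> in if N \<in> {1..<k} then h k N else 0)" for k u
  proof -
    define N where "N = nat \<lfloor>k * exp (- 2 * u)\<rfloor>"
    have N: "u \<in> I k j \<longleftrightarrow> j = N" if "j \<in> {1..<k}" for j
    proof -
      have "real j \<le> k * exp (- 2 * u) \<and> k * exp (- 2 * u) < real j + 1 \<longleftrightarrow> \<lfloor>k * exp (- 2 * u)\<rfloor> = int j"
        by (simp add: floor_eq_iff)
      also have "\<dots> \<longleftrightarrow> j = N" by (auto simp: N_def)
      finally show ?thesis using that I_iff[of j k u] by simp
    qed
    have "F k u = (\<Sum>j\<in>{1..<k}. if j = N then h k j else 0)"
      unfolding F_def by (intro sum.cong refl) (simp add: N indicator_def)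
    also have "\<dots> = (if N \<in> {1..<k} then h k N else 0)" by simp
    finally show ?thesis by (simp add: N_def Let_def)
  qed
  \<comment> \<open>\<open>j * ln ((j + 1) / j)\<close> tends to 1 but is only bounded below by 1/2
    uniformly in \<open>j\<close>; this is the source of the factor 2.\<close>
  have h_bound: "\<bar>h k j\<bar> \<le> 2 * K * sqrt (real j / real k)" if "1 \<le> j" "j < k" for j k
  proof -
    have "1 / 2 \<le> real j * ln ((real j + 1) / real j)"
    proof -
      have "ln (real j / (real j + 1)) \<le> real j / (real j + 1) - 1"
        using that by (intro ln_le_minus_one) auto
      then have "1 / (real j + 1) \<le> ln ((real j + 1) / real j)"
        using that by (simp add: ln_div field_simps)
      then have "real j * (1 / (real j + 1)) \<le> real j * ln ((real j + 1) / real j)"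
        by (intro mult_left_mono) auto
      moreover have "1 / 2 \<le> real j * (1 / (real j + 1))" using that by (simp add: field_simps)
      ultimately show ?thesis by linarith
    qed
    then have d: "1 / 2 \<le> \<bar>real j * ln ((real j + 1) / real j)\<bar>" by linarith
    have c: "\<bar>cor_pow p (sqrt (real j / real k))\<bar> \<le> K * sqrt (real j / real k)"
      using that by (intro K) auto
    have "\<bar>h k j\<bar> = \<bar>cor_pow p (sqrt (real j / real k))\<bar> / \<bar>real j * ln ((real j + 1) / real j)\<bar>"
      by (simp add: h_def abs_divide add.commute)
    also have "\<dots> \<le> (K * sqrt (real j / real k)) / (1 / 2)"
      using K(1) by (intro frac_le c d) auto
    finally show ?thesis by simp
  qed
  have lim: "(\<lambda>k. \<integral>u. F k u \<partial>lborel) \<longlonglongrightarrow> (\<integral>u. g u \<partial>lborel)"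
  proof (rule integral_dominated_convergence)
    show "g \<in> borel_measurable lborel" unfolding g_def by measurable
    show "F k \<in> borel_measurable lborel" for k unfolding F_def I_def by measurable
    show "integrable lborel (\<lambda>u. 2 * K * exp (- \<bar>u\<bar>))" by (intro integrable_mult_right integrable_exp_minus_abs)
    show "AE u in lborel. norm (F k u) \<le> 2 * K * exp (- \<bar>u\<bar>)" for k
    proof (rule AE_I2)
      fix u :: real
      define N where "N = nat \<lfloor>k * exp (- 2 * u)\<rfloor>"
      show "norm (F k u) \<le> 2 * K * exp (- \<bar>u\<bar>)"
      proof (cases "N \<in> {1..<k}")
        case True
        then have N: "real N \<le> k * exp (- 2 * u)" "k * exp (- 2 * u) < real N + 1"
          by (auto simp: N_def)
        have k: "0 < real k" using True by auto
        have "real N + 1 \<le> k" using True by auto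
        have u: "0 < u"
        proof (rule ccontr)
          assume "\<not> 0 < u"
          then have "1 \<le> exp (- 2 * u)" by simp
          then have "real k \<le> k * exp (- 2 * u)" using k by (simp add: mult_le_cancel_left1)
          with N \<open>real N + 1 \<le> k\<close> show False by linarith
        qed
        have "real N / real k \<le> exp (- 2 * u)" using N k by (simp add: field_simps)
        also have "\<dots> = (exp (- u))\<^sup>2" by (simp add: power2_eq_square flip: exp_add)
        finally have "sqrt (real N / real k) \<le> exp (- u)" by (rule real_le_lsqrt[rotated]) simp
        then have "2 * K * sqrt (real N / real k) \<le> 2 * K * exp (- \<bar>u\<bar>)"
          using K(1) u by (intro mult_left_mono) auto
        then show ?thesis using disj[of k u] True h_bound[of N k] by (simp add: N_def Let_def)
      next
        case False
        then have "F k u = 0" using disj[of k u] by (simp only: N_def[symmetric] Let_def if_False)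
        then show ?thesis using K(1) by simp
      qed
    qed
    show "AE u in lborel. (\<lambda>k. F k u) \<longlonglongrightarrow> g u"
    proof (rule AE_I2)
      fix u :: real
      define N where "N = (\<lambda>k::nat. nat \<lfloor>k * exp (- 2 * u)\<rfloor>)"
      show "(\<lambda>k. F k u) \<longlonglongrightarrow> g u"
      proof (cases "0 < u")
        case False
        have "F k u = 0" for k
        proof -
          have "1 \<le> exp (- 2 * u)" using False by simp
          then have "real k \<le> k * exp (- 2 * u)" using mult_left_mono[of 1 "exp (- 2 * u)" "real k"] by simp
          then have "k \<le> N k" unfolding N_def by (simp add: le_nat_floor)
          then show ?thesis using disj[of k u] by (simp add: N_def Let_def)
        qed
        then show ?thesis using False by (simp add: g_def)
      next
        case True
        \<comment> \<open>The active index \<open>N k\<close> satisfies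
          \<open>N k / k \<rightarrow> x\<close>, so the correlation tends to
          \<open>sqrt x = exp (- u)\<close>, while \<open>N k\<close> itself grows, so that the
          correction \<open>j * ln ((j + 1) / j)\<close> tends to 1.\<close>
        define x where "x = exp (- 2 * u)"
        have x: "0 < x" "x < 1" using True by (auto simp: x_def)
        have N_le: "real (N k) \<le> k * x" for k using x by (simp add: N_def x_def)
        have N_gt: "k * x - 1 < real (N k)" for k unfolding N_def x_def by linarith
        have kx: "filterlim (\<lambda>k::nat. real k * x - 1) at_top sequentially" using x by real_asymp
        have N_top: "filterlim (\<lambda>k. real (N k)) at_top sequentially"
          by (rule filterlim_at_top_mono[OF kx]) (use N_gt in \<open>auto intro!: always_eventually less_imp_le\<close>)
        have N_div: "(\<lambda>k. real (N k) / real k) \<longlonglongrightarrow> x"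
        proof (rule real_tendsto_sandwich)
          show "(\<lambda>k::nat. x - 1 / k) \<longlonglongrightarrow> x" by real_asymp
          show "(\<lambda>k::nat. x) \<longlonglongrightarrow> x" by simp
          have "x - 1 / real k \<le> real (N k) / real k \<and> real (N k) / real k \<le> x" if "0 < k" for k
          proof -
            have "x - 1 / real k = (k * x - 1) / real k" using that by (simp add: field_simps)
            also have "\<dots> \<le> real (N k) / real k" using N_gt[of k] by (intro divide_right_mono) auto
            finally show ?thesis using N_le[of k] that by (simp add: divide_le_eq mult.commute)
          qed
          then show "\<forall>\<^sub>F k in sequentially. x - 1 / real k \<le> real (N k) / real k"
            "\<forall>\<^sub>F k in sequentially. real (N k) / real k \<le> x"
            by (auto intro: eventually_mono[OF eventually_gt_at_top[of 0]])
        qed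
        have N_k: "N k \<le> k" for k
        proof -
          have "real (N k) \<le> real k" using N_le[of k] x mult_left_le[of x "real k"] by linarith
          then show ?thesis by simp
        qed
        have r01: "0 \<le> sqrt (real (N k) / real k)" "sqrt (real (N k) / real k) \<le> 1" for k
          using N_k[of k] by (auto simp: divide_le_eq)
        have "(\<lambda>k. sqrt (real (N k) / real k)) \<longlonglongrightarrow> sqrt x" by (intro tendsto_intros N_div)
        moreover have "sqrt x = exp (- u)"
          by (rule real_sqrt_unique) (auto simp: x_def power2_eq_square simp flip: exp_add)
        ultimately have cor: "(\<lambda>k. cor_pow p (sqrt (real (N k) / real k))) \<longlonglongrightarrow> cor_pow p (exp (- u))"
          using cor_pow_tendsto[OF p r01] by simp
        have "((\<lambda>y::real. y * ln ((y + 1) / y)) \<longlongrightarrow> 1) at_top" by real_asymp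
        from filterlim_compose[OF this N_top]
        have "(\<lambda>k. real (N k) * ln ((real (N k) + 1) / real (N k))) \<longlonglongrightarrow> 1" .
        from tendsto_divide[OF cor this] have "(\<lambda>k. h k (N k)) \<longlonglongrightarrow> g u"
          using True by (simp add: h_def g_def add.commute)
        moreover have "\<forall>\<^sub>F k in sequentially. h k (N k) = F k u"
        proof -
          have "\<forall>\<^sub>F k in sequentially. 1 \<le> real (N k)" using N_top unfolding filterlim_at_top by blast
          then show ?thesis
            using eventually_gt_at_top[of 0]
          proof eventually_elim
            case (elim k)
            have "real k * x < real k * 1" using elim x by (intro mult_strict_left_mono) auto
            then have "real (N k) < real k" using N_le[of k] by linarith
            with elim have "N k \<in> {1..<k}" by simp
            then show ?case using disj[of k u] by (simp add: N_def Let_def)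
          qed
        qed
        ultimately show ?thesis by (rule Lim_transform_eventually)
      qed
    qed
  qed
  have int_F: "(\<integral>u. F k u \<partial>lborel) = (\<Sum>j\<in>{1..<k}. cor_pow p (sqrt (real j / real k)) / real j) / 2" for k
  proof -
    have meas: "integrable lborel (\<lambda>u. h k j * indicator (I k j) u)" "(\<integral>u. h k j * indicator (I k j) u \<partial>lborel) = cor_pow p (sqrt (real j / real k)) / real j / 2"
      if j: "j \<in> {1..<k}" for j
    proof -
      have le: "ln (k / (real j + 1)) \<le> ln (k / j)" using j by (intro ln_mono) (auto simp: field_simps)
      have w: "ln (k / j) / 2 - ln (k / (real j + 1)) / 2 = ln ((real j + 1) / j) / 2"
        using j by (simp add: ln_div field_simps)
      have l0: "0 < ln ((real j + 1) / j)" using j by (intro ln_gt_zero) (simp add: field_simps)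
      have em: "emeasure lborel (I k j) = ennreal (ln ((real j + 1) / j) / 2)"
        using le unfolding w[symmetric] I_def by (subst emeasure_lborel_Ioc) (auto simp: add.commute)
      show "integrable lborel (\<lambda>u. h k j * indicator (I k j) u)"
        by (intro integrable_mult_right integrable_real_indicator) (use em in \<open>auto simp: I_def\<close>)
      have "(\<integral>u. h k j * indicator (I k j) u \<partial>lborel) = h k j * (ln ((real j + 1) / j) / 2)"
        using em l0 by (simp add: measure_def)
      also have "\<dots> = cor_pow p (sqrt (real j / real k)) / real j / 2"
        using l0 j by (simp add: h_def add.commute)
      finally show "(\<integral>u. h k j * indicator (I k j) u \<partial>lborel) = cor_pow p (sqrt (real j / real k)) / real j / 2" .
    qed
    have "(\<integral>u. F k u \<partial>lborel) = (\<Sum>j\<in>{1..<k}. \<integral>u. h k j * indicator (I k j) u \<partial>lborel)"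
      unfolding F_def by (rule Bochner_Integration.integral_sum) (rule meas(1))
    also have "\<dots> = (\<Sum>j\<in>{1..<k}. cor_pow p (sqrt (real j / real k)) / real j / 2)"
      by (intro sum.cong refl meas(2))
    finally show ?thesis by (simp only: sum_divide_distrib)
  qed
  \<comment> \<open>Only positive \<open>u\<close> are reached by the sums, which is half of the
    even integrand; this 1/2 cancels the one in the heights of the steps.\<close>
  have int_g: "(\<integral>u. g u \<partial>lborel) = a_const p / 2"
  proof -
    have ig: "integrable lborel g"
      unfolding g_def using integrable_mult_indicator[OF _ integrable_cor_pow[OF p], of "{0<..}"] by simp
    have ig': "integrable lborel (\<lambda>u. g (- u))"
      using lborel_integrable_real_affine[OF ig, of "-1" 0] by simp
    have eq: "(\<integral>u. g (- u) \<partial>lborel) = (\<integral>u. g u \<partial>lborel)"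
      using lborel_integral_real_affine[of "-1" g 0] by simp
    have "a_const p = (\<integral>u. g u + g (- u) \<partial>lborel)"
      unfolding a_const_eq[OF p]
    proof (rule integral_cong_AE)
      show "AE u in lborel. cor_pow p (exp (- \<bar>u\<bar>)) = g u + g (- u)"
        using AE_lborel_singleton[of "0::real"] by eventually_elim (auto simp: g_def indicator_def)
    qed (simp_all add: g_def)
    also have "\<dots> = 2 * (\<integral>u. g u \<partial>lborel)" using ig ig' eq by simp
    finally show ?thesis by simp
  qed
  have "(\<lambda>k. 2 * (\<integral>u. F k u \<partial>lborel)) \<longlonglongrightarrow> 2 * (\<integral>u. g u \<partial>lborel)"
    by (intro tendsto_intros lim)
  then show ?thesis unfolding int_F int_g by simp
qed

subsection \<open>The Gaussian random walk\<close>

lemma (in prob_space) std_normal_transfer: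
  fixes f :: "real \<Rightarrow> real"
  assumes X: "distributed M lborel X std_normal_density" and [measurable]: "f \<in> borel_measurable borel"
  shows "expectation (\<lambda>\<omega>. f (X \<omega>)) = (\<integral>x. f x \<partial>\<N>)"
    and "integrable M (\<lambda>\<omega>. f (X \<omega>)) \<longleftrightarrow> integrable \<N> f"
proof -
  have [measurable]: "X \<in> borel_measurable M" using distributed_measurable[OF X] by simp
  have d: "distr M lborel X = \<N>" by (rule distributed_distr_eq_density[OF X])
  show "expectation (\<lambda>\<omega>. f (X \<omega>)) = (\<integral>x. f x \<partial>\<N>)"
    unfolding d[symmetric] by (subst integral_distr) auto
  show "integrable M (\<lambda>\<omega>. f (X \<omega>)) \<longleftrightarrow> integrable \<N> f"
    unfolding d[symmetric] by (subst integrable_distr_eq) auto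
qed

lemma (in prob_space) L2_mono:
  assumes f: "f \<in> borel_measurable M" and g: "L2 g" and le: "\<And>\<omega>. \<bar>f \<omega>\<bar> \<le> \<bar>g \<omega>\<bar>"
  shows "L2 f" "L2norm f \<le> L2norm g"
proof -
  have sq: "(f \<omega>)\<^sup>2 \<le> (g \<omega>)\<^sup>2" for \<omega> using power_mono[OF le, of \<omega> 2] by simp
  have i: "integrable M (\<lambda>\<omega>. (f \<omega>)\<^sup>2)"
    by (rule Bochner_Integration.integrable_bound[OF L2_integrable_sq[OF g]]) (use f sq in auto)
  then show "L2 f" using f by (simp add: L2_def)
  show "L2norm f \<le> L2norm g"
    unfolding L2norm_def real_sqrt_le_iff by (rule integral_mono[OF i L2_integrable_sq[OF g] sq])
qed

locale gaussian_walk = prob_space +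
  fixes \<xi> :: "nat \<Rightarrow> 'a \<Rightarrow> real" and p :: real
  assumes indep_\<xi>: "indep_vars (\<lambda>_. borel) \<xi> UNIV"
    and normal_\<xi>: "distributed M lborel (\<xi> i) std_normal_density"
    and p: "1 \<le> p"
begin

definition incr :: "nat \<Rightarrow> nat \<Rightarrow> 'a \<Rightarrow> real" where
  "incr j k \<omega> = (\<Sum>i\<in>{j..<k}. \<xi> i \<omega>)"

text \<open>The argument \<open>e\<close> restarts the walk at time \<open>e\<close>, which makes the term independent of the
  first \<open>e\<close> steps at the price of a small error.\<close>

definition G :: "nat \<Rightarrow> nat \<Rightarrow> 'a \<Rightarrow> real" where
  "G e k \<omega> = (\<bar>incr e k \<omega> / sqrt k\<bar> powr p - b_const p) / k"

text \<open>The terms with index between two successive powers of 2. The weights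
  \<open>1 / k\<close> sum to at most 1 there, and the restart time \<open>2 ^ r\<close> halves
  relative to \<open>k\<close> with each further level, so levels play the part of time in the
  mixing locale.\<close>

definition lev :: "nat \<Rightarrow> nat \<Rightarrow> 'a \<Rightarrow> real" where
  "lev e s \<omega> = (\<Sum>k\<in>{2^s..<2^Suc s}. G e k \<omega>)"

lemma \<xi>_measurable [measurable]: "\<xi> i \<in> borel_measurable M"
  using distributed_measurable[OF normal_\<xi>] by simp

lemma incr_measurable [measurable]: "incr j k \<in> borel_measurable M"
  unfolding incr_def[abs_def] by measurable

lemma G_measurable [measurable]: "G e k \<in> borel_measurable M"
  unfolding G_def[abs_def] by measurable

lemma lev_measurable [measurable]: "lev e s \<in> borel_measurable M"
  unfolding lev_def[abs_def] by measurable

lemma incr_normal: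
  assumes "j < k"
  shows "distributed M lborel (\<lambda>\<omega>. incr j k \<omega> / sqrt (real k - real j)) std_normal_density"
proof -
  have "distributed M lborel (\<lambda>x. \<Sum>i\<in>{j..<k}. \<xi> i x) (normal_density (\<Sum>i\<in>{j..<k}. 0) (sqrt (\<Sum>i\<in>{j..<k}. 1\<^sup>2)))"
    using assms by (intro sum_indep_normal indep_vars_subset[OF indep_\<xi>]) (auto simp: normal_\<xi>)
  then have "distributed M lborel (incr j k) (normal_density 0 (sqrt (real k - real j)))"
    using assms by (simp add: incr_def[abs_def] of_nat_diff)
  then show ?thesis
    using normal_standard_normal_convert[of "sqrt (real k - real j)" "incr j k" 0] assms by simp
qed

lemma incr_normal_0: "1 \<le> k \<Longrightarrow> distributed M lborel (\<lambda>\<omega>. incr 0 k \<omega> / sqrt k) std_normal_density"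
  using incr_normal[of 0 k] by simp

lemma incr_indep:
  assumes "j \<le> k"
  shows "indep_var borel (incr 0 j) borel (incr j k)"
proof -
  have "indep_var (PiM {..<j} (\<lambda>_. borel)) (\<lambda>\<omega>. restrict (\<lambda>i. \<xi> i \<omega>) {..<j})
      (PiM {j..<k} (\<lambda>_. borel)) (\<lambda>\<omega>. restrict (\<lambda>i. \<xi> i \<omega>) {j..<k})"
    by (rule indep_var_restrict[OF indep_\<xi>]) auto
  from indep_var_compose[OF this, of "\<lambda>x. \<Sum>i\<in>{..<j}. x i" borel "\<lambda>x. \<Sum>i\<in>{j..<k}. x i" borel]
  have "indep_var borel ((\<lambda>x. \<Sum>i\<in>{..<j}. x i) \<circ> (\<lambda>\<omega>. restrict (\<lambda>i. \<xi> i \<omega>) {..<j}))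
     borel ((\<lambda>x. \<Sum>i\<in>{j..<k}. x i) \<circ> (\<lambda>\<omega>. restrict (\<lambda>i. \<xi> i \<omega>) {j..<k}))"
    by (auto intro!: borel_measurable_sum measurable_component_singleton)
  then show ?thesis by (simp add: comp_def incr_def[abs_def] lessThan_atLeast0)
qed

text \<open>The walk at \<open>k\<close> is the walk at \<open>j\<close> plus an independent
  increment. After normalisation this is the representation in \<open>cor_pow\<close>, with
  correlation \<open>sqrt (j / k)\<close>.\<close>

lemma correlated_expectation:
  assumes j: "1 \<le> j" "j < k"
  shows "expectation (\<lambda>\<omega>. \<bar>incr 0 j \<omega> / sqrt j\<bar> powr p * \<bar>incr 0 k \<omega> / sqrt k\<bar> powr p)
    = cor_pow p (sqrt (j / k)) + (b_const p)\<^sup>2"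
proof -
  define Y Z where "Y = (\<lambda>\<omega>. incr 0 j \<omega> / sqrt j)" and "Z = (\<lambda>\<omega>. incr j k \<omega> / sqrt (real k - real j))"
  define r where "r = sqrt (real j / real k)"
  have Y: "distributed M lborel Y std_normal_density" and Z: "distributed M lborel Z std_normal_density"
    using incr_normal_0[of j] incr_normal[of j k] j by (auto simp: Y_def Z_def)
  have [measurable]: "Y \<in> borel_measurable M" "Z \<in> borel_measurable M" by (auto simp: Y_def Z_def)
  have ind: "indep_var borel Y borel Z"
    using indep_var_compose[OF incr_indep[of j k], of "\<lambda>x. x / sqrt j" borel "\<lambda>x. x / sqrt (real k - real j)" borel] j
    by (simp add: comp_def Y_def[abs_def] Z_def[abs_def])
  have dY: "distr M borel Y = \<N>" and dZ: "distr M borel Z = \<N>"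
    using distributed_distr_eq_density[OF Y] distributed_distr_eq_density[OF Z] by (simp_all cong: distr_cong)
  have joint: "distr M (borel \<Otimes>\<^sub>M borel) (\<lambda>\<omega>. (Y \<omega>, Z \<omega>)) = \<N> \<Otimes>\<^sub>M \<N>"
    using ind unfolding indep_var_distribution_eq dY dZ by simp
  have sum: "incr 0 k \<omega> / sqrt k = r * Y \<omega> + sqrt (1 - r\<^sup>2) * Z \<omega>" for \<omega>
  proof -
    have "incr 0 k \<omega> = incr 0 j \<omega> + incr j k \<omega>"
      using j by (simp add: incr_def sum.atLeastLessThan_concat)
    moreover have "r * Y \<omega> = incr 0 j \<omega> / sqrt k" using j by (simp add: r_def Y_def real_sqrt_divide)
    moreover have "sqrt (1 - r\<^sup>2) * Z \<omega> = incr j k \<omega> / sqrt k"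
    proof -
      have "1 - r\<^sup>2 = (real k - real j) / real k" using j by (simp add: r_def field_simps)
      then show ?thesis using j by (simp add: Z_def real_sqrt_divide)
    qed
    ultimately show ?thesis by (simp add: add_divide_distrib)
  qed
  have "expectation (\<lambda>\<omega>. \<bar>Y \<omega>\<bar> powr p * \<bar>r * Y \<omega> + sqrt (1 - r\<^sup>2) * Z \<omega>\<bar> powr p)
     = (\<integral>(y, z). \<bar>y\<bar> powr p * \<bar>r * y + sqrt (1 - r\<^sup>2) * z\<bar> powr p \<partial>distr M (borel \<Otimes>\<^sub>M borel) (\<lambda>\<omega>. (Y \<omega>, Z \<omega>)))"
    by (subst integral_distr) auto
  then show ?thesis unfolding joint sum by (simp add: cor_pow_def Y_def r_def)
qed

lemma integrable_pow: "1 \<le> k \<Longrightarrow> 0 \<le> q \<Longrightarrow> integrable M (\<lambda>\<omega>. \<bar>incr 0 k \<omega> / sqrt k\<bar> powr q)"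
  using std_normal_transfer(2)[OF incr_normal_0, of k "\<lambda>x. \<bar>x\<bar> powr q"] integrable_std_normal_powr[of q] by simp

lemma L2_pow: "1 \<le> k \<Longrightarrow> L2 (\<lambda>\<omega>. \<bar>incr 0 k \<omega> / sqrt k\<bar> powr p)"
  using integrable_pow[of k "2 * p"] p
  by (simp add: L2_def powr_powr mult.commute flip: powr_realpow[of "_ powr _"] powr_numeral)

definition pow_norm :: real where
  "pow_norm = sqrt (\<integral>x. (\<bar>x\<bar> powr p)\<^sup>2 \<partial>\<N>)"

lemma L2norm_pow: "1 \<le> k \<Longrightarrow> L2norm (\<lambda>\<omega>. \<bar>incr 0 k \<omega> / sqrt k\<bar> powr p) = pow_norm"
  using std_normal_transfer(1)[OF incr_normal_0, of k "\<lambda>x. (\<bar>x\<bar> powr p)\<^sup>2"] by (simp add: L2norm_def pow_norm_def)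

lemma pow_norm_nonneg: "0 \<le> pow_norm"
  by (simp add: pow_norm_def)

lemma expectation_pow: "1 \<le> k \<Longrightarrow> expectation (\<lambda>\<omega>. \<bar>incr 0 k \<omega> / sqrt k\<bar> powr p) = b_const p"
  using std_normal_transfer(1)[OF incr_normal_0, of k "\<lambda>x. \<bar>x\<bar> powr p"] by (simp add: b_const_eq)

lemma L2_G: "1 \<le> k \<Longrightarrow> L2 (G 0 k)"
  unfolding G_def[abs_def]
  using L2_cmult[OF L2_diff[OF L2_pow L2_const], of k "1 / real k" "b_const p"] by simp

lemma G_mean: "1 \<le> k \<Longrightarrow> expectation (G 0 k) = 0"
  unfolding G_def[abs_def]
  using expectation_pow[of k] integrable_pow[of k p] p by (simp add: prob_space)

lemma G_covariance:
  assumes "1 \<le> j" "j < k"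
  shows "expectation (\<lambda>\<omega>. G 0 j \<omega> * G 0 k \<omega>) = cor_pow p (sqrt (j / k)) / (real j * real k)"
proof -
  let ?P = "\<lambda>k \<omega>. \<bar>incr 0 k \<omega> / sqrt k\<bar> powr p" and ?b = "b_const p"
  have k: "1 \<le> k" using assms by simp
  note L = L2_pow[OF assms(1)] L2_pow[OF k]
  have "expectation (\<lambda>\<omega>. G 0 j \<omega> * G 0 k \<omega>)
     = expectation (\<lambda>\<omega>. (?P j \<omega> * ?P k \<omega> - ?b * ?P j \<omega> - ?b * ?P k \<omega> + ?b * ?b) / (real j * real k))"
    unfolding G_def by (intro arg_cong[where f=expectation]) (auto simp: fun_eq_iff algebra_simps)
  also have "\<dots> = (expectation (\<lambda>\<omega>. ?P j \<omega> * ?P k \<omega>) - ?b * ?b - ?b * ?b + ?b * ?b) / (real j * real k)"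
    using L2_integrable_mult[OF L] L2_integrable[OF L(1)] L2_integrable[OF L(2)]
      expectation_pow[OF assms(1)] expectation_pow[OF k] by (simp add: prob_space)
  also have "\<dots> = cor_pow p (sqrt (j / k)) / (real j * real k)"
    using correlated_expectation[OF assms] by (simp add: power2_eq_square)
  finally show ?thesis .
qed

definition pow_var :: real where
  "pow_var = (\<integral>x. (\<bar>x\<bar> powr p - b_const p)\<^sup>2 \<partial>\<N>)"

lemma G_variance: "1 \<le> k \<Longrightarrow> expectation (\<lambda>\<omega>. (G 0 k \<omega>)\<^sup>2) = pow_var / (real k)\<^sup>2"
  using std_normal_transfer(1)[OF incr_normal_0, of k "\<lambda>x. (\<bar>x\<bar> powr p - b_const p)\<^sup>2"]
  by (simp add: G_def power_divide pow_var_def)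

lemma L2norm_G: "1 \<le> k \<Longrightarrow> L2norm (G 0 k) = sqrt pow_var / k"
  by (simp add: L2norm_def G_variance real_sqrt_divide)

text \<open>The term of index \<open>k\<close> adds \<open>pow_var / k^2\<close> to the variance,
  plus twice its covariance with all earlier terms, which is \<open>c k / k\<close> with
  \<open>c k\<close> tending to \<open>a_const p\<close>. Logarithmic averaging of
  \<open>2 * c k + pow_var / k\<close> leaves twice the constant.\<close>

lemma variance_limit:
  "(\<lambda>m. expectation (\<lambda>\<omega>. (\<Sum>k\<in>{1..<Suc m}. G 0 k \<omega>)\<^sup>2) / ln m) \<longlonglongrightarrow> 2 * a_const p"
proof -
  define c where "c = (\<lambda>k. \<Sum>j\<in>{1..<k}. cor_pow p (sqrt (real j / real k)) / real j)"
  let ?Q = "\<lambda>m. expectation (\<lambda>\<omega>. (\<Sum>k\<in>{1..<Suc m}. G 0 k \<omega>)\<^sup>2)"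
  have Q: "?Q m = (\<Sum>k\<in>{1..<Suc m}. (2 * c k + pow_var * (1 / k)) / k)" for m
  proof (induction m)
    case (Suc m)
    let ?S = "\<lambda>\<omega>. \<Sum>k\<in>{1..<Suc m}. G 0 k \<omega>"
    have LS: "L2 ?S" by (intro L2_sum L2_G) auto
    have LG: "L2 (G 0 (Suc m))" by (rule L2_G) simp
    have "expectation (\<lambda>\<omega>. ?S \<omega> * G 0 (Suc m) \<omega>) = (\<Sum>j\<in>{1..<Suc m}. expectation (\<lambda>\<omega>. G 0 j \<omega> * G 0 (Suc m) \<omega>))"
      unfolding sum_distrib_right
      by (intro Bochner_Integration.integral_sum L2_integrable_mult L2_G) auto
    also have "\<dots> = (\<Sum>j\<in>{1..<Suc m}. cor_pow p (sqrt (real j / real (Suc m))) / (real j * real (Suc m)))"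
      by (intro sum.cong refl G_covariance) auto
    also have "\<dots> = c (Suc m) / Suc m" by (simp only: c_def sum_divide_distrib divide_divide_eq_left)
    finally have cr: "expectation (\<lambda>\<omega>. ?S \<omega> * G 0 (Suc m) \<omega>) = c (Suc m) / Suc m" .
    have "?Q (Suc m) = expectation (\<lambda>\<omega>. (?S \<omega>)\<^sup>2 + 2 * (?S \<omega> * G 0 (Suc m) \<omega>) + (G 0 (Suc m) \<omega>)\<^sup>2)"
      by (simp add: power2_sum algebra_simps)
    also have "\<dots> = ?Q m + 2 * (c (Suc m) / Suc m) + pow_var / (real (Suc m))\<^sup>2"
      using L2_integrable_sq[OF LS] L2_integrable_sq[OF LG] L2_integrable_mult[OF LS LG] cr G_variance[of "Suc m"] by simp
    also have "\<dots> = (\<Sum>k\<in>{1..<Suc (Suc m)}. (2 * c k + pow_var * (1 / k)) / k)"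
      unfolding Suc.IH by (simp add: add_divide_distrib power2_eq_square)
    finally show ?case .
  qed simp
  have "(\<lambda>k. 2 * c k + pow_var * (1 / real k)) \<longlonglongrightarrow> 2 * a_const p + pow_var * 0"
    unfolding c_def by (intro tendsto_intros cor_pow_riemann_sum p)
  from log_cesaro[OF this] show ?thesis unfolding Q by simp
qed

text \<open>\<open>p * 4 powr p\<close> comes from the difference of powers as in the linear bound
  for \<open>cor_pow\<close>; the 2 counts the two powers of norm \<open>pow_norm\<close>.\<close>

definition approx_const :: real where "approx_const = 2 * p * 4 powr p * pow_norm"

lemma approx_const_nonneg: "0 \<le> approx_const"
  using p pow_norm_nonneg by (simp add: approx_const_def)

text \<open>Restarting at \<open>e\<close> changes the normalised walk by
  \<open>sqrt (e / k)\<close> times the normalised walk at time \<open>e\<close>. The small factor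
  comes out of the difference of powers, and what remains are powers of standard normal
  variables.\<close>

lemma G_approx:
  assumes "1 \<le> e" "e \<le> k"
  shows "L2 (\<lambda>\<omega>. G 0 k \<omega> - G e k \<omega>)"
    and "L2norm (\<lambda>\<omega>. G 0 k \<omega> - G e k \<omega>) \<le> approx_const * sqrt (e / k) / k"
proof -
  have k: "1 \<le> k" using assms by simp
  define d where "d = sqrt (real e / real k)"
  define c where "c = p * d * 4 powr p / k"
  have d: "0 \<le> d" "d \<le> 1" using assms by (auto simp: d_def)
  have c: "0 \<le> c" using d p by (simp add: c_def)
  define f where "f = (\<lambda>\<omega>. c * (\<bar>incr 0 k \<omega> / sqrt k\<bar> powr p + \<bar>incr 0 e \<omega> / sqrt e\<bar> powr p))"
  have Lf: "L2 f" unfolding f_def by (intro L2_cmult L2_add L2_pow k assms)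
  have bd: "\<bar>G 0 k \<omega> - G e k \<omega>\<bar> \<le> \<bar>f \<omega>\<bar>" for \<omega>
  proof -
    define a x b where "a = incr 0 k \<omega> / sqrt k" and "x = incr 0 e \<omega> / sqrt e" and "b = incr e k \<omega> / sqrt k"
    have "incr 0 k \<omega> = incr 0 e \<omega> + incr e k \<omega>"
      using assms by (simp add: incr_def sum.atLeastLessThan_concat)
    moreover have "d * x = incr 0 e \<omega> / sqrt k" using assms by (simp add: d_def x_def real_sqrt_divide)
    ultimately have ab: "a - b = d * x" by (simp add: a_def b_def add_divide_distrib)
    have dx: "\<bar>a - b\<bar> = d * \<bar>x\<bar>" "\<bar>a - b\<bar> \<le> \<bar>x\<bar>"
      using d mult_right_mono[of d 1 "\<bar>x\<bar>"] by (auto simp: ab abs_mult)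
    \<comment> \<open>Because \<open>|b| \<le> |a| + |a - b|\<close> and, with
      \<open>d \<le> 1\<close>, \<open>|a - b| \<le> |x|\<close>. So \<open>b\<close>, which is not
      standard normal, disappears from the estimate.\<close>
    have t: "\<bar>a\<bar> + \<bar>b\<bar> \<le> 2 * (\<bar>a\<bar> + \<bar>x\<bar>)" using dx(2) by (smt (verit))
    have t': "\<bar>x\<bar> \<le> 2 * (\<bar>a\<bar> + \<bar>x\<bar>)" by simp
    have "\<bar>\<bar>a\<bar> powr p - \<bar>b\<bar> powr p\<bar> \<le> p * \<bar>a - b\<bar> * (\<bar>a\<bar> + \<bar>b\<bar>) powr (p - 1)"
      by (rule abs_powr_diff_le[OF p])
    also have "\<dots> \<le> p * (d * \<bar>x\<bar>) * (2 * (\<bar>a\<bar> + \<bar>x\<bar>)) powr (p - 1)"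
      unfolding dx(1) using p d t by (intro mult_left_mono powr_mono2) auto
    also have "\<dots> \<le> p * (d * (2 * (\<bar>a\<bar> + \<bar>x\<bar>))) * (2 * (\<bar>a\<bar> + \<bar>x\<bar>)) powr (p - 1)"
      using p d t' by (intro mult_right_mono mult_left_mono) auto
    also have "\<dots> = p * d * (2 * (\<bar>a\<bar> + \<bar>x\<bar>)) powr p"
    proof -
      have "(2 * (\<bar>a\<bar> + \<bar>x\<bar>)) * (2 * (\<bar>a\<bar> + \<bar>x\<bar>)) powr (p - 1) = (2 * (\<bar>a\<bar> + \<bar>x\<bar>)) powr p"
        using powr_mult_base[of "2 * (\<bar>a\<bar> + \<bar>x\<bar>)" "p - 1"] by simp
      then show ?thesis by (metis mult.assoc)
    qed
    also have "\<dots> = p * d * (2 powr p * (\<bar>a\<bar> + \<bar>x\<bar>) powr p)" by (simp add: powr_mult del: distrib_left_numeral)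
    also have "\<dots> \<le> p * d * (2 powr p * (2 powr p * (\<bar>a\<bar> powr p + \<bar>x\<bar> powr p)))"
      using p d by (intro mult_left_mono add_powr_le) auto
    also have "\<dots> = p * d * 4 powr p * (\<bar>a\<bar> powr p + \<bar>x\<bar> powr p)"
      using powr_mult[of 2 2 p] by simp
    finally have "\<bar>\<bar>a\<bar> powr p - \<bar>b\<bar> powr p\<bar> / k \<le> p * d * 4 powr p * (\<bar>a\<bar> powr p + \<bar>x\<bar> powr p) / k"
      by (rule divide_right_mono) simp
    moreover have "G 0 k \<omega> - G e k \<omega> = (\<bar>a\<bar> powr p - \<bar>b\<bar> powr p) / k"
      by (simp add: G_def a_def b_def diff_divide_distrib)
    ultimately have "\<bar>G 0 k \<omega> - G e k \<omega>\<bar> \<le> f \<omega>"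
      by (simp add: f_def c_def a_def x_def abs_divide)
    then show ?thesis by linarith
  qed
  show "L2 (\<lambda>\<omega>. G 0 k \<omega> - G e k \<omega>)" by (rule L2_mono(1)[OF _ Lf bd]) simp
  have "L2norm (\<lambda>\<omega>. G 0 k \<omega> - G e k \<omega>) \<le> L2norm f" by (rule L2_mono(2)[OF _ Lf bd]) simp
  also have "\<dots> \<le> c * (pow_norm + pow_norm)"
    unfolding f_def L2norm_cmult using c
      L2norm_add[OF L2_pow[OF k] L2_pow[OF assms(1)]] L2norm_pow[OF k] L2norm_pow[OF assms(1)]
    by (simp add: mult_left_mono)
  also have "\<dots> = approx_const * sqrt (e / k) / k"
    by (simp add: c_def approx_const_def d_def)
  finally show "L2norm (\<lambda>\<omega>. G 0 k \<omega> - G e k \<omega>) \<le> approx_const * sqrt (e / k) / k" .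
qed

lemma sum_inverse_level: "(\<Sum>k\<in>{2^s..<2^Suc s}. 1 / real k) \<le> 1"
proof -
  have "(\<Sum>k\<in>{2^s..<2^Suc s}. 1 / real k) \<le> (\<Sum>k\<in>{(2::nat)^s..<2^Suc s}. 1 / 2 ^ s)"
  proof (rule sum_mono)
    fix k :: nat assume "k \<in> {2^s..<2^Suc s}"
    then have "(2::real) ^ s \<le> real k" by (metis atLeastLessThan_iff of_nat_le_iff of_nat_numeral of_nat_power)
    then show "1 / real k \<le> 1 / 2 ^ s" by (intro frac_le) auto
  qed
  also have "\<dots> = 1" by simp
  finally show ?thesis .
qed

lemma level_pos: "k \<in> {2^s..<2^Suc s} \<Longrightarrow> 1 \<le> (k::nat)"
  by (meson atLeastLessThan_iff le_trans one_le_numeral one_le_power)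

lemma lev_approx:
  assumes "r \<le> s"
  shows "L2 (\<lambda>\<omega>. lev 0 s \<omega> - lev (2^r) s \<omega>)"
    and "L2norm (\<lambda>\<omega>. lev 0 s \<omega> - lev (2^r) s \<omega>) \<le> approx_const * sqrt (1/2) ^ (s - r)"
proof -
  have rs: "(2::nat)^r \<le> k" if "k \<in> {2^s..<2^Suc s}" for k
  proof -
    have "(2::nat) ^ r \<le> 2 ^ s" using assms by (intro power_increasing) auto
    with that show ?thesis by (metis atLeastLessThan_iff le_trans)
  qed
  have eq: "(\<lambda>\<omega>. lev 0 s \<omega> - lev (2^r) s \<omega>) = (\<lambda>\<omega>. \<Sum>k\<in>{2^s..<2^Suc s}. G 0 k \<omega> - G (2^r) k \<omega>)"
    by (simp add: lev_def sum_subtractf)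
  show "L2 (\<lambda>\<omega>. lev 0 s \<omega> - lev (2^r) s \<omega>)"
    unfolding eq by (intro L2_sum G_approx(1) rs) simp
  have "L2norm (\<lambda>\<omega>. lev 0 s \<omega> - lev (2^r) s \<omega>) \<le> (\<Sum>k\<in>{2^s..<2^Suc s}. L2norm (\<lambda>\<omega>. G 0 k \<omega> - G (2^r) k \<omega>))"
    unfolding eq by (intro L2norm_sum G_approx(1) rs) simp
  also have "\<dots> \<le> (\<Sum>k\<in>{2^s..<2^Suc s}. approx_const * sqrt (1/2) ^ (s - r) * (1 / real k))"
  proof (rule sum_mono)
    fix k :: nat assume k: "k \<in> {2^s..<2^Suc s}"
    have "(2::real) ^ s \<le> real k" using k by (metis atLeastLessThan_iff of_nat_le_iff of_nat_numeral of_nat_power)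
    then have "real (2 ^ r) / real k \<le> 2 ^ r / 2 ^ s"
      by (simp add: frac_le)
    also have "\<dots> = (1/2) ^ (s - r)" using assms by (simp add: power_diff power_one_over field_simps)
    finally have "sqrt (real (2 ^ r) / real k) \<le> sqrt ((1/2) ^ (s - r))" by simp
    then have le: "sqrt (real (2 ^ r) / real k) \<le> sqrt (1/2) ^ (s - r)" by (simp add: real_sqrt_power)
    have "L2norm (\<lambda>\<omega>. G 0 k \<omega> - G (2^r) k \<omega>) \<le> approx_const * sqrt (real (2^r) / real k) / real k"
      by (intro G_approx rs k) simp
    also have "\<dots> \<le> approx_const * sqrt (1/2) ^ (s - r) * (1 / real k)"
      using le approx_const_nonneg by (simp add: divide_right_mono mult_left_mono)
    finally show "L2norm (\<lambda>\<omega>. G 0 k \<omega> - G (2^r) k \<omega>) \<le> approx_const * sqrt (1/2) ^ (s - r) * (1 / real k)" .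
  qed
  also have "\<dots> \<le> approx_const * sqrt (1/2) ^ (s - r) * 1"
    unfolding sum_distrib_left[symmetric]
    using approx_const_nonneg sum_inverse_level by (intro mult_left_mono) auto
  finally show "L2norm (\<lambda>\<omega>. lev 0 s \<omega> - lev (2^r) s \<omega>) \<le> approx_const * sqrt (1/2) ^ (s - r)" by simp
qed

definition pow_moment4 :: real where
  "pow_moment4 = (\<integral>x. (\<bar>x\<bar> powr p - b_const p) ^ 4 \<partial>\<N>)"

lemma integrable_moment4: "integrable \<N> (\<lambda>x. (\<bar>x\<bar> powr p - b_const p) ^ 4)"
proof (rule Bochner_Integration.integrable_bound)
  show "integrable \<N> (\<lambda>x. 16 * (\<bar>x\<bar> powr (4 * p) + b_const p ^ 4))"
    using p integrable_std_normal_powr[of "4 * p"] by simp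
  show "AE x in \<N>. norm ((\<bar>x\<bar> powr p - b_const p) ^ 4) \<le> norm (16 * (\<bar>x\<bar> powr (4 * p) + b_const p ^ 4))"
  proof (rule AE_I2)
    fix x :: real
    let ?a = "\<bar>x\<bar> powr p" and ?b = "b_const p"
    have "\<bar>a - b\<bar> \<le> 2 * max a b" if "0 \<le> a" "0 \<le> b" for a b :: real
      using that by (auto simp: max_def abs_le_iff)
    then have "\<bar>?a - ?b\<bar> \<le> 2 * max ?a ?b" using b_const_nonneg by simp
    then have "\<bar>?a - ?b\<bar> ^ 4 \<le> (2 * max ?a ?b) ^ 4" by (intro power_mono) auto
    also have "\<dots> = 16 * max ?a ?b ^ 4" by (simp add: power_mult_distrib)
    also have "max ?a ?b ^ 4 \<le> ?a ^ 4 + ?b ^ 4" by (auto simp: max_def)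
    also have "?a ^ 4 = \<bar>x\<bar> powr (4 * p)"
      by (cases "x = 0") (simp_all add: powr_powr mult.commute flip: powr_numeral)
    finally show "norm ((?a - ?b) ^ 4) \<le> norm (16 * (\<bar>x\<bar> powr (4 * p) + ?b ^ 4))" by (simp add: power_abs)
  qed
qed simp

text \<open>A power mean inequality with weights \<open>1 / k\<close> of total at most 1, so the
  bound is the fourth moment of a single centred power and does not depend on the level.\<close>

lemma lev_moment4:
  shows "integrable M (\<lambda>\<omega>. lev 0 s \<omega> ^ 4)" and "expectation (\<lambda>\<omega>. lev 0 s \<omega> ^ 4) \<le> pow_moment4"
proof -
  let ?D = "{2^s..<2^Suc s} :: nat set"
  let ?x = "\<lambda>k \<omega>. \<bar>incr 0 k \<omega> / sqrt k\<bar> powr p - b_const p"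
  have bd: "lev 0 s \<omega> ^ 4 \<le> (\<Sum>k\<in>?D. 1 / real k * ?x k \<omega> ^ 4)" for \<omega>
  proof -
    have "lev 0 s \<omega> ^ 4 = (\<Sum>k\<in>?D. 1 / real k * ?x k \<omega>) ^ 4" by (simp add: lev_def G_def)
    also have "\<dots> \<le> (\<Sum>k\<in>?D. 1 / real k) ^ 3 * (\<Sum>k\<in>?D. 1 / real k * ?x k \<omega> ^ 4)"
      by (rule power4_sum_le) auto
    also have "\<dots> \<le> 1 * (\<Sum>k\<in>?D. 1 / real k * ?x k \<omega> ^ 4)"
      using sum_inverse_level by (intro mult_right_mono power_le_one sum_nonneg) auto
    finally show ?thesis by simp
  qed
  have x4: "integrable M (\<lambda>\<omega>. ?x k \<omega> ^ 4)" "expectation (\<lambda>\<omega>. ?x k \<omega> ^ 4) = pow_moment4" if "1 \<le> k" for k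
    using std_normal_transfer[OF incr_normal_0[OF that], of "\<lambda>x. (\<bar>x\<bar> powr p - b_const p) ^ 4"] integrable_moment4
    by (simp_all add: pow_moment4_def)
  have i: "integrable M (\<lambda>\<omega>. \<Sum>k\<in>?D. 1 / real k * ?x k \<omega> ^ 4)"
    by (intro Bochner_Integration.integrable_sum integrable_mult_right x4(1) level_pos)
  show i4: "integrable M (\<lambda>\<omega>. lev 0 s \<omega> ^ 4)"
    by (rule Bochner_Integration.integrable_bound[OF i]) (use bd in \<open>auto intro!: AE_I2 simp: sum_nonneg simp del: powr_divide abs_divide\<close>)
  have "expectation (\<lambda>\<omega>. lev 0 s \<omega> ^ 4) \<le> expectation (\<lambda>\<omega>. \<Sum>k\<in>?D. 1 / real k * ?x k \<omega> ^ 4)"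
    by (intro integral_mono i i4 bd)
  also have "\<dots> = (\<Sum>k\<in>?D. expectation (\<lambda>\<omega>. 1 / real k * ?x k \<omega> ^ 4))"
    by (intro Bochner_Integration.integral_sum integrable_mult_right x4(1) level_pos)
  also have "\<dots> = (\<Sum>k\<in>?D. 1 / real k * pow_moment4)"
    by (intro sum.cong refl) (subst integral_mult_right_zero, subst x4(2), auto dest: level_pos)
  also have "\<dots> \<le> 1 * pow_moment4"
    unfolding sum_distrib_right[symmetric] using sum_inverse_level
    by (intro mult_right_mono) (auto simp: pow_moment4_def)
  finally show "expectation (\<lambda>\<omega>. lev 0 s \<omega> ^ 4) \<le> pow_moment4" by simp
qed

text \<open>Levels below \<open>r\<close> involve only \<open>k < 2 ^ r\<close>, hence only the
  steps before \<open>2 ^ r\<close>, whereas the restarted levels use only the steps from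
  \<open>2 ^ r\<close> on.\<close>

lemma lev_indep:
  assumes A: "A \<subseteq> {..<r}" and B: "B \<subseteq> {r..}"
  shows "indep_var borel (\<lambda>\<omega>. \<Sum>s\<in>A. lev 0 s \<omega>) borel (\<lambda>\<omega>. \<Sum>s\<in>B. lev (2^r) s \<omega>)"
proof -
  define e :: nat where "e = 2 ^ r"
  define F where "F = (\<lambda>(j::nat) (S::nat set) x. \<Sum>s\<in>S. \<Sum>k\<in>{2^s..<2^Suc s}.
      (\<bar>(\<Sum>i\<in>{j..<k}. x i) / sqrt (real k)\<bar> powr p - b_const p) / real k)"
  have k_lt: "k \<le> e" if "s \<in> A" "k \<in> {2^s..<2^Suc s}" for s k
  proof -
    have "Suc s \<le> r" using that A by auto
    then have "(2::nat) ^ Suc s \<le> 2 ^ r" by (intro power_increasing) auto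
    then show ?thesis using that by (auto simp: e_def)
  qed
  have ind: "indep_var (PiM {..<e} (\<lambda>_. borel)) (\<lambda>\<omega>. restrict (\<lambda>i. \<xi> i \<omega>) {..<e})
      (PiM {e..} (\<lambda>_. borel)) (\<lambda>\<omega>. restrict (\<lambda>i. \<xi> i \<omega>) {e..})"
    by (rule indep_var_restrict[OF indep_\<xi>]) auto
  have m1: "F 0 A \<in> borel_measurable (PiM {..<e} (\<lambda>_. borel))"
  proof -
    have c: "(\<lambda>x. x i) \<in> borel_measurable (PiM {..<e} (\<lambda>_. borel))" if "s \<in> A" "k \<in> {2^s..<2^Suc s}" "i \<in> {0..<k}" for s k i
      using k_lt[OF that(1,2)] that(3) by (intro measurable_component_singleton) auto
    have c2: "(\<lambda>x. \<Sum>i\<in>{0..<k}. x i) \<in> borel_measurable (PiM {..<e} (\<lambda>_. borel :: real measure))" if "s \<in> A" "k \<in> {2^s..<2^Suc s}" for s k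
      by (rule borel_measurable_sum) (rule c[OF that])
    show ?thesis unfolding F_def
    proof (intro borel_measurable_sum)
      fix s k :: nat assume s: "s \<in> A" "k \<in> {2^s..<2^Suc s}"
      note [measurable] = c2[OF s]
      show "(\<lambda>x. (\<bar>(\<Sum>i\<in>{0..<k}. x i) / sqrt (real k)\<bar> powr p - b_const p) / real k) \<in> borel_measurable (PiM {..<e} (\<lambda>_. borel))"
        by measurable
    qed
  qed
  have m2: "F e B \<in> borel_measurable (PiM {e..} (\<lambda>_. borel))"
  proof -
    have c2[measurable]: "(\<lambda>x. \<Sum>i\<in>{e..<k}. x i) \<in> borel_measurable (PiM {e..} (\<lambda>_. borel :: real measure))" for k
      by (intro borel_measurable_sum measurable_component_singleton) auto
    show ?thesis unfolding F_def by measurable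
  qed
  have "indep_var borel (F 0 A \<circ> (\<lambda>\<omega>. restrict (\<lambda>i. \<xi> i \<omega>) {..<e})) borel (F e B \<circ> (\<lambda>\<omega>. restrict (\<lambda>i. \<xi> i \<omega>) {e..}))"
    by (rule indep_var_compose[OF ind m1 m2])
  moreover have "F 0 A \<circ> (\<lambda>\<omega>. restrict (\<lambda>i. \<xi> i \<omega>) {..<e}) = (\<lambda>\<omega>. \<Sum>s\<in>A. lev 0 s \<omega>)"
  proof
    fix \<omega>
    have "(\<Sum>i\<in>{0..<k}. restrict (\<lambda>i. \<xi> i \<omega>) {..<e} i) = incr 0 k \<omega>" if "s \<in> A" "k \<in> {2^s..<2^Suc s}" for s k
      unfolding incr_def using k_lt[OF that] by (intro sum.cong) auto
    then show "(F 0 A \<circ> (\<lambda>\<omega>. restrict (\<lambda>i. \<xi> i \<omega>) {..<e})) \<omega> = (\<Sum>s\<in>A. lev 0 s \<omega>)"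
      unfolding F_def lev_def G_def comp_def by (intro sum.cong refl) simp
  qed
  moreover have "F e B \<circ> (\<lambda>\<omega>. restrict (\<lambda>i. \<xi> i \<omega>) {e..}) = (\<lambda>\<omega>. \<Sum>s\<in>B. lev (2^r) s \<omega>)"
  proof
    fix \<omega>
    have "(\<Sum>i\<in>{e..<k}. restrict (\<lambda>i. \<xi> i \<omega>) {e..} i) = incr e k \<omega>" for k
      unfolding incr_def by (intro sum.cong) auto
    then show "(F e B \<circ> (\<lambda>\<omega>. restrict (\<lambda>i. \<xi> i \<omega>) {e..})) \<omega> = (\<Sum>s\<in>B. lev (2^r) s \<omega>)"
      unfolding F_def lev_def G_def comp_def by (simp add: e_def)
  qed
  ultimately show ?thesis by simp
qed

lemma pow_moment4_nonneg: "0 \<le> pow_moment4"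
  by (simp add: pow_moment4_def)

text \<open>The rate \<open>sqrt (1/2)\<close> is the correlation lost per doubling of time. In
  \<open>K\<close> the summand 1 makes the base at least 1, so that its fourth power dominates
  \<open>pow_moment4\<close> itself.\<close>

sublocale geometric_mixing M "lev 0" "\<lambda>r. lev (2^r)" "approx_const + (1 + pow_moment4)" "sqrt (1/2)"
proof
  note nn = approx_const_nonneg pow_moment4_nonneg
  show "expectation (lev 0 s) = 0" for s
    unfolding lev_def
    by (subst Bochner_Integration.integral_sum) (auto intro!: L2_integrable L2_G G_mean sum.neutral dest!: level_pos)
  show "integrable M (\<lambda>\<omega>. lev 0 s \<omega> ^ 4)" for s by (rule lev_moment4)
  show "expectation (\<lambda>\<omega>. lev 0 s \<omega> ^ 4) \<le> (approx_const + (1 + pow_moment4)) ^ 4" for s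
  proof -
    have "expectation (\<lambda>\<omega>. lev 0 s \<omega> ^ 4) \<le> (approx_const + (1 + pow_moment4)) ^ 1" using lev_moment4(2)[of s] nn by simp
    also have "\<dots> \<le> (approx_const + (1 + pow_moment4)) ^ 4" using nn by (intro power_increasing) auto
    finally show ?thesis .
  qed
  show "integrable M (\<lambda>\<omega>. (lev 0 s \<omega> - lev (2 ^ r) s \<omega>)\<^sup>2)" if "r \<le> s" for r s
    using lev_approx(1)[OF that] by (rule L2_integrable_sq)
  show "expectation (\<lambda>\<omega>. (lev 0 s \<omega> - lev (2 ^ r) s \<omega>)\<^sup>2) \<le> ((approx_const + (1 + pow_moment4)) * sqrt (1/2) ^ (s - r))\<^sup>2" if "r \<le> s" for r s
  proof -
    have "L2norm (\<lambda>\<omega>. lev 0 s \<omega> - lev (2 ^ r) s \<omega>) \<le> approx_const * sqrt (1/2) ^ (s - r)" by (rule lev_approx(2)[OF that])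
    also have "\<dots> \<le> (approx_const + (1 + pow_moment4)) * sqrt (1/2) ^ (s - r)"
      using nn by (intro mult_right_mono) auto
    finally show ?thesis unfolding L2norm_sq[symmetric] by (intro power_mono L2norm_nonneg)
  qed
  show "0 \<le> approx_const + (1 + pow_moment4)" using nn by simp
  show "indep_var borel (\<lambda>\<omega>. \<Sum>s\<in>A. lev 0 s \<omega>) borel (\<lambda>\<omega>. \<Sum>s\<in>B. lev (2 ^ r) s \<omega>)"
    if "A \<subseteq> {..<r}" "B \<subseteq> {r..}" for A B r
    by (rule lev_indep[OF that])
qed (auto simp: real_sqrt_lt_1_iff)

lemma sum_levels: "(\<Sum>s<n. lev 0 s \<omega>) = (\<Sum>k\<in>{1..<2^n}. G 0 k \<omega>)"
proof (induction n)
  case (Suc n)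
  have "(\<Sum>k\<in>{1..<2^Suc n}. G 0 k \<omega>) = (\<Sum>k\<in>{1..<2^n}. G 0 k \<omega>) + (\<Sum>k\<in>{2^n..<2^Suc n}. G 0 k \<omega>)"
    by (subst sum.atLeastLessThan_concat) auto
  then show ?case using Suc by (simp add: lev_def)
qed simp

end

section \<open>The central limit theorem for the power sums of the walk\<close>

context gaussian_walk
begin

text \<open>The first \<open>n\<close> levels comprise the indices up to \<open>2 ^ n - 1\<close>,
  whose logarithm is asymptotic to \<open>n * ln 2\<close>.\<close>

lemma level_variance_limit:
  "(\<lambda>n. expectation (\<lambda>\<omega>. (\<Sum>s<n. lev 0 s \<omega>)\<^sup>2) / n) \<longlonglongrightarrow> 2 * a_const p * ln 2"
proof -
  have top: "filterlim (\<lambda>n. 2 ^ n - 1 :: nat) at_top sequentially"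
  proof (rule filterlim_at_top_mono[OF filterlim_ident])
    have "n \<le> 2 ^ n - 1" for n :: nat using less_exp[of n] by linarith
    then show "\<forall>\<^sub>F n in sequentially. n \<le> 2 ^ n - 1" by simp
  qed
  have l: "(\<lambda>n. ln (real (2 ^ n - 1)) / real n) \<longlonglongrightarrow> ln 2"
  proof -
    have "(\<lambda>n. ln (2 ^ n - 1) / real n) \<longlonglongrightarrow> ln 2" by real_asymp
    then show ?thesis by (simp add: of_nat_diff)
  qed
  have "(\<lambda>n. expectation (\<lambda>\<omega>. (\<Sum>k\<in>{1..<Suc (2 ^ n - 1)}. G 0 k \<omega>)\<^sup>2) / ln (real (2 ^ n - 1))
      * (ln (real (2 ^ n - 1)) / real n)) \<longlonglongrightarrow> 2 * a_const p * ln 2"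
    by (rule tendsto_mult[OF filterlim_compose[OF variance_limit top] l])
  moreover have "\<forall>\<^sub>F n in sequentially. expectation (\<lambda>\<omega>. (\<Sum>k\<in>{1..<Suc (2 ^ n - 1)}. G 0 k \<omega>)\<^sup>2) / ln (real (2 ^ n - 1))
      * (ln (real (2 ^ n - 1)) / real n) = expectation (\<lambda>\<omega>. (\<Sum>s<n. lev 0 s \<omega>)\<^sup>2) / n"
    using eventually_ge_at_top[of 2]
  proof eventually_elim
    case (elim n)
    have "(2::nat) ^ 2 \<le> 2 ^ n" using elim by (intro power_increasing) auto
    then have "1 < (2::nat) ^ n - 1" by simp
    then have "1 < real (2 ^ n - 1)" by linarith
    then have "ln (real (2 ^ n - 1)) \<noteq> 0" by simp
    moreover have "Suc (2 ^ n - 1) = 2 ^ n" by simp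
    ultimately show ?case by (simp only: sum_levels) simp
  qed
  ultimately show ?thesis by (rule Lim_transform_eventually)
qed

text \<open>Scale, centring and number of terms are free sequences because in the application the
  first two are functions of the sample size, not of the number of terms. The limit has variance
  \<open>2 * a_const p * \<tau>^2\<close>, of which the characteristic function sees half.\<close>

theorem walk_central_limit:
  assumes m: "filterlim m at_top sequentially"
    and u: "(\<lambda>N. u N * sqrt (ln (real (m N)))) \<longlonglongrightarrow> \<tau>"
    and d: "(\<lambda>N. u N * (b_const p * harm (m N) - d N)) \<longlonglongrightarrow> 0"
  shows "(\<lambda>N. CLINT \<omega>|M. iexp (u N * ((\<Sum>k\<in>{1..<Suc (m N)}. \<bar>incr 0 k \<omega> / sqrt k\<bar> powr p / k) - d N)))
    \<longlonglongrightarrow> of_real (exp (- (a_const p * \<tau>\<^sup>2)))"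
proof -
  \<comment> \<open>The number of complete levels among the indices up to \<open>m\<close>; the
    shift by 1 is there because \<open>n\<close> levels end just before
    \<open>2 ^ n\<close>.\<close>
  define lvl where "lvl = (\<lambda>m::nat. nat \<lfloor>log 2 (real m + 1)\<rfloor>)"
  have lvl: "2 ^ lvl m \<le> Suc m" "Suc m < 2 ^ Suc (lvl m)" for m
  proof -
    have l0: "0 \<le> log 2 (real m + 1)" by simp
    have "real (lvl m) \<le> log 2 (real m + 1)" using l0 by (simp add: lvl_def)
    then have "2 powr real (lvl m) \<le> real m + 1" by (subst (asm) le_log_iff) auto
    then have "real (2 ^ lvl m) \<le> real (Suc m)" by (simp add: powr_realpow add.commute)
    then show "2 ^ lvl m \<le> Suc m" by (simp only: of_nat_le_iff)
    have "log 2 (real m + 1) < real (lvl m) + 1" unfolding lvl_def by linarith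
    then have "real m + 1 < 2 powr (real (Suc (lvl m)))" by (subst (asm) log_less_iff) (auto simp: add.commute)
    then have "real (Suc m) < real (2 ^ Suc (lvl m))" by (subst (asm) powr_realpow) (auto simp: add.commute)
    then show "Suc m < 2 ^ Suc (lvl m)" by (simp only: of_nat_less_iff)
  qed
  have lvl_log: "log 2 (real m + 1) - 1 \<le> real (lvl m)" "real (lvl m) \<le> log 2 (real m + 1)" for m
  proof -
    have l0: "0 \<le> log 2 (real m + 1)" by simp
    show "real (lvl m) \<le> log 2 (real m + 1)" using l0 by (simp add: lvl_def)
    show "log 2 (real m + 1) - 1 \<le> real (lvl m)" unfolding lvl_def by linarith
  qed
  have lvl_div: "(\<lambda>m. real (lvl m) / ln (real m)) \<longlonglongrightarrow> 1 / ln 2"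
  proof (rule real_tendsto_sandwich)
    show "(\<lambda>m::nat. (log 2 (real m + 1) - 1) / ln (real m)) \<longlonglongrightarrow> 1 / ln 2"
      unfolding log_def inverse_eq_divide[symmetric, of "ln 2"] by real_asymp
    show "(\<lambda>m::nat. log 2 (real m + 1) / ln (real m)) \<longlonglongrightarrow> 1 / ln 2"
      unfolding log_def inverse_eq_divide[symmetric, of "ln 2"] by real_asymp
    show "\<forall>\<^sub>F m in sequentially. (log 2 (real m + 1) - 1) / ln (real m) \<le> real (lvl m) / ln (real m)"
      using eventually_ge_at_top[of 1] by eventually_elim (intro divide_right_mono lvl_log, simp)
    show "\<forall>\<^sub>F m in sequentially. real (lvl m) / ln (real m) \<le> log 2 (real m + 1) / ln (real m)"
      using eventually_ge_at_top[of 1] by eventually_elim (intro divide_right_mono lvl_log, simp)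
  qed
  have lvl_top: "filterlim lvl at_top sequentially"
  proof -
    have "filterlim (\<lambda>m::nat. log 2 (real m + 1) - 1) at_top sequentially" unfolding log_def by real_asymp
    then have "filterlim (\<lambda>m. real (lvl m)) at_top sequentially"
      by (rule filterlim_at_top_mono) (auto intro: always_eventually lvl_log)
    then show ?thesis by (rule filterlim_sequentially_iff_filterlim_real[THEN iffD2])
  qed
  define n where "n = (\<lambda>N. lvl (m N))"
  have n_top: "filterlim n at_top sequentially" unfolding n_def by (rule filterlim_compose[OF lvl_top m])
  \<comment> \<open>There are about \<open>ln (m N) / ln 2\<close> levels, so measuring the scale in
    levels divides \<open>\<tau>\<close> by \<open>sqrt (ln 2)\<close>; the \<open>ln 2\<close> in
    the variance per level compensates for it.\<close>
  define t where "t = \<tau> / sqrt (ln 2)"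
  have ln_top: "filterlim (\<lambda>N. ln (real (m N))) at_top sequentially"
    by (rule filterlim_compose[OF ln_at_top filterlim_compose[OF filterlim_real_sequentially m]])
  have ln_pos: "\<forall>\<^sub>F N in sequentially. 0 < ln (real (m N))"
    using ln_top by (simp add: filterlim_at_top_dense)
  have u0: "u \<longlonglongrightarrow> 0"
  proof -
    have "(\<lambda>N. u N * sqrt (ln (real (m N))) * (1 / sqrt (ln (real (m N))))) \<longlonglongrightarrow> \<tau> * 0"
      by (intro tendsto_mult u tendsto_divide_0[OF tendsto_const] filterlim_at_top_imp_at_infinity
          filterlim_compose[OF sqrt_at_top ln_top])
    moreover have "\<forall>\<^sub>F N in sequentially. u N * sqrt (ln (real (m N))) * (1 / sqrt (ln (real (m N)))) = u N"
      using ln_pos by eventually_elim simp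
    ultimately show ?thesis using Lim_transform_eventually by fastforce
  qed
  have un: "(\<lambda>N. u N * sqrt (n N)) \<longlonglongrightarrow> t"
  proof -
    have "(\<lambda>N. u N * sqrt (ln (real (m N))) * sqrt (real (n N) / ln (real (m N)))) \<longlonglongrightarrow> \<tau> * sqrt (1 / ln 2)"
      unfolding n_def by (intro tendsto_mult u tendsto_real_sqrt filterlim_compose[OF lvl_div m])
    moreover have "\<forall>\<^sub>F N in sequentially. u N * sqrt (ln (real (m N))) * sqrt (real (n N) / ln (real (m N))) = u N * sqrt (n N)"
      using ln_pos by eventually_elim (simp add: real_sqrt_divide)
    ultimately show ?thesis unfolding t_def real_sqrt_divide using Lim_transform_eventually by fastforce
  qed
  let ?E = "\<lambda>v f. CLINT \<omega>|M. iexp (v * f \<omega>)"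
  define S where "S = (\<lambda>N \<omega>. \<Sum>s<n N. lev 0 s \<omega>)"
  define T where "T = (\<lambda>N \<omega>. \<Sum>k\<in>{1..<Suc (m N)}. G 0 k \<omega>)"
  have LS: "L2 (S N)" for N unfolding S_def by (rule L2_sum_V)
  have LT: "L2 (T N)" for N unfolding T_def by (intro L2_sum L2_G) auto
  \<comment> \<open>The incomplete last level has bounded norm, again because its weights sum to at
    most 1; it disappears since \<open>u\<close> tends to 0.\<close>
  have TS: "L2norm (\<lambda>\<omega>. T N \<omega> - S N \<omega>) \<le> sqrt pow_var" for N
  proof -
    have sub: "{2 ^ n N..<Suc (m N)} \<subseteq> {2 ^ n N..<2 ^ Suc (n N)}" using lvl[of "m N"] by (auto simp: n_def)
    have eq: "T N \<omega> - S N \<omega> = (\<Sum>k\<in>{2 ^ n N..<Suc (m N)}. G 0 k \<omega>)" for \<omega>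
    proof -
      have "(\<Sum>k\<in>{1..<2 ^ n N}. G 0 k \<omega>) + (\<Sum>k\<in>{2 ^ n N..<Suc (m N)}. G 0 k \<omega>) = T N \<omega>"
        unfolding T_def by (rule sum.atLeastLessThan_concat) (use lvl(1)[of "m N"] in \<open>auto simp: n_def\<close>)
      then show ?thesis by (simp add: S_def sum_levels)
    qed
    have pos: "1 \<le> k" if "k \<in> {2 ^ n N..<Suc (m N)}" for k using that sub level_pos[of k "n N"] by blast
    have "L2norm (\<lambda>\<omega>. T N \<omega> - S N \<omega>) \<le> (\<Sum>k\<in>{2 ^ n N..<Suc (m N)}. L2norm (G 0 k))"
      unfolding eq by (intro L2norm_sum L2_G pos)
    also have "\<dots> = (\<Sum>k\<in>{2 ^ n N..<Suc (m N)}. sqrt pow_var * (1 / real k))"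
      by (intro sum.cong refl) (use L2norm_G[OF pos] in simp)
    also have "\<dots> \<le> (\<Sum>k\<in>{2 ^ n N..<2 ^ Suc (n N)}. sqrt pow_var * (1 / real k))"
      using sub by (intro sum_mono2) (auto simp: pow_var_def)
    also have "\<dots> \<le> sqrt pow_var * 1"
      unfolding sum_distrib_left[symmetric] by (intro mult_left_mono sum_inverse_level) (simp add: pow_var_def)
    finally show ?thesis by simp
  qed
  have e1: "(\<lambda>N. ?E (u N) (T N) - ?E (u N) (S N)) \<longlonglongrightarrow> 0"
  proof (rule Lim_null_comparison)
    show "\<forall>\<^sub>F N in sequentially. norm (?E (u N) (T N) - ?E (u N) (S N)) \<le> \<bar>u N\<bar> * sqrt pow_var"
    proof (intro always_eventually allI)
      fix N
      have "norm (?E (u N) (T N) - ?E (u N) (S N)) \<le> \<bar>u N\<bar> * expectation (\<lambda>\<omega>. \<bar>T N \<omega> - S N \<omega>\<bar>)"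
        by (intro norm_expectation_iexp_diff L2_integrable LT LS)
      also have "\<dots> \<le> \<bar>u N\<bar> * sqrt pow_var"
        by (intro mult_left_mono order_trans[OF expectation_abs_le TS] L2_diff LT LS) simp
      finally show "norm (?E (u N) (T N) - ?E (u N) (S N)) \<le> \<bar>u N\<bar> * sqrt pow_var" .
    qed
    show "(\<lambda>N. \<bar>u N\<bar> * sqrt pow_var) \<longlonglongrightarrow> 0"
      using tendsto_mult_left_zero[OF tendsto_rabs_zero[OF u0]] .
  qed
  \<comment> \<open>The limit theorem needs the exact scale \<open>t / sqrt (n N)\<close>, while
    \<open>u N\<close> has only this order; the sum has norm of order \<open>sqrt (n N)\<close>, so
    the difference is negligible.\<close>
  have e2: "(\<lambda>N. ?E (u N) (S N) - ?E (t / sqrt (n N)) (S N)) \<longlonglongrightarrow> 0"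
  proof (rule Lim_null_comparison)
    show "\<forall>\<^sub>F N in sequentially. norm (?E (u N) (S N) - ?E (t / sqrt (n N)) (S N)) \<le> \<bar>u N * sqrt (n N) - t\<bar> * sqrt var_bound"
    proof -
      have "\<forall>\<^sub>F N in sequentially. 1 \<le> n N" using n_top unfolding filterlim_at_top by blast
      then show ?thesis
      proof eventually_elim
        case (elim N)
        let ?v = "t / sqrt (n N)"
        have r: "?E v (S N) = ?E 1 (\<lambda>\<omega>. v * S N \<omega>)" for v by simp
        have "norm (?E (u N) (S N) - ?E ?v (S N)) \<le> \<bar>1\<bar> * expectation (\<lambda>\<omega>. \<bar>u N * S N \<omega> - ?v * S N \<omega>\<bar>)"
          unfolding r by (intro norm_expectation_iexp_diff L2_integrable L2_cmult LS)
        also have "\<dots> = \<bar>u N - ?v\<bar> * expectation (\<lambda>\<omega>. \<bar>S N \<omega>\<bar>)"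
          by (simp add: left_diff_distrib[symmetric] abs_mult del: times_divide_eq_left)
        also have "\<dots> \<le> \<bar>u N - ?v\<bar> * sqrt (var_bound * n N)"
        proof (rule mult_left_mono)
          have "expectation (\<lambda>\<omega>. \<bar>S N \<omega>\<bar>) \<le> L2norm (S N)" by (rule expectation_abs_le[OF LS])
          also have "\<dots> \<le> sqrt (var_bound * n N)" unfolding S_def by (rule L2norm_sum_V_le) auto
          finally show "expectation (\<lambda>\<omega>. \<bar>S N \<omega>\<bar>) \<le> sqrt (var_bound * n N)" .
        qed simp
        also have "\<dots> = \<bar>(u N - ?v) * sqrt (n N)\<bar> * sqrt var_bound" by (simp add: abs_mult real_sqrt_mult)
        also have "(u N - ?v) * sqrt (n N) = u N * sqrt (n N) - t" using elim by (simp add: left_diff_distrib)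
        finally show ?case .
      qed
    qed
    have "(\<lambda>N. u N * sqrt (n N) - t) \<longlonglongrightarrow> 0" using un by (simp add: LIM_zero)
    then show "(\<lambda>N. \<bar>u N * sqrt (n N) - t\<bar> * sqrt var_bound) \<longlonglongrightarrow> 0"
      by (intro tendsto_mult_left_zero tendsto_rabs_zero)
  qed
  have e3: "(\<lambda>N. ?E (t / sqrt (n N)) (S N)) \<longlonglongrightarrow> of_real (exp (- (t\<^sup>2 * (2 * a_const p * ln 2) / 2)))"
    unfolding S_def by (rule filterlim_compose[OF central_limit[OF level_variance_limit] n_top])
  have t2: "t\<^sup>2 * (2 * a_const p * ln 2) / 2 = a_const p * \<tau>\<^sup>2"
    by (simp add: t_def power_divide)
  have "(\<lambda>N. (?E (u N) (T N) - ?E (u N) (S N)) + (?E (u N) (S N) - ?E (t / sqrt (n N)) (S N)) + ?E (t / sqrt (n N)) (S N))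
     \<longlonglongrightarrow> 0 + 0 + of_real (exp (- (t\<^sup>2 * (2 * a_const p * ln 2) / 2)))"
    by (intro tendsto_add e1 e2 e3)
  then have eT: "(\<lambda>N. ?E (u N) (T N)) \<longlonglongrightarrow> of_real (exp (- (a_const p * \<tau>\<^sup>2)))" by (simp add: t2)
  \<comment> \<open>\<open>b_const p * harm (m N)\<close> is the exact mean of the power sum;
    replacing it by \<open>d N\<close> only turns the characteristic function by a phase that tends
    to 1.\<close>
  have "(\<lambda>N. iexp (u N * (b_const p * harm (m N) - d N))) \<longlonglongrightarrow> iexp 0"
    by (intro tendsto_exp tendsto_mult tendsto_const tendsto_of_real d)
  from tendsto_mult[OF this eT]
  have "(\<lambda>N. iexp (u N * (b_const p * harm (m N) - d N)) * ?E (u N) (T N)) \<longlonglongrightarrow> of_real (exp (- (a_const p * \<tau>\<^sup>2)))"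
    by simp
  moreover have "iexp (u N * (b_const p * harm (m N) - d N)) * ?E (u N) (T N)
     = (CLINT \<omega>|M. iexp (u N * ((\<Sum>k\<in>{1..<Suc (m N)}. \<bar>incr 0 k \<omega> / sqrt k\<bar> powr p / k) - d N)))" for N
  proof -
    have "(\<Sum>k\<in>{1..<Suc (m N)}. \<bar>incr 0 k \<omega> / sqrt k\<bar> powr p / k) - d N = (b_const p * harm (m N) - d N) + T N \<omega>" for \<omega>
      by (simp only: T_def G_def diff_divide_distrib sum_subtractf sum_inverse_nat[symmetric] sum_distrib_left) simp
    then have "(CLINT \<omega>|M. iexp (u N * ((\<Sum>k\<in>{1..<Suc (m N)}. \<bar>incr 0 k \<omega> / sqrt k\<bar> powr p / k) - d N)))
      = (CLINT \<omega>|M. iexp (u N * (b_const p * harm (m N) - d N)) * iexp (u N * T N \<omega>))"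
      by (simp only: distrib_left of_real_add exp_add)
    then show ?thesis by simp
  qed
  ultimately show ?thesis by simp
qed

end

subsection \<open>The weighted integral of the CUSUM process as a weighted sum\<close>

text \<open>Half-open, so that cells are exactly the sets on which the integer part of
  \<open>(N + 1) * t\<close>, and with it the CUSUM process, is constant.\<close>

definition cell :: "nat \<Rightarrow> nat \<Rightarrow> real set" where
  "cell N k = {real k / (real N + 1)..<(real k + 1) / (real N + 1)}"

definition cell_weight :: "real \<Rightarrow> nat \<Rightarrow> nat \<Rightarrow> real" where
  "cell_weight q N k = (LBINT t:cell N k. 1 / (t * (1 - t)) powr q)"

lemma cell_measurable [measurable]: "cell N k \<in> sets borel"
  by (simp add: cell_def)

lemma cell_iff: "t \<in> cell N k \<longleftrightarrow> \<lfloor>(real N + 1) * t\<rfloor> = int k"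
proof -
  have "0 < real N + 1" by simp
  then show ?thesis unfolding cell_def floor_eq_iff by (simp add: pos_divide_le_eq pos_less_divide_eq mult.commute)
qed

lemma emeasure_cell: "emeasure lborel (cell N k) = ennreal (1 / (real N + 1))"
proof -
  have "(real k + 1) / (real N + 1) - real k / (real N + 1) = 1 / (real N + 1)" by (simp add: diff_divide_distrib[symmetric])
  then show ?thesis unfolding cell_def by (subst emeasure_lborel_Ico) (auto simp: divide_right_mono)
qed

lemma measure_cell: "measure lborel (cell N k) = 1 / (real N + 1)"
  by (simp add: measure_def emeasure_cell)

lemma cell_bounds:
  assumes "1 \<le> k" "k < N" "t \<in> cell N k"
  shows "1 / (real N + 1) \<le> t" "1 / (real N + 1) \<le> 1 - t"
proof -
  have k: "1 \<le> real k" "real k + 1 \<le> real N" using assms by linarith+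
  have t: "real k / (real N + 1) \<le> t" "t < (real k + 1) / (real N + 1)" using assms by (auto simp: cell_def)
  have "1 / (real N + 1) \<le> real k / (real N + 1)" using k by (intro divide_right_mono) auto
  then show "1 / (real N + 1) \<le> t" using t by linarith
  have "(real k + 1) / (real N + 1) \<le> real N / (real N + 1)" using k by (intro divide_right_mono) auto
  also have "\<dots> = 1 - 1 / (real N + 1)" by (simp add: field_simps)
  finally show "1 / (real N + 1) \<le> 1 - t" using t by linarith
qed

lemma cell_weight_integrable:
  assumes "1 \<le> k" "k < N" "0 \<le> q"
  shows "set_integrable lborel (cell N k) (\<lambda>t. 1 / (t * (1 - t)) powr q)"
proof -
  define d where "d = 1 / (real N + 1)"
  have d: "0 < d" by (simp add: d_def)
  show ?thesis
    unfolding set_integrable_def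
  proof (rule Bochner_Integration.integrable_bound)
    show "integrable lborel (\<lambda>t. 1 / (d * d) powr q * indicator (cell N k) t)"
      by (intro integrable_mult_right integrable_real_indicator) (simp_all add: emeasure_cell)
    show "AE t in lborel. norm (indicator (cell N k) t *\<^sub>R (1 / (t * (1 - t)) powr q)) \<le> norm (1 / (d * d) powr q * indicator (cell N k) t)"
    proof (rule AE_I2)
      fix t :: real
      show "norm (indicator (cell N k) t *\<^sub>R (1 / (t * (1 - t)) powr q)) \<le> norm (1 / (d * d) powr q * indicator (cell N k) t)"
      proof (cases "t \<in> cell N k")
        case True
        then have "d \<le> t" "d \<le> 1 - t" using cell_bounds[OF assms(1,2)] by (auto simp: d_def)
        then have "d * d \<le> t * (1 - t)" using d by (intro mult_mono) auto
        then have "(d * d) powr q \<le> (t * (1 - t)) powr q" using d assms by (intro powr_mono2) auto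
        then have "1 / (t * (1 - t)) powr q \<le> 1 / (d * d) powr q" using d by (intro divide_left_mono) (auto intro!: mult_pos_pos dest: order_less_le_trans[of 0 "(d * d) powr q"])
        then show ?thesis using True by simp
      qed simp
    qed
  qed simp
qed

text \<open>The reflection \<open>t \<mapsto> 1 - t\<close> preserves the weight and swaps the two
  cells up to end points, which are null. The exact match is due to the factor \<open>N + 1\<close>
  in the time scale.\<close>

lemma cell_weight_symmetric:
  assumes "k < N"
  shows "cell_weight q N (N - k) = cell_weight q N k"
proof -
  let ?f = "\<lambda>t::real. 1 / (t * (1 - t)) powr q"
  have "cell_weight q N (N - k) = (LBINT t. indicator (cell N (N - k)) (1 + -1 * t) *\<^sub>R ?f (1 + -1 * t))"
    unfolding cell_weight_def set_lebesgue_integral_def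
    by (subst lborel_integral_real_affine[where c = "-1" and t = 1]) simp_all
  also have "\<dots> = (LBINT t. indicator (cell N k) t *\<^sub>R ?f t)"
  proof (rule integral_cong_AE)
    have k: "real (N - k) = real N - real k" using assms by (simp add: of_nat_diff)
    have ae: "AE t in lborel. t \<noteq> real k / (real N + 1)" "AE t in lborel. t \<noteq> (real k + 1) / (real N + 1)"
      by (rule AE_lborel_singleton)+
    show "AE t in lborel. indicator (cell N (N - k)) (1 + -1 * t) *\<^sub>R ?f (1 + -1 * t) = indicator (cell N k) t *\<^sub>R ?f t"
      using ae
    proof eventually_elim
      case (elim t)
      have n: "0 < real N + 1" by simp
      have e: "t * (real N + 1) \<noteq> real k" "t * (real N + 1) \<noteq> real k + 1"
        using elim n by (auto simp: eq_divide_eq)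
      have "1 + -1 * t \<in> cell N (N - k) \<longleftrightarrow> real N - real k \<le> (1 - t) * (real N + 1) \<and> (1 - t) * (real N + 1) < real N - real k + 1"
        using n by (simp add: cell_def k pos_divide_le_eq pos_less_divide_eq)
      also have "\<dots> \<longleftrightarrow> t * (real N + 1) \<le> real k + 1 \<and> real k < t * (real N + 1)"
        by (auto simp: algebra_simps)
      also have "\<dots> \<longleftrightarrow> real k \<le> t * (real N + 1) \<and> t * (real N + 1) < real k + 1" using e by linarith
      also have "\<dots> \<longleftrightarrow> t \<in> cell N k"
        using n by (simp add: cell_def pos_divide_le_eq pos_less_divide_eq)
      finally have "1 + -1 * t \<in> cell N (N - k) \<longleftrightarrow> t \<in> cell N k" .
      then show ?case by (simp add: indicator_def mult.commute)
    qed
  qed measurable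
  finally show ?thesis by (simp add: cell_weight_def set_lebesgue_integral_def)
qed

definition cusum_at :: "(nat \<Rightarrow> real) \<Rightarrow> nat \<Rightarrow> nat \<Rightarrow> real" where
  "cusum_at x N k = (\<Sum>i=1..k. x i) - real k / real N * (\<Sum>i=1..N. x i)"

text \<open>The CUSUM vanishes at \<open>k = 0\<close> and \<open>k = N\<close>, so the two outer
  cells, on which the weight is singular, contribute nothing.\<close>

lemma cusum_integral_eq_sum:
  assumes N: "1 \<le> N" and p: "0 < p"
  shows "(LBINT t:{0..1}. \<bar>cusum_process x N t\<bar> powr p / (t * (1 - t)) powr (1 + p / 2))
    = (\<Sum>k\<in>{1..<N}. real N powr (- p / 2) * \<bar>cusum_at x N k\<bar> powr p * cell_weight (1 + p / 2) N k)"
proof -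
  let ?q = "1 + p / 2"
  let ?w = "\<lambda>t::real. 1 / (t * (1 - t)) powr ?q"
  let ?c = "\<lambda>k. real N powr (- p / 2) * \<bar>cusum_at x N k\<bar> powr p"
  have pt: "indicator {0..1} t *\<^sub>R (\<bar>cusum_process x N t\<bar> powr p / (t * (1 - t)) powr ?q)
     = (\<Sum>k\<in>{1..<N}. ?c k * (indicator (cell N k) t *\<^sub>R ?w t))" for t
  proof (cases "0 \<le> t \<and> t < 1")
    case False
    have "t \<notin> cell N k" if "k \<in> {1..<N}" for k
    proof
      assume "t \<in> cell N k"
      then have "1 / (real N + 1) \<le> t" "1 / (real N + 1) \<le> 1 - t" using cell_bounds[of k N t] that by auto
      moreover have "0 < 1 / (real N + 1)" by simp
      ultimately show False using False by linarith
    qed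
    moreover have "cusum_process x N t = 0" using False by (auto simp: cusum_process_def)
    ultimately show ?thesis using p by simp
  next
    case True
    define k0 where "k0 = nat \<lfloor>(real N + 1) * t\<rfloor>"
    have fl: "\<lfloor>(real N + 1) * t\<rfloor> = int k0" using True by (simp add: k0_def)
    have k0: "k0 \<le> N"
    proof -
      have "(real N + 1) * t < (real N + 1) * 1" using True by (intro mult_strict_left_mono) auto
      then have "\<lfloor>(real N + 1) * t\<rfloor> < int N + 1" unfolding floor_less_iff by simp
      then show ?thesis using fl by simp
    qed
    have cu: "cusum x N ((real N + 1) * t) = cusum_at x N k0"
      unfolding cusum_def cusum_at_def fl by simp
    have "(\<Sum>k\<in>{1..<N}. ?c k * (indicator (cell N k) t *\<^sub>R ?w t)) = (\<Sum>k\<in>{1..<N}. if k = k0 then ?c k0 * ?w t else 0)"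
      by (intro sum.cong refl) (auto simp: cell_iff fl indicator_def)
    also have "\<dots> = (if k0 \<in> {1..<N} then ?c k0 * ?w t else 0)" by simp
    also have "\<dots> = ?c k0 * ?w t"
    proof (cases "k0 \<in> {1..<N}")
      case False
      then have "k0 = 0 \<or> k0 = N" using k0 by auto
      then have "cusum_at x N k0 = 0" using N by (auto simp: cusum_at_def)
      then show ?thesis using p by simp
    qed simp
    also have "?c k0 = \<bar>cusum_process x N t\<bar> powr p"
      using True by (simp add: cusum_process_def cu abs_mult powr_mult powr_powr)
    finally show ?thesis using True by simp
  qed
  have "(LBINT t:{0..1}. \<bar>cusum_process x N t\<bar> powr p / (t * (1 - t)) powr ?q)
     = (LBINT t. \<Sum>k\<in>{1..<N}. ?c k * (indicator (cell N k) t *\<^sub>R ?w t))"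
    unfolding set_lebesgue_integral_def pt ..
  also have "\<dots> = (\<Sum>k\<in>{1..<N}. LBINT t. ?c k * (indicator (cell N k) t *\<^sub>R ?w t))"
    using cell_weight_integrable[of _ N ?q] p
    by (intro Bochner_Integration.integral_sum integrable_mult_right) (auto simp: set_integrable_def)
  also have "\<dots> = (\<Sum>k\<in>{1..<N}. ?c k * cell_weight ?q N k)"
    by (simp only: integral_mult_right_zero cell_weight_def set_lebesgue_integral_def)
  finally show ?thesis .
qed

section \<open>Approximation of the cell weights by powers of the index\<close>

lemma powr_neg_diff_le:
  fixes q r :: real
  assumes q: "0 \<le> q" and r: "1 / 8 \<le> r"
  shows "\<bar>r powr (- q) - 1\<bar> \<le> q * 8 powr (q + 1) * \<bar>r - 1\<bar>"
proof -
  have main: "\<bar>y powr (- q) - x powr (- q)\<bar> \<le> q * 8 powr (q + 1) * (y - x)" if xy: "1 / 8 \<le> x" "x < y" for x y :: real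
  proof -
    have "\<exists>z>x. z < y \<and> y powr (- q) - x powr (- q) = (y - x) * (- q * z powr (- q - 1))"
      using xy by (intro MVT2) (auto intro!: derivative_eq_intros)
    then obtain z where z: "x < z" "z < y" "y powr (- q) - x powr (- q) = (y - x) * (- q * z powr (- q - 1))" by blast
    have "z powr (- q - 1) \<le> (1 / 8) powr (- q - 1)" using z xy q by (intro powr_mono2') auto
    also have "\<dots> = 8 powr (q + 1)" by (simp add: powr_divide powr_minus_divide[symmetric] add.commute flip: powr_minus)
    finally have zb: "z powr (- q - 1) \<le> 8 powr (q + 1)" .
    have "\<bar>y powr (- q) - x powr (- q)\<bar> = (y - x) * (q * z powr (- q - 1))"
      unfolding z(3) using q xy by (simp add: abs_mult)
    also have "\<dots> \<le> (y - x) * (q * 8 powr (q + 1))" using zb q xy by (intro mult_left_mono) auto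
    finally show ?thesis by (simp add: mult_ac)
  qed
  consider "r = 1" | "r < 1" | "1 < r" by linarith
  then show ?thesis
  proof cases
    case 2
    then show ?thesis using main[of r 1] r by (simp add: abs_minus_commute)
  next
    case 3
    then show ?thesis using main[of 1 r] by simp
  qed simp
qed

text \<open>On the cell \<open>t * (1 - t)\<close> equals \<open>k / N\<close> times a ratio
  \<open>r\<close> near 1. Its deviation has two sources: moving \<open>t\<close> within the cell
  costs order \<open>1 / k\<close>, and the factor \<open>1 - t\<close> costs order
  \<open>k / N\<close>.\<close>

lemma cell_weight_approx:
  assumes q: "0 \<le> q" and k: "1 \<le> k" "2 * k \<le> N"
  shows "\<bar>cell_weight q N k - (real k / real N) powr (- q) / (real N + 1)\<bar>
    \<le> 2 * q * 8 powr (q + 1) * (1 / real k + real k / real N) * (real k / real N) powr (- q) / (real N + 1)"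
proof -
  define x where "x = real k / real N"
  define c where "c = 2 * q * 8 powr (q + 1) * (1 / real k + real k / real N) * x powr (- q)"
  have kN: "k < N" "1 \<le> real k" "2 * real k \<le> real N" "0 < real N" using k by linarith+
  have x0: "0 < x" using kN by (simp add: x_def)
  let ?f = "\<lambda>t::real. 1 / (t * (1 - t)) powr q"
  have pt: "\<bar>?f t - x powr (- q)\<bar> \<le> c" if t: "t \<in> cell N k" for t
  proof -
    have n: "0 < real N + 1" by simp
    have t12: "real k \<le> t * (real N + 1)" "t * (real N + 1) < real k + 1"
      using t n by (simp_all add: cell_def pos_divide_le_eq pos_less_divide_eq)
    have t0: "0 < t" using t12 kN n by (metis mult_nonpos_nonneg not_le less_le_trans zero_less_one order_less_imp_le)
    define s where "s = t / x"
    define r where "r = s * (1 - t)"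
    have sx: "s = t * real N / real k" by (simp add: s_def x_def)
    have tN: "t * real N \<le> real k + 1" "real k - t \<le> t * real N" using t12 t0 by (simp_all add: algebra_simps)
    have t_le: "t \<le> (real k + 1) / (real N + 1)" using t12 n by (simp add: pos_le_divide_eq)
    also have "\<dots> \<le> 2 * real k / real N"
      using kN by (intro frac_le) auto
    finally have t2: "t \<le> 2 * (real k / real N)" by simp
    have "(real k + 1) / (real N + 1) \<le> 3 / 4"
    proof -
      have "4 * (real k + 1) \<le> 3 * (real N + 1)" unfolding distrib_left using kN by linarith
      then show ?thesis using n by (simp add: pos_divide_le_eq)
    qed
    then have t34: "t \<le> 3 / 4" using t_le by linarith
    have s1: "\<bar>s - 1\<bar> \<le> 1 / real k"
    proof -
      have "\<bar>t * real N - real k\<bar> \<le> 1" using tN t34 by linarith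
      moreover have "s - 1 = (t * real N - real k) / real k" using kN by (simp add: sx diff_divide_distrib)
      ultimately show ?thesis using kN by (simp add: abs_divide divide_right_mono)
    qed
    have s_ge: "1 / 2 \<le> s"
    proof -
      have "t * real N + t * real N \<ge> t * (real N + 1)" using t0 kN by (simp add: algebra_simps)
      then have "real k \<le> 2 * (t * real N)" using t12 by linarith
      then show ?thesis using kN by (simp add: sx pos_le_divide_eq)
    qed
    \<comment> \<open>\<open>2 * k \<le> N\<close> keeps the cell below 3/4, so \<open>1 - t\<close>
      is at least 1/4, and \<open>s\<close> is at least 1/2 even for small \<open>k\<close>. This is
      where the constant 8 comes from.\<close>
    have r8: "1 / 8 \<le> r"
    proof -
      have "1 / 2 * (1 / 4) \<le> s * (1 - t)" using s_ge t34 by (intro mult_mono) auto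
      then show ?thesis by (simp add: r_def)
    qed
    have "\<bar>r - 1\<bar> \<le> 2 * (1 / real k + real k / real N)"
    proof -
      have "r - 1 = (s - 1) * (1 - t) - t" by (simp add: r_def algebra_simps)
      then have "\<bar>r - 1\<bar> \<le> \<bar>s - 1\<bar> * \<bar>1 - t\<bar> + \<bar>t\<bar>" by (metis abs_mult abs_triangle_ineq4)
      also have "\<dots> \<le> 1 / real k * 1 + 2 * (real k / real N)" using s1 t0 t34 t2 by (intro add_mono mult_mono) auto
      also have "\<dots> \<le> 2 * (1 / real k) + 2 * (real k / real N)"
        by (intro add_mono) (auto simp: divide_right_mono)
      also have "\<dots> = 2 * (1 / real k + real k / real N)" by (simp only: distrib_left)
      finally show ?thesis .
    qed
    then have "\<bar>r powr (- q) - 1\<bar> \<le> q * 8 powr (q + 1) * (2 * (1 / real k + real k / real N))"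
      using powr_neg_diff_le[OF q r8] q by (smt (verit) mult_left_mono mult_nonneg_nonneg powr_ge_zero)
    then have "x powr (- q) * \<bar>r powr (- q) - 1\<bar> \<le> x powr (- q) * (q * 8 powr (q + 1) * (2 * (1 / real k + real k / real N)))"
      by (rule mult_left_mono) simp
    moreover have "?f t = x powr (- q) * r powr (- q)"
    proof -
      have "t * (1 - t) = x * r" using x0 by (simp add: r_def s_def)
      then have "?f t = (x * r) powr (- q)" by (simp add: powr_minus_divide)
      also have "\<dots> = x powr (- q) * r powr (- q)" using x0 r8 by (intro powr_mult)
      finally show ?thesis .
    qed
    then have "\<bar>?f t - x powr (- q)\<bar> = x powr (- q) * \<bar>r powr (- q) - 1\<bar>"
      by (simp add: abs_mult flip: right_diff_distrib[of "x powr (- q)" _ 1, simplified])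
    ultimately show ?thesis by (simp only: c_def mult_ac)
  qed
  have I: "integrable lborel (\<lambda>t. indicator (cell N k) t *\<^sub>R ?f t)"
    using cell_weight_integrable[OF k(1) kN(1) q] by (simp add: set_integrable_def)
  have Ic: "integrable lborel (\<lambda>t. indicator (cell N k) t *\<^sub>R b)" for b :: real
    by (intro integrable_scaleR_left integrable_real_indicator) (simp_all add: emeasure_cell)
  have ic: "(LBINT t. indicator (cell N k) t *\<^sub>R b) = b / (real N + 1)" for b :: real
    by (simp add: measure_cell)
  have "cell_weight q N k - x powr (- q) / (real N + 1) = (LBINT t. indicator (cell N k) t *\<^sub>R ?f t - indicator (cell N k) t *\<^sub>R x powr (- q))"
    unfolding Bochner_Integration.integral_diff[OF I Ic] ic by (simp add: cell_weight_def set_lebesgue_integral_def)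
  moreover have "\<bar>LBINT t. indicator (cell N k) t *\<^sub>R ?f t - indicator (cell N k) t *\<^sub>R x powr (- q)\<bar>
      \<le> (LBINT t. norm (indicator (cell N k) t *\<^sub>R ?f t - indicator (cell N k) t *\<^sub>R x powr (- q)))"
    unfolding real_norm_def[symmetric] by (rule integral_norm_bound)
  moreover have "(LBINT t. norm (indicator (cell N k) t *\<^sub>R ?f t - indicator (cell N k) t *\<^sub>R x powr (- q)))
      \<le> (LBINT t. indicator (cell N k) t *\<^sub>R c)"
  proof (rule integral_mono[OF integrable_norm[OF Bochner_Integration.integrable_diff[OF I Ic]] Ic])
    fix t
    show "norm (indicator (cell N k) t *\<^sub>R ?f t - indicator (cell N k) t *\<^sub>R x powr (- q)) \<le> indicator (cell N k) t *\<^sub>R c"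
      using pt[of t] by (cases "t \<in> cell N k") auto
  qed
  ultimately have "\<bar>cell_weight q N k - x powr (- q) / (real N + 1)\<bar> \<le> c / (real N + 1)"
    unfolding ic by linarith
  then show ?thesis unfolding c_def x_def .
qed

text \<open>With \<open>q = 1 + p / 2\<close> the powers of \<open>N\<close> combine to
  \<open>N / (N + 1)\<close>. Replacing this by 1 costs at most \<open>k / N\<close>, which accounts
  for the added 1 in the constant.\<close>

lemma scaled_cell_weight_approx:
  assumes p: "0 < p" and k: "1 \<le> k" "2 * k \<le> N"
  defines "q \<equiv> 1 + p / 2"
  shows "\<bar>real N powr (- p / 2) * cell_weight q N k - real k powr (- q)\<bar>
    \<le> (2 * q * 8 powr (q + 1) + 1) * (1 / real k + real k / real N) * real k powr (- q)"
proof -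
  have kN: "1 \<le> real k" "2 * real k \<le> real N" "0 < real N" using k by linarith+
  define e where "e = 1 / real k + real k / real N"
  define C where "C = 2 * q * 8 powr (q + 1)"
  have q0: "0 \<le> q" using p by (simp add: q_def)
  have C0: "0 \<le> C" using q0 by (simp add: C_def)
  have e0: "0 \<le> e" by (simp add: e_def)
  have scale: "real N powr (- p / 2) * (real k / real N) powr (- q) = real N * real k powr (- q)"
  proof -
    have "(real k / real N) powr (- q) = real k powr (- q) * real N powr q"
      using kN by (simp add: powr_divide powr_minus_divide)
    moreover have "real N powr (- p / 2) * real N powr q = real N"
      using kN by (simp add: q_def flip: powr_add)
    ultimately show ?thesis by (simp add: mult_ac)
  qed
  have f: "real N / (real N + 1) = 1 - 1 / (real N + 1)" by (simp add: field_simps)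
  have "\<bar>cell_weight q N k - (real k / real N) powr (- q) / (real N + 1)\<bar> \<le> C * e * (real k / real N) powr (- q) / (real N + 1)"
    unfolding C_def e_def by (rule cell_weight_approx[OF q0 k])
  then have "real N powr (- p / 2) * \<bar>cell_weight q N k - (real k / real N) powr (- q) / (real N + 1)\<bar>
    \<le> real N powr (- p / 2) * (C * e * (real k / real N) powr (- q) / (real N + 1))"
    by (rule mult_left_mono) simp
  also have "\<dots> = C * e * (real N powr (- p / 2) * (real k / real N) powr (- q)) / (real N + 1)" by simp
  also have "\<dots> = C * e * real k powr (- q) * (real N / (real N + 1))" unfolding scale by simp
  also have "\<dots> \<le> C * e * real k powr (- q) * 1"
    using C0 e0 kN by (intro mult_left_mono) auto
  finally have 0: "real N powr (- p / 2) * \<bar>cell_weight q N k - (real k / real N) powr (- q) / (real N + 1)\<bar>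
    \<le> C * e * real k powr (- q) * 1" .
  have 1: "\<bar>real N powr (- p / 2) * cell_weight q N k - real k powr (- q) * (real N / (real N + 1))\<bar> \<le> C * e * real k powr (- q)"
  proof -
    have "real N powr (- p / 2) * ((real k / real N) powr (- q) / (real N + 1)) = real k powr (- q) * (real N / (real N + 1))"
      unfolding times_divide_eq_right scale by (simp only: mult.commute)
    then have "real N powr (- p / 2) * cell_weight q N k - real k powr (- q) * (real N / (real N + 1))
      = real N powr (- p / 2) * (cell_weight q N k - (real k / real N) powr (- q) / (real N + 1))"
      by (simp only: right_diff_distrib)
    then show ?thesis using 0 by (simp add: abs_mult)
  qed
  have 2: "\<bar>real k powr (- q) * (real N / (real N + 1)) - real k powr (- q)\<bar> \<le> e * real k powr (- q)"
  proof -
    have "1 / (real N + 1) \<le> real k / real N" using kN by (intro frac_le) auto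
    also have "\<dots> \<le> e" by (simp add: e_def)
    finally have "real k powr (- q) * (1 / (real N + 1)) \<le> real k powr (- q) * e" by (rule mult_left_mono) simp
    moreover have "real k powr (- q) * (real N / (real N + 1)) - real k powr (- q) = - (real k powr (- q) * (1 / (real N + 1)))"
      unfolding f by (simp add: right_diff_distrib)
    moreover have "0 \<le> real k powr (- q) * (1 / (real N + 1))" by simp
    ultimately show ?thesis by (simp only: abs_minus_cancel abs_of_nonneg mult.commute[of e])
  qed
  have "(C + 1) * e * real k powr (- q) = C * e * real k powr (- q) + e * real k powr (- q)" by (simp add: algebra_simps)
  then show ?thesis using 1 2 unfolding C_def[symmetric] e_def[symmetric] by linarith
qed

section \<open>Errors of the single terms and a bound for their sum\<close>

lemma perturbed_pow_le:
  fixes x y B d p :: real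
  assumes p: "1 \<le> p" and B: "0 \<le> B" and d: "0 \<le> d" "d \<le> 2" and y: "\<bar>y - x\<bar> \<le> B * d"
  shows "\<bar>\<bar>y\<bar> powr p - \<bar>x\<bar> powr p\<bar> \<le> p * 2 powr p * d * ((1 + B) powr p * (1 + \<bar>x\<bar>) powr p)"
proof -
  \<comment> \<open>\<open>u\<close> dominates both \<open>B\<close> and half of
    \<open>|x| + |y|\<close>, and it factorises: the random size \<open>B\<close> leaves the
    estimate as the factor \<open>(1 + B) powr p\<close>, common to all terms.\<close>
  define u where "u = (1 + B) * (1 + \<bar>x\<bar>)"
  have u1: "1 \<le> u" using B mult_mono[of 1 "1 + B" 1 "1 + \<bar>x\<bar>"] by (simp add: u_def)
  have "B * d \<le> B * 2" using d B by (intro mult_left_mono) auto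
  then have "\<bar>y\<bar> + \<bar>x\<bar> \<le> 2 * \<bar>x\<bar> + 2 * B" using y by linarith
  also have "\<dots> \<le> 2 * u" using B by (simp add: u_def algebra_simps)
  finally have yx: "\<bar>y\<bar> + \<bar>x\<bar> \<le> 2 * u" .
  have Bu: "B \<le> u"
  proof -
    have "u = 1 + \<bar>x\<bar> + B + B * \<bar>x\<bar>" by (simp add: u_def algebra_simps)
    then show ?thesis using B mult_nonneg_nonneg[OF B abs_ge_zero[of x]] by linarith
  qed
  have "\<bar>\<bar>y\<bar> powr p - \<bar>x\<bar> powr p\<bar> \<le> p * \<bar>y - x\<bar> * (\<bar>y\<bar> + \<bar>x\<bar>) powr (p - 1)"
    by (rule abs_powr_diff_le[OF p])
  also have "\<dots> \<le> p * (B * d) * (2 * u) powr (p - 1)"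
    using p y yx B d by (intro mult_mono mult_left_mono powr_mono2) auto
  also have "\<dots> \<le> p * ((2 * u) * d) * (2 * u) powr (p - 1)"
    using p Bu u1 d by (intro mult_right_mono mult_left_mono) auto
  also have "\<dots> = p * d * ((2 * u) * (2 * u) powr (p - 1))" by (simp only: mult_ac)
  also have "(2 * u) * (2 * u) powr (p - 1) = (2 * u) powr p"
    using u1 powr_mult_base[of "2 * u" "p - 1"] by simp
  also have "(2 * u) powr p = 2 powr p * ((1 + B) powr p * (1 + \<bar>x\<bar>) powr p)"
    using u1 B by (simp add: u_def powr_mult)
  finally show ?thesis by (simp only: mult_ac)
qed

text \<open>The relative errors at index \<open>k\<close>: the strong approximation after division
  by \<open>sqrt k\<close>, the bridge term after the same division, and the rounding of the
  weight.\<close>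

definition err_weight :: "real \<Rightarrow> nat \<Rightarrow> nat \<Rightarrow> real" where
  "err_weight z N k = real k powr (z - 1/2) + sqrt (real k / real N) + (1 / real k + real k / real N)"

text \<open>With \<open>A\<close> the constant of the weight approximation this is
  \<open>(1 + 2 * A) * (p * 2 powr p) + A\<close>: the first part for the change of the power, the
  second for the change of the weight.\<close>

definition err_const :: "real \<Rightarrow> real" where
  "err_const p = (1 + 2 * (2 * (1 + p / 2) * 8 powr (1 + p / 2 + 1) + 1)) * (p * 2 powr p)
     + (2 * (1 + p / 2) * 8 powr (1 + p / 2 + 1) + 1)"

lemma err_const_nonneg: "1 \<le> p \<Longrightarrow> 0 \<le> err_const p"
  by (simp add: err_const_def)

lemma err_weight_nonneg: "0 \<le> err_weight z N k"
  by (simp add: err_weight_def)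

text \<open>\<open>y\<close> is a scaled CUSUM value and \<open>w\<close> the Wiener value
  approximating it. The change of the power is estimated under the true weight, the change of the
  weight under the Gaussian power.\<close>

lemma weighted_term_error:
  fixes y w :: real
  assumes p: "1 \<le> p" and B: "0 \<le> B" and z: "z < 1/2" and k: "1 \<le> k" "2 * k \<le> N"
    and yw: "\<bar>y - w\<bar> \<le> B * (real k powr z + real k / sqrt (real N))"
  shows "\<bar>real N powr (- p / 2) * \<bar>y\<bar> powr p * cell_weight (1 + p / 2) N k - \<bar>w / sqrt k\<bar> powr p / k\<bar>
    \<le> err_const p * (1 + B) powr p * (err_weight z N k / k * (1 + \<bar>w / sqrt k\<bar>) powr p)"
proof -
  have kN: "1 \<le> real k" "2 * real k \<le> real N" "0 < real N" using k by linarith+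
  define q where "q = 1 + p / 2"
  define A where "A = 2 * q * 8 powr (q + 1) + 1"
  define e where "e = 1 / real k + real k / real N"
  define d where "d = real k powr (z - 1/2) + sqrt (real k / real N)"
  define \<kappa> where "\<kappa> = real N powr (- p / 2) * cell_weight q N k"
  define x v where "x = w / sqrt k" and "v = y / sqrt k"
  define U where "U = (1 + B) powr p * (1 + \<bar>x\<bar>) powr p"
  define c where "c = real k powr (- q)"
  have A0: "0 \<le> A" using p by (simp add: A_def q_def)
  have c0: "0 < c" using kN by (simp add: c_def)
  have e: "0 \<le> e" "e \<le> 2"
  proof -
    have "1 / real k \<le> 1" "real k / real N \<le> 1" using kN by simp_all
    then show "e \<le> 2" by (simp add: e_def)
  qed (simp add: e_def)
  have d: "0 \<le> d" "d \<le> 2"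
  proof -
    have "real k powr (z - 1/2) \<le> 1" using powr_mono[of "z - 1/2" 0 "real k"] kN z by simp
    moreover have "sqrt (real k / real N) \<le> 1" using kN by simp
    ultimately show "d \<le> 2" unfolding d_def by linarith
  qed (simp add: d_def)
  have \<kappa>: "\<bar>\<kappa> - c\<bar> \<le> A * e * c"
    using scaled_cell_weight_approx[of p k N] p k by (simp add: \<kappa>_def c_def A_def e_def q_def)
  have "A * e * c \<le> A * 2 * c" using A0 e c0 by (intro mult_right_mono mult_left_mono) auto
  then have \<kappa>2: "\<bar>\<kappa>\<bar> \<le> (1 + 2 * A) * c" using \<kappa> c0 by (simp add: algebra_simps)
  \<comment> \<open>The identity that makes \<open>1 / k\<close> appear:
    \<open>k powr (- 1 - p / 2)\<close> times \<open>sqrt k powr p\<close>.\<close>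
  have scale: "c * \<bar>sqrt k * s\<bar> powr p = \<bar>s\<bar> powr p / k" for s
  proof -
    have "\<bar>sqrt k * s\<bar> powr p = real k powr (p / 2) * \<bar>s\<bar> powr p"
      using kN by (simp add: abs_mult powr_mult powr_half_sqrt[symmetric] powr_powr)
    moreover have "c * real k powr (p / 2) = 1 / k"
      using kN by (simp add: c_def q_def powr_minus_divide flip: powr_add)
    ultimately show ?thesis by (metis mult.assoc times_divide_eq_left mult_1)
  qed
  have yv: "y = sqrt k * v" and wx: "w = sqrt k * x" using kN by (simp_all add: v_def x_def)
  have "\<bar>v - x\<bar> = \<bar>y - w\<bar> / sqrt k" by (simp add: v_def x_def abs_divide flip: diff_divide_distrib)
  also have "\<dots> \<le> B * (real k powr z + real k / sqrt (real N)) / sqrt k" using yw by (intro divide_right_mono) auto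
  also have "\<dots> = B * d"
  proof -
    have "real k powr z / sqrt k = real k powr (z - 1/2)" using kN by (simp add: powr_diff powr_half_sqrt)
    moreover have "real k / sqrt (real N) / sqrt k = sqrt (real k / real N)"
    proof -
      have "real k / sqrt (real N) / sqrt k = real k / sqrt k / sqrt (real N)" by (simp add: mult.commute)
      then show ?thesis by (simp add: real_sqrt_divide real_div_sqrt)
    qed
    ultimately show ?thesis
      by (simp only: d_def add_divide_distrib times_divide_eq_right[symmetric])
  qed
  finally have vx: "\<bar>\<bar>v\<bar> powr p - \<bar>x\<bar> powr p\<bar> \<le> p * 2 powr p * d * U"
    unfolding U_def by (rule perturbed_pow_le[OF p B d])
  have xU: "\<bar>x\<bar> powr p \<le> U"
  proof -
    have "1 * \<bar>x\<bar> powr p \<le> (1 + B) powr p * (1 + \<bar>x\<bar>) powr p"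
      using B p by (intro mult_mono powr_mono2 ge_one_powr_ge_zero) auto
    then show ?thesis by (simp add: U_def)
  qed
  have U0: "0 \<le> U" by (simp add: U_def)
  have sw: "c * \<bar>w\<bar> powr p = \<bar>x\<bar> powr p / k" using scale[of x] by (simp only: wx[symmetric])
  have dec: "\<kappa> * \<bar>y\<bar> powr p - \<bar>x\<bar> powr p / k = \<kappa> * (\<bar>y\<bar> powr p - \<bar>w\<bar> powr p) + (\<kappa> - c) * \<bar>w\<bar> powr p"
    unfolding right_diff_distrib left_diff_distrib sw by simp
  have "\<bar>\<kappa> * (\<bar>y\<bar> powr p - \<bar>w\<bar> powr p)\<bar> \<le> (1 + 2 * A) * c * \<bar>\<bar>y\<bar> powr p - \<bar>w\<bar> powr p\<bar>"
    unfolding abs_mult using \<kappa>2 by (rule mult_right_mono) simp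
  also have "\<dots> = (1 + 2 * A) * (c * \<bar>\<bar>y\<bar> powr p - \<bar>w\<bar> powr p\<bar>)" by (simp only: mult.assoc)
  also have "c * \<bar>\<bar>y\<bar> powr p - \<bar>w\<bar> powr p\<bar> = \<bar>c * \<bar>y\<bar> powr p - c * \<bar>w\<bar> powr p\<bar>"
    using c0 by (simp only: abs_mult_pos'[symmetric] right_diff_distrib[symmetric] less_imp_le abs_mult abs_of_pos)
  also have "\<dots> = \<bar>\<bar>v\<bar> powr p - \<bar>x\<bar> powr p\<bar> / k"
    unfolding yv wx scale using kN by (simp add: abs_divide flip: diff_divide_distrib)
  also have "(1 + 2 * A) * (\<bar>\<bar>v\<bar> powr p - \<bar>x\<bar> powr p\<bar> / k) \<le> (1 + 2 * A) * ((p * 2 powr p * d * U) / k)"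
    using vx A0 by (intro mult_left_mono divide_right_mono) auto
  also have "\<dots> \<le> (1 + 2 * A) * ((p * 2 powr p * err_weight z N k * U) / k)"
    using A0 p U0 e by (intro mult_left_mono divide_right_mono mult_right_mono) (auto simp: err_weight_def d_def e_def)
  finally have t1: "\<bar>\<kappa> * (\<bar>y\<bar> powr p - \<bar>w\<bar> powr p)\<bar> \<le> (1 + 2 * A) * (p * 2 powr p) * (err_weight z N k / k * U)"
    by simp
  have "\<bar>(\<kappa> - c) * \<bar>w\<bar> powr p\<bar> \<le> A * e * c * \<bar>w\<bar> powr p"
    unfolding abs_mult using mult_right_mono[OF \<kappa>, of "\<bar>w\<bar> powr p"] by simp
  also have "\<dots> = A * e * (\<bar>x\<bar> powr p / k)" by (simp only: sw mult.assoc)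
  also have "\<dots> \<le> A * err_weight z N k * (U / k)"
    using A0 d xU by (intro mult_mono divide_right_mono mult_left_mono) (auto simp: err_weight_def d_def e_def)
  finally have t2: "\<bar>(\<kappa> - c) * \<bar>w\<bar> powr p\<bar> \<le> A * (err_weight z N k / k * U)" by simp
  have "\<bar>\<kappa> * \<bar>y\<bar> powr p - \<bar>x\<bar> powr p / k\<bar> \<le> (1 + 2 * A) * (p * 2 powr p) * (err_weight z N k / k * U) + A * (err_weight z N k / k * U)"
    unfolding dec using abs_triangle_ineq t1 t2 by (meson add_mono order_trans)
  also have "\<dots> = err_const p * (err_weight z N k / k * U)"
    unfolding err_const_def A_def q_def by (simp only: distrib_right)
  also have "\<dots> = err_const p * (1 + B) powr p * (err_weight z N k / k * (1 + \<bar>x\<bar>) powr p)"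
    unfolding U_def by (simp only: mult_ac)
  finally show ?thesis by (simp only: \<kappa>_def x_def q_def mult_ac)
qed

text \<open>Telescoping, as \<open>1 / sqrt (m + 1)\<close> is at most twice the increment of the
  square root.\<close>

lemma sum_inverse_sqrt_le: "(\<Sum>k\<in>{1..<Suc m}. 1 / sqrt (real k)) \<le> 2 * sqrt m"
proof (induction m)
  case (Suc m)
  let ?a = "sqrt (real m)" and ?b = "sqrt (real (Suc m))"
  have b: "0 < ?b" "?a \<le> ?b" "0 \<le> ?a" by simp_all
  have "(?b - ?a) * (?b + ?a) = 1" by (simp add: algebra_simps)
  then have "1 \<le> (?b - ?a) * (2 * ?b)"
    using b mult_left_mono[of "?b + ?a" "2 * ?b" "?b - ?a"] by simp
  then have "1 / ?b \<le> 2 * (?b - ?a)" unfolding pos_divide_le_eq[OF b(1)] by (simp only: mult_ac)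
  then show ?case using Suc by simp
qed simp

text \<open>After division by \<open>k\<close> the strong approximation gives
  \<open>k powr (z - 3/2)\<close>, summable exactly because \<open>z < 1/2\<close>; the bridge term
  gives \<open>1 / sqrt (N * k)\<close>, whose sum up to \<open>N / 2\<close> stays bounded; the
  rounding gives \<open>1 / k^2\<close> and \<open>1 / N\<close>. Hence the total error is bounded
  rather than of order \<open>ln N\<close>.\<close>

lemma sum_err_weight_bounded:
  assumes z: "z < 1/2"
  obtains K where "0 \<le> K" "\<And>N m. 1 \<le> N \<Longrightarrow> 2 * m \<le> N \<Longrightarrow> (\<Sum>k\<in>{1..<Suc m}. err_weight z N k / k) \<le> K"
proof -
  define K1 where "K1 = (\<Sum>k. real k powr (z - 3/2))"
  define K2 where "K2 = (\<Sum>k. real k powr (-2))"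
  have s1: "summable (\<lambda>k. real k powr (z - 3/2))" using z by (simp add: summable_real_powr_iff)
  have s2: "summable (\<lambda>k. real k powr (-2))" by (simp add: summable_real_powr_iff)
  have bd: "(\<Sum>k\<in>{1..<Suc m}. err_weight z N k / k) \<le> K1 + 2 + K2 + 1" if N: "1 \<le> N" and m: "2 * m \<le> N" for N m :: nat
  proof -
    have N0: "0 < real N" "real m \<le> real N" using N m by linarith+
    have "(\<Sum>k\<in>{1..<Suc m}. err_weight z N k / k)
      = (\<Sum>k\<in>{1..<Suc m}. real k powr (z - 3/2) + 1 / sqrt N * (1 / sqrt k) + real k powr (-2) + 1 / N)"
    proof (rule sum.cong[OF refl])
      fix k assume "k \<in> {1..<Suc m}"
      then have k: "0 < real k" by simp
      have "real k powr (z - 1/2) / k = real k powr (z - 3/2)"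
        using k powr_diff[of "real k" "z - 1/2" 1] by simp
      moreover have "sqrt (real k / real N) / k = 1 / sqrt N * (1 / sqrt k)"
      proof -
        have "sqrt (real k) / real k = 1 / sqrt (real k)" using k by (simp add: divide_eq_eq eq_divide_eq)
        moreover have "sqrt (real k / real N) / k = sqrt (real k) / real k / sqrt N" by (simp add: real_sqrt_divide)
        ultimately show ?thesis by simp
      qed
      moreover have "1 / real k / k = real k powr (-2)"
        using k by (simp add: powr_minus_divide power2_eq_square)
      moreover have "real k / real N / k = 1 / N" using k by simp
      ultimately show "err_weight z N k / k = real k powr (z - 3/2) + 1 / sqrt N * (1 / sqrt k) + real k powr (-2) + 1 / N"
        by (simp only: err_weight_def add_divide_distrib add.assoc)
    qed
    also have "\<dots> = (\<Sum>k\<in>{1..<Suc m}. real k powr (z - 3/2)) + 1 / sqrt N * (\<Sum>k\<in>{1..<Suc m}. 1 / sqrt k)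
      + (\<Sum>k\<in>{1..<Suc m}. real k powr (-2)) + m / N"
      by (simp only: sum.distrib sum_distrib_left[symmetric]) simp
    also have "\<dots> \<le> K1 + 2 + K2 + 1"
    proof (intro add_mono)
      show "(\<Sum>k\<in>{1..<Suc m}. real k powr (z - 3/2)) \<le> K1" unfolding K1_def by (intro sum_le_suminf s1) auto
      show "(\<Sum>k\<in>{1..<Suc m}. real k powr (-2)) \<le> K2" unfolding K2_def by (intro sum_le_suminf s2) auto
      have "1 / sqrt N * (\<Sum>k\<in>{1..<Suc m}. 1 / sqrt k) \<le> 1 / sqrt N * (2 * sqrt m)"
        by (intro mult_left_mono sum_inverse_sqrt_le) simp
      also have "\<dots> \<le> 1 / sqrt N * (2 * sqrt N)" using N0 by (intro mult_left_mono) auto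
      also have "\<dots> = 2" using N0 by simp
      finally show "1 / sqrt N * (\<Sum>k\<in>{1..<Suc m}. 1 / sqrt k) \<le> 2" .
      show "real m / real N \<le> 1" using N0 by simp
    qed
    finally show ?thesis .
  qed
  have "0 \<le> K1 + 2 + K2 + 1" using suminf_nonneg[OF s1] suminf_nonneg[OF s2] by (simp add: K1_def K2_def)
  then show thesis using that bd by blast
qed

subsection \<open>Wiener processes on integer times\<close>

lemma (in prob_space) iid_normal_integral:
  fixes F :: "(nat \<Rightarrow> real) \<Rightarrow> complex"
  assumes ind: "indep_vars (\<lambda>_. borel) \<eta> {..<m}" and m: "1 \<le> m"
    and normal: "\<And>i. i < m \<Longrightarrow> distributed M lborel (\<eta> i) std_normal_density"
    and F: "F \<in> borel_measurable (PiM {..<m} (\<lambda>_. borel))"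
  shows "expectation (\<lambda>\<omega>. F (\<lambda>i\<in>{..<m}. \<eta> i \<omega>)) = (\<integral>x. F x \<partial>PiM {..<m} (\<lambda>_. \<N>))"
proof -
  have rv: "\<eta> i \<in> borel_measurable M" if "i \<in> {..<m}" for i
    using distributed_measurable[OF normal[of i]] that by simp
  have d: "distr M borel (\<eta> i) = \<N>" if "i \<in> {..<m}" for i
  proof -
    have "distr M borel (\<eta> i) = distr M lborel (\<eta> i)" by (rule distr_cong) simp_all
    then show ?thesis using distributed_distr_eq_density[OF normal[of i]] that by simp
  qed
  have ne: "{..<m} \<noteq> {}" using m by (auto simp: lessThan_empty_iff)
  have "distr M (PiM {..<m} (\<lambda>_. borel)) (\<lambda>\<omega>. \<lambda>i\<in>{..<m}. \<eta> i \<omega>) = PiM {..<m} (\<lambda>i. distr M borel (\<eta> i))"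
    using ind indep_vars_iff_distr_eq_PiM'[where M' = "\<lambda>_. borel" and X = \<eta>, OF ne] rv by simp
  also have "\<dots> = PiM {..<m} (\<lambda>_. \<N>)" by (rule PiM_cong) (auto simp: d)
  finally have eq: "distr M (PiM {..<m} (\<lambda>_. borel)) (\<lambda>\<omega>. \<lambda>i\<in>{..<m}. \<eta> i \<omega>) = PiM {..<m} (\<lambda>_. \<N>)" .
  show ?thesis
    unfolding eq[symmetric] using F rv by (subst integral_distr) (auto intro!: measurable_restrict)
qed

text \<open>The canonical space on which the walk lives for all lengths at once, so that a limit in
  the length makes sense.\<close>

definition gauss_seq :: "(nat \<Rightarrow> real) measure" where
  "gauss_seq = PiM UNIV (\<lambda>_. \<N>)"

lemma gaussian_walk_gauss_seq:
  assumes "1 \<le> p"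
  shows "gaussian_walk gauss_seq (\<lambda>i x. x i) p"
proof -
  have ps: "prob_space \<N>" by (rule \<N>.prob_space_axioms)
  have S: "prob_space gauss_seq" unfolding gauss_seq_def by (rule prob_space_PiM) (rule ps)
  interpret S: prob_space gauss_seq by (rule S)
  have rv: "(\<lambda>x. x i) \<in> borel_measurable gauss_seq" for i
  proof -
    have "(\<lambda>x. x i) \<in> measurable gauss_seq \<N>" unfolding gauss_seq_def by (rule measurable_component_singleton) simp
    then show ?thesis by simp
  qed
  have d: "distr gauss_seq borel (\<lambda>x. x i) = \<N>" for i
  proof -
    have "distr gauss_seq borel (\<lambda>x. x i) = distr gauss_seq \<N> (\<lambda>x. x i)" by (rule distr_cong) simp_all
    also have "\<dots> = \<N>" unfolding gauss_seq_def by (rule distr_PiM_component[OF ps]) simp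
    finally show ?thesis .
  qed
  have sets: "sets (PiM UNIV (\<lambda>_::nat. borel)) = sets gauss_seq" unfolding gauss_seq_def by (rule sets_PiM_cong) simp_all
  have "S.indep_vars (\<lambda>_. borel) (\<lambda>i x. x i) UNIV"
  proof (subst S.indep_vars_iff_distr_eq_PiM)
    have "distr gauss_seq (PiM UNIV (\<lambda>_. borel)) (\<lambda>x. \<lambda>i\<in>UNIV. x i) = distr gauss_seq gauss_seq (\<lambda>x. x)"
      by (rule distr_cong) (simp_all add: sets restrict_def)
    also have "\<dots> = PiM UNIV (\<lambda>i. distr gauss_seq borel (\<lambda>x. x i))" unfolding d by (simp add: gauss_seq_def)
    finally show "distr gauss_seq (PiM UNIV (\<lambda>_. borel)) (\<lambda>x. \<lambda>i\<in>UNIV. x i) = PiM UNIV (\<lambda>i. distr gauss_seq borel (\<lambda>x. x i))" .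
  qed (auto simp: rv)
  moreover have "distributed gauss_seq lborel (\<lambda>x. x i) std_normal_density" for i
  proof -
    have "distr gauss_seq lborel (\<lambda>x. x i) = distr gauss_seq borel (\<lambda>x. x i)" by (rule distr_cong) simp_all
    then show ?thesis unfolding distributed_def using rv d by simp
  qed
  ultimately show ?thesis
    using assms by unfold_locales auto
qed

definition walk_pow_sum :: "real \<Rightarrow> nat \<Rightarrow> (nat \<Rightarrow> real) \<Rightarrow> real" where
  "walk_pow_sum p m w = (\<Sum>k\<in>{1..<Suc m}. \<bar>w k / sqrt k\<bar> powr p / k)"

definition walk_char :: "real \<Rightarrow> nat \<Rightarrow> real \<Rightarrow> real \<Rightarrow> complex" where
  "walk_char p m u d = (CLINT x|gauss_seq. iexp (u * (walk_pow_sum p m (\<lambda>k. \<Sum>i\<in>{0..<k}. x i) - d)))"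

lemma walk_char_limit:
  assumes p: "1 \<le> p" and m: "filterlim m at_top sequentially"
    and u: "(\<lambda>N. u N * sqrt (ln (real (m N)))) \<longlonglongrightarrow> \<tau>"
    and d: "(\<lambda>N. u N * (b_const p * harm (m N) - d N)) \<longlonglongrightarrow> 0"
  shows "(\<lambda>N. walk_char p (m N) (u N) (d N)) \<longlonglongrightarrow> of_real (exp (- (a_const p * \<tau>\<^sup>2)))"
proof -
  interpret S: gaussian_walk gauss_seq "\<lambda>i x. x i" p by (rule gaussian_walk_gauss_seq[OF p])
  show ?thesis using S.walk_central_limit[OF m u d] by (simp add: walk_char_def walk_pow_sum_def S.incr_def)
qed

text \<open>The law is given only for increments; since \<open>W 0\<close> vanishes almost surely,
  \<open>W t\<close> has the law of its increment from 0.\<close>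

lemma (in prob_space) wiener_std_normal:
  assumes W: "wiener_process_on M T W" and t: "0 < t" "t \<le> T"
  shows "distributed M lborel (\<lambda>\<omega>. W t \<omega> / sqrt t) std_normal_density"
proof -
  have meas: "W s \<in> borel_measurable M" if "0 \<le> s" "s \<le> T" for s using W that by (auto simp: wiener_process_on_def)
  have W0: "AE \<omega> in M. W 0 \<omega> = 0" using W by (simp add: wiener_process_on_def)
  have "(0::real) \<le> 0 \<and> 0 < t \<and> t \<le> T" using t by simp
  then have "distributed M lborel (\<lambda>\<omega>. W t \<omega> - W 0 \<omega>) (\<lambda>x. ennreal (normal_density 0 (sqrt (t - 0)) x))"
    using W unfolding wiener_process_on_def by blast
  then have D: "distributed M lborel (\<lambda>\<omega>. W t \<omega> - W 0 \<omega>) (\<lambda>x. ennreal (normal_density 0 (sqrt t) x))" by simp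
  have "distr M lborel (W t) = distr M lborel (\<lambda>\<omega>. W t \<omega> - W 0 \<omega>)"
    using W0 meas[of t] meas[of 0] t by (intro distr_cong_AE) auto
  then have "distributed M lborel (W t) (\<lambda>x. ennreal (normal_density 0 (sqrt t) x))"
    using D meas[of t] t by (simp add: distributed_def)
  then show ?thesis using normal_standard_normal_convert[of "sqrt t" "W t" 0] t by simp
qed

text \<open>Only the \<open>m\<close> unit increments enter, and they are independent standard
  normal. Both sides are therefore the integral of one function \<open>F\<close> over the same
  finite product measure.\<close>

lemma (in prob_space) wiener_walk_char:
  assumes W: "wiener_process_on M T W" and m: "1 \<le> m" "real m \<le> T"
  shows "(CLINT \<omega>|M. iexp (u * (walk_pow_sum p m (\<lambda>k. W (real k) \<omega>) - d))) = walk_char p m u d"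
proof -
  define \<eta> where "\<eta> = (\<lambda>i \<omega>. W (real (Suc i)) \<omega> - W (real i) \<omega>)"
  define F where "F = (\<lambda>x. iexp (u * (walk_pow_sum p m (\<lambda>k. \<Sum>i\<in>{0..<k}. x i) - d)))"
  have meas: "W s \<in> borel_measurable M" if "0 \<le> s" "s \<le> T" for s using W that by (auto simp: wiener_process_on_def)
  have meas_\<eta>: "\<eta> i \<in> borel_measurable M" if "i < m" for i
    unfolding \<eta>_def using that m by (intro borel_measurable_diff meas) auto
  have F_meas: "F \<in> borel_measurable (PiM {..<m} (\<lambda>_. borel))"
  proof -
    have c: "(\<lambda>x. \<Sum>i\<in>{0..<k}. x i) \<in> borel_measurable (PiM {..<m} (\<lambda>_. borel :: real measure))" if "k \<in> {1..<Suc m}" for k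
      using that by (intro borel_measurable_sum measurable_component_singleton) auto
    have "(\<lambda>x. walk_pow_sum p m (\<lambda>k. \<Sum>i\<in>{0..<k}. x i)) \<in> borel_measurable (PiM {..<m} (\<lambda>_. borel))"
      unfolding walk_pow_sum_def
    proof (rule borel_measurable_sum)
      fix k assume k: "k \<in> {1..<Suc m}"
      note [measurable] = c[OF k]
      show "(\<lambda>x. \<bar>(\<Sum>i\<in>{0..<k}. x i) / sqrt (real k)\<bar> powr p / real k) \<in> borel_measurable (PiM {..<m} (\<lambda>_. borel))"
        by measurable
    qed
    then show ?thesis unfolding F_def by measurable
  qed
  have F_restrict: "F (\<lambda>i\<in>{..<m}. x i) = F x" for x
  proof -
    have "(\<Sum>i\<in>{0..<k}. (\<lambda>i\<in>{..<m}. x i) i) = (\<Sum>i\<in>{0..<k}. x i)" if "k \<in> {1..<Suc m}" for k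
      using that by (intro sum.cong) auto
    then have "walk_pow_sum p m (\<lambda>k. \<Sum>i\<in>{0..<k}. (\<lambda>i\<in>{..<m}. x i) i) = walk_pow_sum p m (\<lambda>k. \<Sum>i\<in>{0..<k}. x i)"
      unfolding walk_pow_sum_def by (intro sum.cong refl) metis
    then show ?thesis by (simp only: F_def)
  qed
  have ind: "indep_vars (\<lambda>_. borel) \<eta> {..<m}"
  proof -
    have "0 \<le> real 0 \<and> (\<forall>i<m. real i \<le> real (Suc i)) \<and> real m \<le> T" using m by simp
    then show ?thesis using W unfolding wiener_process_on_def \<eta>_def by blast
  qed
  have normal: "distributed M lborel (\<eta> i) std_normal_density" if "i < m" for i
  proof -
    have "0 \<le> real i \<and> real i < real (Suc i) \<and> real (Suc i) \<le> T" using that m by auto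
    then have "distributed M lborel (\<lambda>\<omega>. W (real (Suc i)) \<omega> - W (real i) \<omega>) (\<lambda>x. ennreal (normal_density 0 (sqrt (real (Suc i) - real i)) x))"
      using W unfolding wiener_process_on_def by blast
    then show ?thesis by (simp add: \<eta>_def)
  qed
  have "(CLINT \<omega>|M. iexp (u * (walk_pow_sum p m (\<lambda>k. W (real k) \<omega>) - d))) = (CLINT \<omega>|M. F (\<lambda>i. \<eta> i \<omega>))"
  proof (rule integral_cong_AE)
    have "(\<lambda>\<omega>. walk_pow_sum p m (\<lambda>k. W (real k) \<omega>)) \<in> borel_measurable M"
      unfolding walk_pow_sum_def
    proof (rule borel_measurable_sum)
      fix k assume k: "k \<in> {1..<Suc m}"
      have [measurable]: "W (real k) \<in> borel_measurable M" using k m by (intro meas) auto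
      show "(\<lambda>\<omega>. \<bar>W (real k) \<omega> / sqrt (real k)\<bar> powr p / real k) \<in> borel_measurable M" by measurable
    qed
    then show "(\<lambda>\<omega>. iexp (u * (walk_pow_sum p m (\<lambda>k. W (real k) \<omega>) - d))) \<in> borel_measurable M" by measurable
    have "(\<lambda>\<omega>. F (\<lambda>i\<in>{..<m}. \<eta> i \<omega>)) \<in> borel_measurable M"
      by (rule measurable_compose[OF measurable_restrict F_meas]) (use meas_\<eta> in auto)
    then show "(\<lambda>\<omega>. F (\<lambda>i. \<eta> i \<omega>)) \<in> borel_measurable M" by (simp only: F_restrict)
    have "AE \<omega> in M. W 0 \<omega> = 0" using W by (simp add: wiener_process_on_def)
    then show "AE \<omega> in M. iexp (u * (walk_pow_sum p m (\<lambda>k. W (real k) \<omega>) - d)) = F (\<lambda>i. \<eta> i \<omega>)"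
    proof eventually_elim
      case (elim \<omega>)
      have "(\<Sum>i\<in>{0..<k}. \<eta> i \<omega>) = W (real k) \<omega>" for k
        unfolding \<eta>_def using sum_lessThan_telescope[of "\<lambda>i. W (real i) \<omega>" k] elim by (simp add: lessThan_atLeast0)
      then show ?case by (simp add: F_def)
    qed
  qed
  also have "\<dots> = (\<integral>x. F x \<partial>PiM {..<m} (\<lambda>_. \<N>))"
    using iid_normal_integral[OF ind m(1) normal F_meas] by (simp only: F_restrict)
  also have "\<dots> = walk_char p m u d"
  proof -
    interpret S: gaussian_walk gauss_seq "\<lambda>i x. x i" 1 by (rule gaussian_walk_gauss_seq) simp
    have "(\<integral>x. F (\<lambda>i\<in>{..<m}. x i) \<partial>gauss_seq) = (\<integral>x. F x \<partial>PiM {..<m} (\<lambda>_. \<N>))"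
      by (rule S.iid_normal_integral[OF S.indep_vars_subset[OF S.indep_\<xi>] m(1) S.normal_\<xi> F_meas]) simp
    then show ?thesis by (simp only: F_restrict) (simp add: F_def walk_char_def)
  qed
  finally show ?thesis .
qed

subsection \<open>Boundedness in probability\<close>

context prob_space
begin

lemma bounded_in_probability_mono:
  assumes Y: "bounded_in_probability M Y" and [measurable]: "\<And>N. Y N \<in> borel_measurable M"
    and le: "\<forall>\<^sub>F N in sequentially. \<forall>\<omega>\<in>space M. \<bar>X N \<omega>\<bar> \<le> \<bar>Y N \<omega>\<bar>"
  shows "bounded_in_probability M X"
  unfolding bounded_in_probability_def
proof (intro allI impI)
  fix \<delta> :: real assume "0 < \<delta>"
  then obtain C where C: "\<forall>\<^sub>F N in sequentially. prob {\<omega>\<in>space M. \<bar>Y N \<omega>\<bar> > C} < \<delta>"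
    using Y unfolding bounded_in_probability_def by blast
  have "\<forall>\<^sub>F N in sequentially. prob {\<omega>\<in>space M. \<bar>X N \<omega>\<bar> > C} < \<delta>"
    using C le
  proof eventually_elim
    case (elim N)
    have "prob {\<omega>\<in>space M. \<bar>X N \<omega>\<bar> > C} \<le> prob {\<omega>\<in>space M. \<bar>Y N \<omega>\<bar> > C}"
      by (rule finite_measure_mono) (use elim in force, measurable)
    then show ?case using elim by simp
  qed
  then show "\<exists>C. \<forall>\<^sub>F N in sequentially. prob {\<omega>\<in>space M. \<bar>X N \<omega>\<bar> > C} < \<delta>" by blast
qed

lemma bounded_in_probability_add:
  assumes X: "bounded_in_probability M X" and Y: "bounded_in_probability M Y"
    and [measurable]: "\<And>N. X N \<in> borel_measurable M" "\<And>N. Y N \<in> borel_measurable M"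
  shows "bounded_in_probability M (\<lambda>N \<omega>. X N \<omega> + Y N \<omega>)"
  unfolding bounded_in_probability_def
proof (intro allI impI)
  fix \<delta> :: real assume d: "0 < \<delta>"
  obtain C where C: "\<forall>\<^sub>F N in sequentially. prob {\<omega>\<in>space M. \<bar>X N \<omega>\<bar> > C} < \<delta> / 2"
    using X[unfolded bounded_in_probability_def, rule_format, of "\<delta> / 2"] d by auto
  obtain D where D: "\<forall>\<^sub>F N in sequentially. prob {\<omega>\<in>space M. \<bar>Y N \<omega>\<bar> > D} < \<delta> / 2"
    using Y[unfolded bounded_in_probability_def, rule_format, of "\<delta> / 2"] d by auto
  have "\<forall>\<^sub>F N in sequentially. prob {\<omega>\<in>space M. \<bar>X N \<omega> + Y N \<omega>\<bar> > C + D} < \<delta>"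
    using C D
  proof eventually_elim
    case (elim N)
    have "prob {\<omega>\<in>space M. \<bar>X N \<omega> + Y N \<omega>\<bar> > C + D}
      \<le> prob ({\<omega>\<in>space M. \<bar>X N \<omega>\<bar> > C} \<union> {\<omega>\<in>space M. \<bar>Y N \<omega>\<bar> > D})"
      by (rule finite_measure_mono) (auto, measurable)
    also have "\<dots> \<le> prob {\<omega>\<in>space M. \<bar>X N \<omega>\<bar> > C} + prob {\<omega>\<in>space M. \<bar>Y N \<omega>\<bar> > D}"
      by (rule measure_Un_le) measurable
    finally show ?case using elim by linarith
  qed
  then show "\<exists>C. \<forall>\<^sub>F N in sequentially. prob {\<omega>\<in>space M. \<bar>X N \<omega> + Y N \<omega>\<bar> > C} < \<delta>" by blast
qed

lemma bounded_in_probability_subseq: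
  assumes "bounded_in_probability M Y" "filterlim g at_top sequentially"
  shows "bounded_in_probability M (\<lambda>N. Y (g N))"
  unfolding bounded_in_probability_def
proof (intro allI impI)
  fix \<delta> :: real assume "0 < \<delta>"
  then obtain C where "\<forall>\<^sub>F N in sequentially. prob {\<omega>\<in>space M. \<bar>Y N \<omega>\<bar> > C} < \<delta>"
    using assms(1) unfolding bounded_in_probability_def by blast
  from eventually_compose_filterlim[OF this assms(2)]
  show "\<exists>C. \<forall>\<^sub>F N in sequentially. prob {\<omega>\<in>space M. \<bar>Y (g N) \<omega>\<bar> > C} < \<delta>" by blast
qed

lemma bounded_in_probability_L1:
  assumes i: "\<And>N. integrable M (Y N)" and K: "\<forall>\<^sub>F N in sequentially. expectation (\<lambda>\<omega>. \<bar>Y N \<omega>\<bar>) \<le> K"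
  shows "bounded_in_probability M Y"
  unfolding bounded_in_probability_def
proof (intro allI impI)
  fix \<delta> :: real assume d: "0 < \<delta>"
  \<comment> \<open>The added 1 makes Markov's bound \<open>|K| / C\<close> strictly smaller than
    \<open>\<delta>\<close>.\<close>
  define C where "C = (\<bar>K\<bar> + 1) / \<delta>"
  have C: "0 < C" using d by (simp add: C_def add_nonneg_pos)
  have "\<forall>\<^sub>F N in sequentially. prob {\<omega>\<in>space M. \<bar>Y N \<omega>\<bar> > C} < \<delta>"
    using K
  proof eventually_elim
    case (elim N)
    have [measurable]: "Y N \<in> borel_measurable M" using i[of N] by (rule borel_measurable_integrable)
    have "prob {\<omega>\<in>space M. \<bar>Y N \<omega>\<bar> > C} \<le> prob {\<omega>\<in>space M. \<bar>Y N \<omega>\<bar> \<ge> C}"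
      by (rule finite_measure_mono) (auto, measurable)
    also have "\<dots> \<le> expectation (\<lambda>\<omega>. \<bar>Y N \<omega>\<bar>) / C"
      by (rule integral_Markov_inequality_measure[where A="space M"]) (use i C in auto)
    also have "\<dots> \<le> \<bar>K\<bar> / C" using elim C by (intro divide_right_mono) auto
    also have "\<dots> < \<delta>" unfolding pos_divide_less_eq[OF C] using d by (simp add: C_def)
    finally show ?case .
  qed
  then show "\<exists>C. \<forall>\<^sub>F N in sequentially. prob {\<omega>\<in>space M. \<bar>Y N \<omega>\<bar> > C} < \<delta>" by blast
qed

text \<open>Off two events of small probability \<open>B\<close> and \<open>Q\<close> are bounded by
  constants, and there the null sequence \<open>c\<close> pushes \<open>D\<close> below any
  level.\<close>

lemma vanishing_in_probability:
  fixes D B Q :: "nat \<Rightarrow> 'a \<Rightarrow> real"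
  assumes B: "bounded_in_probability M B" and Q: "bounded_in_probability M Q"
    and [measurable]: "\<And>N. B N \<in> borel_measurable M" "\<And>N. Q N \<in> borel_measurable M"
    and c: "c \<longlonglongrightarrow> 0" and c0: "\<And>N. 0 \<le> c N" and p: "0 \<le> p"
    and le: "\<forall>\<^sub>F N in sequentially. \<forall>\<omega>\<in>space M. \<bar>D N \<omega>\<bar> \<le> c N * (1 + \<bar>B N \<omega>\<bar>) powr p * \<bar>Q N \<omega>\<bar>"
    and e: "0 < (e::real)"
  shows "(\<lambda>N. prob {\<omega>\<in>space M. \<bar>D N \<omega>\<bar> > e}) \<longlonglongrightarrow> 0"
proof (rule LIMSEQ_I)
  fix \<delta> :: real assume d: "0 < \<delta>"
  obtain C where C: "\<forall>\<^sub>F N in sequentially. prob {\<omega>\<in>space M. \<bar>B N \<omega>\<bar> > C} < \<delta> / 2"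
    using B[unfolded bounded_in_probability_def, rule_format, of "\<delta> / 2"] d by auto
  obtain C' where C': "\<forall>\<^sub>F N in sequentially. prob {\<omega>\<in>space M. \<bar>Q N \<omega>\<bar> > C'} < \<delta> / 2"
    using Q[unfolded bounded_in_probability_def, rule_format, of "\<delta> / 2"] d by auto
  have "(\<lambda>N. c N * ((1 + \<bar>C\<bar>) powr p * \<bar>C'\<bar>)) \<longlonglongrightarrow> 0" by (rule tendsto_mult_left_zero[OF c])
  then have small: "\<forall>\<^sub>F N in sequentially. c N * ((1 + \<bar>C\<bar>) powr p * \<bar>C'\<bar>) < e"
    using e by (rule order_tendstoD)
  have "\<forall>\<^sub>F N in sequentially. prob {\<omega>\<in>space M. \<bar>D N \<omega>\<bar> > e} < \<delta>"
    using C C' small le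
  proof eventually_elim
    case (elim N)
    have sub: "{\<omega>\<in>space M. \<bar>D N \<omega>\<bar> > e} \<subseteq> {\<omega>\<in>space M. \<bar>B N \<omega>\<bar> > C} \<union> {\<omega>\<in>space M. \<bar>Q N \<omega>\<bar> > C'}"
    proof (rule subsetI, rule ccontr)
      fix \<omega> assume w: "\<omega> \<in> {\<omega>\<in>space M. \<bar>D N \<omega>\<bar> > e}" "\<omega> \<notin> {\<omega>\<in>space M. \<bar>B N \<omega>\<bar> > C} \<union> {\<omega>\<in>space M. \<bar>Q N \<omega>\<bar> > C'}"
      then have BC: "\<bar>B N \<omega>\<bar> \<le> \<bar>C\<bar>" "\<bar>Q N \<omega>\<bar> \<le> \<bar>C'\<bar>" by auto
      have "\<bar>D N \<omega>\<bar> \<le> c N * (1 + \<bar>B N \<omega>\<bar>) powr p * \<bar>Q N \<omega>\<bar>" using elim w by auto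
      also have "\<dots> \<le> c N * (1 + \<bar>C\<bar>) powr p * \<bar>C'\<bar>"
        using BC c0 p by (intro mult_mono mult_left_mono powr_mono2) auto
      finally show False using w elim by (simp add: mult.assoc)
    qed
    have "prob {\<omega>\<in>space M. \<bar>D N \<omega>\<bar> > e} \<le> prob ({\<omega>\<in>space M. \<bar>B N \<omega>\<bar> > C} \<union> {\<omega>\<in>space M. \<bar>Q N \<omega>\<bar> > C'})"
      by (rule finite_measure_mono[OF sub]) measurable
    also have "\<dots> \<le> prob {\<omega>\<in>space M. \<bar>B N \<omega>\<bar> > C} + prob {\<omega>\<in>space M. \<bar>Q N \<omega>\<bar> > C'}"
      by (rule measure_Un_le) measurable
    finally show ?case using elim by linarith
  qed
  then show "\<exists>no. \<forall>n\<ge>no. norm (prob {\<omega>\<in>space M. \<bar>D n \<omega>\<bar> > e} - 0) < \<delta>"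
    by (simp add: eventually_sequentially)
qed

text \<open>The counterpart of the bound in mean for differences that are small only in probability:
  where they are large, two numbers of modulus 1 still differ by at most 2.\<close>

lemma norm_expectation_iexp_diff_prob:
  assumes [measurable]: "X \<in> borel_measurable M" "Y \<in> borel_measurable M" and e: "0 \<le> e"
  shows "cmod ((CLINT \<omega>|M. iexp (u * X \<omega>)) - (CLINT \<omega>|M. iexp (u * Y \<omega>)))
    \<le> \<bar>u\<bar> * e + 2 * prob {\<omega>\<in>space M. \<bar>X \<omega> - Y \<omega>\<bar> > e}"
proof -
  let ?A = "{\<omega>\<in>space M. \<bar>X \<omega> - Y \<omega>\<bar> > e}"
  have I: "integrable M (\<lambda>\<omega>. iexp (u * X \<omega>))" "integrable M (\<lambda>\<omega>. iexp (u * Y \<omega>))"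
    by (intro integrable_iexp_real assms)+
  have A: "?A \<in> sets M" by measurable
  have J1: "integrable M (indicator ?A :: 'a \<Rightarrow> real)"
    by (rule integrable_real_indicator[OF A]) (simp add: emeasure_eq_measure)
  have "?A \<inter> space M = ?A" by auto
  then have J2: "expectation (indicator ?A) = prob ?A" by simp
  have J: "integrable M (\<lambda>\<omega>. \<bar>u\<bar> * e + 2 * indicator ?A \<omega>)"
    by (intro Bochner_Integration.integrable_add integrable_const integrable_mult_right J1)
  have pt: "cmod (iexp (u * X \<omega>) - iexp (u * Y \<omega>)) \<le> \<bar>u\<bar> * e + 2 * indicator ?A \<omega>" if "\<omega> \<in> space M" for \<omega>
  proof (cases "\<omega> \<in> ?A")
    case True
    have "cmod (iexp (u * X \<omega>) - iexp (u * Y \<omega>)) \<le> cmod (iexp (u * X \<omega>)) + cmod (iexp (u * Y \<omega>))"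
      by (rule norm_triangle_ineq4)
    also have "\<dots> = 2" by (simp only: norm_exp_i_times)
    also have "\<dots> \<le> \<bar>u\<bar> * e + 2 * indicator ?A \<omega>" using True e by simp
    finally show ?thesis .
  next
    case False
    then have "\<bar>X \<omega> - Y \<omega>\<bar> \<le> e" using that by auto
    have "cmod (iexp (u * X \<omega>) - iexp (u * Y \<omega>)) \<le> \<bar>u * X \<omega> - u * Y \<omega>\<bar>" by (rule norm_iexp_diff)
    also have "\<dots> = \<bar>u\<bar> * \<bar>X \<omega> - Y \<omega>\<bar>" by (simp add: abs_mult flip: right_diff_distrib)
    also have "\<dots> \<le> \<bar>u\<bar> * e" using \<open>\<bar>X \<omega> - Y \<omega>\<bar> \<le> e\<close> by (intro mult_left_mono) auto
    finally show ?thesis using False by simp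
  qed
  have "cmod ((CLINT \<omega>|M. iexp (u * X \<omega>)) - (CLINT \<omega>|M. iexp (u * Y \<omega>)))
    = cmod (CLINT \<omega>|M. iexp (u * X \<omega>) - iexp (u * Y \<omega>))"
    by (simp only: Bochner_Integration.integral_diff[OF I])
  also have "\<dots> \<le> expectation (\<lambda>\<omega>. cmod (iexp (u * X \<omega>) - iexp (u * Y \<omega>)))" by (rule integral_norm_bound)
  also have "\<dots> \<le> expectation (\<lambda>\<omega>. \<bar>u\<bar> * e + 2 * indicator ?A \<omega>)"
    by (rule integral_mono[OF integrable_norm[OF Bochner_Integration.integrable_diff[OF I]] J pt])
  also have "\<dots> = \<bar>u\<bar> * e + 2 * prob ?A"
    by (subst Bochner_Integration.integral_add[OF integrable_const integrable_mult_right[OF J1]])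
      (simp only: integral_mult_right_zero J2 lebesgue_integral_const prob_space scaleR_one)
  finally show ?thesis .
qed

lemma iexp_limit_transfer:
  assumes m: "\<And>N. X N \<in> borel_measurable M" "\<And>N. Y N \<in> borel_measurable M"
    and XY: "\<And>e. 0 < e \<Longrightarrow> (\<lambda>N. prob {\<omega>\<in>space M. \<bar>X N \<omega> - Y N \<omega>\<bar> > e}) \<longlonglongrightarrow> 0"
    and Y: "(\<lambda>N. CLINT \<omega>|M. iexp (u * Y N \<omega>)) \<longlonglongrightarrow> c"
  shows "(\<lambda>N. CLINT \<omega>|M. iexp (u * X N \<omega>)) \<longlonglongrightarrow> c"
proof -
  have "(\<lambda>N. (CLINT \<omega>|M. iexp (u * X N \<omega>)) - (CLINT \<omega>|M. iexp (u * Y N \<omega>))) \<longlonglongrightarrow> 0"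
  proof (rule LIMSEQ_I)
    fix \<delta> :: real assume d: "0 < \<delta>"
    define e where "e = \<delta> / 2 / (\<bar>u\<bar> + 1)"
    have u1: "0 < \<bar>u\<bar> + 1" by linarith
    have e0: "0 < e" using d u1 by (simp add: e_def)
    have "\<bar>u\<bar> * e \<le> (\<bar>u\<bar> + 1) * e" using e0 by (intro mult_right_mono) auto
    also have "\<dots> = \<delta> / 2"
      using u1 unfolding e_def by (metis less_irrefl nonzero_mult_div_cancel_left times_divide_eq_right)
    finally have e: "0 < e" "\<bar>u\<bar> * e \<le> \<delta> / 2" using e0 by auto
    have "\<forall>\<^sub>F N in sequentially. prob {\<omega>\<in>space M. \<bar>X N \<omega> - Y N \<omega>\<bar> > e} < \<delta> / 4"
      using XY[OF e(1)] d by (intro order_tendstoD) auto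
    then have "\<forall>\<^sub>F N in sequentially. norm ((CLINT \<omega>|M. iexp (u * X N \<omega>)) - (CLINT \<omega>|M. iexp (u * Y N \<omega>)) - 0) < \<delta>"
    proof eventually_elim
      case (elim N)
      show ?case using norm_expectation_iexp_diff_prob[OF m(1) m(2) less_imp_le[OF e(1)], of u N N] elim e(2) by simp
    qed
    then show "\<exists>no. \<forall>N\<ge>no. norm ((CLINT \<omega>|M. iexp (u * X N \<omega>)) - (CLINT \<omega>|M. iexp (u * Y N \<omega>)) - 0) < \<delta>"
      by (simp only: eventually_sequentially)
  qed
  from tendsto_add[OF this Y] show ?thesis by simp
qed

end

text \<open>When \<open>m N\<close> lies between \<open>N / 4\<close> and \<open>N\<close>,
  \<open>ln (m N)\<close> differs from \<open>ln N\<close> by at most \<open>ln 4\<close>, and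
  \<open>harm (m N)\<close> from \<open>ln (m N)\<close> by a bounded amount. Since \<open>u\<close>
  tends to 0, centring by \<open>ln N\<close> is as good as the exact mean, and the scale may be
  written with \<open>ln N\<close>.\<close>

lemma comparable_index_limits:
  fixes m :: "nat \<Rightarrow> nat" and t a b :: real
  assumes m: "\<forall>\<^sub>F N in sequentially. real N / 4 \<le> real (m N) \<and> m N \<le> N" and a: "0 < a"
  defines "u \<equiv> \<lambda>N::nat. t * sqrt (1 / (4 * a * ln (real N)))"
  shows "filterlim m at_top sequentially"
    and "(\<lambda>N. u N * sqrt (ln (real (m N)))) \<longlonglongrightarrow> t / sqrt (4 * a)"
    and "(\<lambda>N. u N * (b * harm (m N) - b * ln (real N))) \<longlonglongrightarrow> 0"
proof -
  have "filterlim (\<lambda>N::nat. real N / 4) at_top sequentially" by real_asymp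
  then have "filterlim (\<lambda>N. real (m N)) at_top sequentially"
    by (rule filterlim_at_top_mono) (use m in \<open>auto elim: eventually_mono\<close>)
  then show top: "filterlim m at_top sequentially" by (rule filterlim_sequentially_iff_filterlim_real[THEN iffD2])
  have bounds: "\<forall>\<^sub>F N in sequentially. 2 \<le> N \<and> 0 < ln (real N) \<and> 1 \<le> m N \<and> ln (real N) - ln 4 \<le> ln (real (m N)) \<and> ln (real (m N)) \<le> ln (real N)"
    using m eventually_ge_at_top[of 5]
  proof eventually_elim
    case (elim N)
    then have N: "5 \<le> real N" by linarith
    have mN: "0 < real N / 4" "real N / 4 \<le> real (m N)" "real (m N) \<le> real N" using N elim by auto
    then have "ln (real N / 4) \<le> ln (real (m N))" by (intro ln_mono) auto
    moreover have "ln (real (m N)) \<le> ln (real N)" using mN by (intro ln_mono) auto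
    moreover have "ln (real N / 4) = ln (real N) - ln 4" using N by (simp add: ln_div)
    moreover have "0 < m N" using mN by (metis of_nat_0_less_iff less_le_trans)
    ultimately show ?case using N elim by simp
  qed
  have ratio: "(\<lambda>N. ln (real (m N)) / ln (real N)) \<longlonglongrightarrow> 1"
  proof (rule real_tendsto_sandwich)
    show "(\<lambda>N::nat. (ln (real N) - ln 4) / ln (real N)) \<longlonglongrightarrow> 1" by real_asymp
    show "(\<lambda>N::nat. 1::real) \<longlonglongrightarrow> 1" by simp
    show "\<forall>\<^sub>F N in sequentially. (ln (real N) - ln 4) / ln (real N) \<le> ln (real (m N)) / ln (real N)"
      using bounds by eventually_elim (auto intro: divide_right_mono)
    show "\<forall>\<^sub>F N in sequentially. ln (real (m N)) / ln (real N) \<le> 1"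
      using bounds by eventually_elim auto
  qed
  have "(\<lambda>N. t / sqrt (4 * a) * sqrt (ln (real (m N)) / ln (real N))) \<longlonglongrightarrow> t / sqrt (4 * a) * sqrt 1"
    by (intro tendsto_intros ratio)
  moreover have "t / sqrt (4 * a) * sqrt (ln (real (m N)) / ln (real N)) = u N * sqrt (ln (real (m N)))" for N
    by (simp add: u_def real_sqrt_divide real_sqrt_mult)
  ultimately show "(\<lambda>N. u N * sqrt (ln (real (m N)))) \<longlonglongrightarrow> t / sqrt (4 * a)" by simp
  have v0: "(\<lambda>N::nat. sqrt (1 / (4 * a * ln (real N)))) \<longlonglongrightarrow> 0"
  proof -
    have "(\<lambda>N::nat. 1 / (4 * a) * (1 / ln (real N))) \<longlonglongrightarrow> 1 / (4 * a) * 0"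
      by (intro tendsto_mult tendsto_const) real_asymp
    then have "(\<lambda>N::nat. 1 / (4 * a * ln (real N))) \<longlonglongrightarrow> 0" by simp
    from tendsto_real_sqrt[OF this] show ?thesis by simp
  qed
  have u0: "u \<longlonglongrightarrow> 0" unfolding u_def by (rule tendsto_mult_right_zero[OF v0])
  have h: "(\<lambda>N. harm (m N) - ln (real (m N)) :: real) \<longlonglongrightarrow> euler_mascheroni"
    by (rule filterlim_compose[OF euler_mascheroni_LIMSEQ top])
  have 1: "(\<lambda>N. u N * (b * (harm (m N) - ln (real (m N))))) \<longlonglongrightarrow> 0 * (b * euler_mascheroni)"
    by (intro tendsto_mult u0 tendsto_const h)
  have 2: "(\<lambda>N. u N * (b * (ln (real (m N)) - ln (real N)))) \<longlonglongrightarrow> 0"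
  proof (rule Lim_null_comparison)
    show "\<forall>\<^sub>F N in sequentially. norm (u N * (b * (ln (real (m N)) - ln (real N)))) \<le> \<bar>u N\<bar> * (\<bar>b\<bar> * ln 4)"
      using bounds
    proof eventually_elim
      case (elim N)
      then have "\<bar>ln (real (m N)) - ln (real N)\<bar> \<le> ln 4" by linarith
      then show ?case unfolding real_norm_def abs_mult by (intro mult_left_mono) auto
    qed
    show "(\<lambda>N. \<bar>u N\<bar> * (\<bar>b\<bar> * ln 4)) \<longlonglongrightarrow> 0" by (rule tendsto_mult_left_zero[OF tendsto_rabs_zero[OF u0]])
  qed
  have "(\<lambda>N. u N * (b * (harm (m N) - ln (real (m N)))) + u N * (b * (ln (real (m N)) - ln (real N)))) \<longlonglongrightarrow> 0 + 0"
    using 1 2 by (intro tendsto_add) simp_all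
  then show "(\<lambda>N. u N * (b * harm (m N) - b * ln (real N))) \<longlonglongrightarrow> 0" by (simp add: algebra_simps)
qed

text \<open>Each normalised value is standard normal, so all terms share one moment and the
  expectation is governed by the sum of the error weights.\<close>

lemma (in prob_space) err_sum_L1:
  fixes x :: "nat \<Rightarrow> 'a \<Rightarrow> real"
  assumes x: "\<And>k. k \<in> {1..<Suc m} \<Longrightarrow> distributed M lborel (\<lambda>\<omega>. x k \<omega> / sqrt k) std_normal_density"
    and p: "1 \<le> p"
  shows "integrable M (\<lambda>\<omega>. \<Sum>k\<in>{1..<Suc m}. err_weight z N k / k * (1 + \<bar>x k \<omega> / sqrt k\<bar>) powr p)"
    and "expectation (\<lambda>\<omega>. \<Sum>k\<in>{1..<Suc m}. err_weight z N k / k * (1 + \<bar>x k \<omega> / sqrt k\<bar>) powr p)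
      = (\<Sum>k\<in>{1..<Suc m}. err_weight z N k / k) * (\<integral>x. (1 + \<bar>x\<bar>) powr p \<partial>\<N>)"
proof -
  have iN: "integrable \<N> (\<lambda>x. (1 + \<bar>x\<bar>) powr p)"
  proof (rule Bochner_Integration.integrable_bound)
    show "integrable \<N> (\<lambda>x. 2 powr p * (1 powr p + \<bar>x\<bar> powr p))"
      using integrable_std_normal_powr[of p] p by simp
    have "(1 + \<bar>x\<bar>) powr p \<le> 2 powr p * (1 powr p + \<bar>x\<bar> powr p)" for x :: real
      using p by (intro add_powr_le) auto
    then show "AE x in \<N>. norm ((1 + \<bar>x\<bar>) powr p) \<le> norm (2 powr p * (1 powr p + \<bar>x\<bar> powr p))"
      by (intro AE_I2) simp
  qed simp
  have i: "integrable M (\<lambda>\<omega>. err_weight z N k / k * (1 + \<bar>x k \<omega> / sqrt k\<bar>) powr p)"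
    and e: "expectation (\<lambda>\<omega>. err_weight z N k / k * (1 + \<bar>x k \<omega> / sqrt k\<bar>) powr p) = err_weight z N k / k * (\<integral>x. (1 + \<bar>x\<bar>) powr p \<partial>\<N>)"
    if "k \<in> {1..<Suc m}" for k
    using std_normal_transfer[OF x[OF that], of "\<lambda>x. (1 + \<bar>x\<bar>) powr p"] iN
    by (simp_all del: abs_divide)
  show "integrable M (\<lambda>\<omega>. \<Sum>k\<in>{1..<Suc m}. err_weight z N k / k * (1 + \<bar>x k \<omega> / sqrt k\<bar>) powr p)"
    by (intro Bochner_Integration.integrable_sum i)
  show "expectation (\<lambda>\<omega>. \<Sum>k\<in>{1..<Suc m}. err_weight z N k / k * (1 + \<bar>x k \<omega> / sqrt k\<bar>) powr p)
      = (\<Sum>k\<in>{1..<Suc m}. err_weight z N k / k) * (\<integral>x. (1 + \<bar>x\<bar>) powr p \<partial>\<N>)"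
    unfolding sum_distrib_right by (subst Bochner_Integration.integral_sum) (auto simp only: i e intro!: sum.cong)
qed

text \<open>The midpoint of an even \<open>N\<close> belongs to the first half, as in the ranges of
  the two approximations: \<open>k \<le> N / 2\<close> on the left, and
  \<open>N - k < N / 2\<close>, that is at most \<open>(N - 1) div 2\<close>, on the right. For
  \<open>N = 1\<close> all sums are empty.\<close>

lemma sum_split_halves:
  fixes f :: "nat \<Rightarrow> real"
  assumes N: "1 \<le> N"
  shows "(\<Sum>k\<in>{1..<N}. f k) = (\<Sum>k\<in>{1..<Suc (N div 2)}. f k) + (\<Sum>j\<in>{1..<Suc ((N - 1) div 2)}. f (N - j))"
proof -
  have "(\<Sum>k\<in>{1..<N}. f k) = (\<Sum>k\<in>{1..<Suc (N div 2)} \<inter> {1..<N}. f k) + (\<Sum>k\<in>{Suc (N div 2)..<N}. f k)"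
    by (subst sum.union_disjoint[symmetric]) (auto intro!: sum.cong)
  also have "(\<Sum>k\<in>{Suc (N div 2)..<N}. f k) = (\<Sum>j\<in>{1..<Suc ((N - 1) div 2)}. f (N - j))"
    by (rule sum.reindex_bij_witness[of _ "\<lambda>j. N - j" "\<lambda>k. N - k"]) auto
  also have "(\<Sum>k\<in>{1..<Suc (N div 2)} \<inter> {1..<N}. f k) = (\<Sum>k\<in>{1..<Suc (N div 2)}. f k)"
  proof (cases "N = 1")
    case False
    then have "{1..<Suc (N div 2)} \<inter> {1..<N} = {1..<Suc (N div 2)}" using N by auto
    then show ?thesis by simp
  qed simp
  finally show ?thesis .
qed

lemma cusum_at_shift:
  assumes "1 \<le> N" "k \<le> N"
  shows "cusum_at (\<lambda>i. c + e i) N k = cusum_at e N k"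
  using assms by (simp add: cusum_at_def sum.distrib algebra_simps)

lemma (in prob_space) walk_pow_sum_measurable:
  assumes "\<And>k. k \<in> {1..<Suc m} \<Longrightarrow> W k \<in> borel_measurable M"
  shows "(\<lambda>\<omega>. walk_pow_sum p m (\<lambda>k. W k \<omega>)) \<in> borel_measurable M"
  unfolding walk_pow_sum_def
proof (rule borel_measurable_sum)
  fix k assume "k \<in> {1..<Suc m}"
  then have [measurable]: "W k \<in> borel_measurable M" by (rule assms)
  show "(\<lambda>\<omega>. \<bar>W k \<omega> / sqrt (real k)\<bar> powr p / real k) \<in> borel_measurable M" by measurable
qed

lemma (in prob_space) indep_walk_pow_sums:
  assumes ind: "indep_processes_on M T V W" and m: "real m \<le> T" "real m' \<le> T"
  shows "indep_var borel (\<lambda>\<omega>. walk_pow_sum p m (\<lambda>k. V (real k) \<omega>) - d) borel (\<lambda>\<omega>. walk_pow_sum p m' (\<lambda>k. W (real k) \<omega>) - d)"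
proof -
  have meas: "(\<lambda>x. walk_pow_sum p n (\<lambda>k. x (real k)) - d) \<in> borel_measurable (PiM {0..T} (\<lambda>_. borel))" if n: "real n \<le> T" for n
  proof -
    have "(\<lambda>x. walk_pow_sum p n (\<lambda>k. x (real k))) \<in> borel_measurable (PiM {0..T} (\<lambda>_. borel))"
      unfolding walk_pow_sum_def
    proof (rule borel_measurable_sum)
      fix k assume "k \<in> {1..<Suc n}"
      then have [measurable]: "(\<lambda>x. x (real k)) \<in> borel_measurable (PiM {0..T} (\<lambda>_. borel :: real measure))"
        using n by (intro measurable_component_singleton) auto
      show "(\<lambda>x. \<bar>x (real k) / sqrt (real k)\<bar> powr p / real k) \<in> borel_measurable (PiM {0..T} (\<lambda>_. borel))" by measurable
    qed
    then show ?thesis by measurable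
  qed
  have restr: "walk_pow_sum p n (\<lambda>k. (\<lambda>t\<in>{0..T}. f t) (real k)) = walk_pow_sum p n (\<lambda>k. f (real k))" if "real n \<le> T" for n f
    unfolding walk_pow_sum_def using that by (intro sum.cong refl) auto
  show ?thesis
    using indep_var_compose[OF ind[unfolded indep_processes_on_def] meas[OF m(1)] meas[OF m(2)]]
    by (simp only: comp_def restr[OF m(1)] restr[OF m(2)])
qed

section \<open>Assembly of both ends for the CUSUM process\<close>

theorem theorem1p2:
  fixes M :: "'a measure"
    and X \<epsilon> :: "nat \<Rightarrow> 'a \<Rightarrow> real"
    and W1 W2 :: "nat \<Rightarrow> real \<Rightarrow> 'a \<Rightarrow> real"
    and p \<mu>\<^sub>0 \<sigma> \<zeta> :: real
  assumes "prob_space M"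
    and "p \<ge> 1"
    and "\<And>i \<omega>. i \<ge> 1 \<Longrightarrow> \<omega> \<in> space M \<Longrightarrow> X i \<omega> = \<mu>\<^sub>0 + \<epsilon> i \<omega>"
    and "\<And>i. i \<ge> 1 \<Longrightarrow> integrable M (\<epsilon> i)"
    and "\<And>i. i \<ge> 1 \<Longrightarrow> integral\<^sup>L M (\<epsilon> i) = 0"
    and "\<sigma> > 0"
    and "\<zeta> < 1/2"
    and "\<And>N. N \<ge> 1 \<Longrightarrow> wiener_process_on M (real N / 2) (W1 N)"
    and "\<And>N. N \<ge> 1 \<Longrightarrow> wiener_process_on M (real N / 2) (W2 N)"
    and "\<And>N. N \<ge> 1 \<Longrightarrow> indep_processes_on M (real N / 2) (W1 N) (W2 N)"
    and "bounded_in_probability M (\<lambda>N \<omega>.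
           SUP k\<in>{k::nat. 1 \<le> k \<and> real k \<le> real N / 2}.
             real k powr (-\<zeta>) * \<bar>(\<Sum>i=1..k. \<epsilon> i \<omega>) - \<sigma> * W1 N (real k) \<omega>\<bar>)"
    and "bounded_in_probability M (\<lambda>N \<omega>.
           SUP k\<in>{k::nat. real N / 2 < real k \<and> k < N}.
             real (N - k) powr (-\<zeta>) * \<bar>(\<Sum>i=k+1..N. \<epsilon> i \<omega>) - \<sigma> * W2 N (real (N - k)) \<omega>\<bar>)"
  shows "weak_conv_m
           (\<lambda>N. distr M borel (\<lambda>\<omega>.
              sqrt (1 / (4 * a_const p * ln (real N))) *
              (1 / \<sigma> powr p *
                 (LBINT t:{0..1}. \<bar>cusum_process (\<lambda>i. X i \<omega>) N t\<bar> powr p / (t * (1 - t)) powr (1 + p/2))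
               - 2 * b_const p * ln (real N))))
           std_normal_distribution"
proof -
  interpret prob_space M by fact
  note p = assms(2) and X = assms(3) and \<sigma> = assms(6) and \<zeta> = assms(7)
    and W1 = assms(8) and W2 = assms(9)
  have \<epsilon>_meas [measurable]: "\<epsilon> i \<in> borel_measurable M" if "i \<ge> 1" for i
    using assms(4)[OF that] by (rule borel_measurable_integrable)
  define S where "S = (\<lambda>k \<omega>. \<Sum>i=1..k. \<epsilon> i \<omega>)"
  define I1 I2 where "I1 = (\<lambda>N::nat. {k::nat. 1 \<le> k \<and> real k \<le> real N / 2})"
    and "I2 = (\<lambda>N::nat. {k::nat. real N / 2 < real k \<and> k < N})"
  define A1 where "A1 = (\<lambda>N \<omega>. SUP k\<in>I1 N. real k powr (-\<zeta>) * \<bar>S k \<omega> - \<sigma> * W1 N (real k) \<omega>\<bar>)"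
  define A2 where "A2 = (\<lambda>N \<omega>. SUP k\<in>I2 N. real (N - k) powr (-\<zeta>) * \<bar>(\<Sum>i=k+1..N. \<epsilon> i \<omega>) - \<sigma> * W2 N (real (N - k)) \<omega>\<bar>)"
  have bA: "bounded_in_probability M A1" "bounded_in_probability M A2"
    using assms(11,12) unfolding A1_def A2_def I1_def I2_def S_def by simp_all
  have S_meas [measurable]: "S k \<in> borel_measurable M" for k
    unfolding S_def by (intro borel_measurable_sum \<epsilon>_meas) auto
  have W1_meas: "W1 N s \<in> borel_measurable M" if "1 \<le> N" "0 \<le> s" "s \<le> real N / 2" for N s
    using W1[OF that(1)] that by (auto simp: wiener_process_on_def)
  have W2_meas: "W2 N s \<in> borel_measurable M" if "1 \<le> N" "0 \<le> s" "s \<le> real N / 2" for N s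
    using W2[OF that(1)] that by (auto simp: wiener_process_on_def)
  have fin: "finite (I1 N)" "finite (I2 N)" for N
  proof -
    have "I1 N \<subseteq> {..N}" unfolding I1_def by auto
    then show "finite (I1 N)" by (rule finite_subset) simp
    have "I2 N \<subseteq> {..N}" unfolding I2_def by auto
    then show "finite (I2 N)" by (rule finite_subset) simp
  qed
  have A1_meas [measurable]: "A1 N \<in> borel_measurable M" for N
    unfolding A1_def
  proof (rule borel_measurable_cSUP)
    fix k assume k: "k \<in> I1 N"
    then have [measurable]: "W1 N (real k) \<in> borel_measurable M" by (intro W1_meas) (auto simp: I1_def)
    show "(\<lambda>\<omega>. real k powr (-\<zeta>) * \<bar>S k \<omega> - \<sigma> * W1 N (real k) \<omega>\<bar>) \<in> borel_measurable M" by measurable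
  qed (auto intro!: bdd_above_finite fin countable_finite)
  have A2_meas [measurable]: "A2 N \<in> borel_measurable M" for N
    unfolding A2_def
  proof (rule borel_measurable_cSUP)
    fix k assume k: "k \<in> I2 N"
    then have [measurable]: "W2 N (real (N - k)) \<in> borel_measurable M" by (intro W2_meas) (auto simp: I2_def)
    have [measurable]: "(\<lambda>\<omega>. \<Sum>i=k+1..N. \<epsilon> i \<omega>) \<in> borel_measurable M" by (intro borel_measurable_sum \<epsilon>_meas) auto
    show "(\<lambda>\<omega>. real (N - k) powr (-\<zeta>) * \<bar>(\<Sum>i=k+1..N. \<epsilon> i \<omega>) - \<sigma> * W2 N (real (N - k)) \<omega>\<bar>) \<in> borel_measurable M"
      by measurable
  qed (auto intro!: bdd_above_finite fin countable_finite)
  have scaled: "s \<le> a * real k powr \<zeta>" if "1 \<le> k" "real k powr (-\<zeta>) * s \<le> a" for s a and k :: nat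
  proof -
    have "real k powr \<zeta> * (real k powr (-\<zeta>) * s) \<le> real k powr \<zeta> * a" using that by (intro mult_left_mono) auto
    moreover have "real k powr \<zeta> * real k powr (-\<zeta>) = 1" using that by (simp flip: powr_add)
    ultimately show ?thesis by (metis mult.assoc mult.commute mult_1)
  qed
  have A1_bound: "\<bar>S k \<omega> - \<sigma> * W1 N (real k) \<omega>\<bar> \<le> \<bar>A1 N \<omega>\<bar> * real k powr \<zeta>" if "k \<in> I1 N" for N k \<omega>
  proof (rule scaled)
    have "real k powr (-\<zeta>) * \<bar>S k \<omega> - \<sigma> * W1 N (real k) \<omega>\<bar> \<le> A1 N \<omega>"
      unfolding A1_def by (rule cSUP_upper[OF that]) (intro bdd_above_finite finite_imageI fin)
    then show "real k powr (-\<zeta>) * \<bar>S k \<omega> - \<sigma> * W1 N (real k) \<omega>\<bar> \<le> \<bar>A1 N \<omega>\<bar>" by linarith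
  qed (use that in \<open>auto simp: I1_def\<close>)
  have A2_bound: "\<bar>(S N \<omega> - S k \<omega>) - \<sigma> * W2 N (real (N - k)) \<omega>\<bar> \<le> \<bar>A2 N \<omega>\<bar> * real (N - k) powr \<zeta>" if "k \<in> I2 N" for N k \<omega>
  proof (rule scaled)
    have kN: "k < N" using that by (simp add: I2_def)
    have "(\<Sum>i=1..N. \<epsilon> i \<omega>) = (\<Sum>i=1..k. \<epsilon> i \<omega>) + (\<Sum>i=k+1..N. \<epsilon> i \<omega>)"
      using kN sum.atLeastLessThan_concat[of 1 "Suc k" "Suc N" "\<lambda>i. \<epsilon> i \<omega>"]
      by (simp add: atLeastLessThanSuc_atLeastAtMost)
    then have eq: "S N \<omega> - S k \<omega> = (\<Sum>i=k+1..N. \<epsilon> i \<omega>)" by (simp add: S_def)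
    have "real (N - k) powr (-\<zeta>) * \<bar>(\<Sum>i=k+1..N. \<epsilon> i \<omega>) - \<sigma> * W2 N (real (N - k)) \<omega>\<bar> \<le> A2 N \<omega>"
      unfolding A2_def by (rule cSUP_upper[OF that]) (intro bdd_above_finite finite_imageI fin)
    then show "real (N - k) powr (-\<zeta>) * \<bar>(S N \<omega> - S k \<omega>) - \<sigma> * W2 N (real (N - k)) \<omega>\<bar> \<le> \<bar>A2 N \<omega>\<bar>" unfolding eq by linarith
    show "1 \<le> N - k" using kN by simp
  qed

  \<comment> \<open>A bound for the sum of all \<open>N\<close> errors relative to
    \<open>sqrt N\<close>. The index \<open>k = N\<close> is outside the ranges available at
    \<open>N\<close> but is the last one of the first range at \<open>2 * N\<close>; this works
    because the error sequence does not depend on \<open>N\<close>.\<close>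
  define R where "R = (\<lambda>N \<omega>. \<sigma> * \<bar>W1 (2 * N) (real N) \<omega> / sqrt N\<bar> + \<bar>A1 (2 * N) \<omega>\<bar>)"
  have S_R: "\<bar>S N \<omega>\<bar> \<le> R N \<omega> * sqrt N" if N: "1 \<le> N" for N \<omega>
  proof -
    have "N \<in> I1 (2 * N)" using N by (simp add: I1_def)
    from A1_bound[OF this, of \<omega>]
    have "\<bar>S N \<omega>\<bar> \<le> \<sigma> * \<bar>W1 (2 * N) (real N) \<omega>\<bar> + \<bar>A1 (2 * N) \<omega>\<bar> * real N powr \<zeta>"
      using \<sigma> abs_triangle_ineq2[of "S N \<omega>" "\<sigma> * W1 (2 * N) (real N) \<omega>"] by (simp add: abs_mult)
    also have "real N powr \<zeta> \<le> sqrt N"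
      using N \<zeta> by (subst powr_half_sqrt[symmetric]) (auto intro!: powr_mono)
    also have "\<bar>W1 (2 * N) (real N) \<omega>\<bar> = \<bar>W1 (2 * N) (real N) \<omega> / sqrt N\<bar> * sqrt N" using N by (simp add: abs_divide)
    finally show ?thesis using N by (simp add: R_def distrib_right mult_left_mono mult.assoc)
  qed
  have W1_std: "distributed M lborel (\<lambda>\<omega>. W1 N (real k) \<omega> / sqrt k) std_normal_density" if "1 \<le> k" "2 * k \<le> N" for N k
    by (rule wiener_std_normal[OF W1]) (use that in auto)
  have W2_std: "distributed M lborel (\<lambda>\<omega>. W2 N (real k) \<omega> / sqrt k) std_normal_density" if "1 \<le> k" "2 * k \<le> N" for N k
    by (rule wiener_std_normal[OF W2]) (use that in auto)
  have R_meas [measurable]: "R N \<in> borel_measurable M" for N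
  \<comment> \<open>The hypotheses say nothing about \<open>W1 0\<close>. Here the quotient by
    \<open>sqrt 0\<close> is 0, and below \<open>Z\<close> is set to 0 at this index.\<close>
  proof (cases "N = 0")
    case False
    then have [measurable]: "W1 (2 * N) (real N) \<in> borel_measurable M" by (intro W1_meas) auto
    show ?thesis unfolding R_def by measurable
  qed (simp add: R_def)
  have bR: "bounded_in_probability M R"
  proof -
    define Z where "Z = (\<lambda>N \<omega>. if N = 0 then 0 else \<sigma> * \<bar>W1 (2 * N) (real N) \<omega> / sqrt N\<bar>)"
    have i: "integrable M (Z N)" "expectation (\<lambda>\<omega>. \<bar>Z N \<omega>\<bar>) \<le> \<sigma> * (\<integral>x. \<bar>x\<bar> \<partial>\<N>)" for N
    proof -
      have iN: "integrable \<N> (\<lambda>x. \<bar>x\<bar>)" using integrable_std_normal_powr[of 1] by simp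
      have "integrable M (Z N) \<and> expectation (\<lambda>\<omega>. \<bar>Z N \<omega>\<bar>) \<le> \<sigma> * (\<integral>x. \<bar>x\<bar> \<partial>\<N>)"
      proof (cases "N = 0")
        case False
        then have s: "distributed M lborel (\<lambda>\<omega>. W1 (2 * N) (real N) \<omega> / sqrt N) std_normal_density" by (intro W1_std) auto
        show ?thesis using std_normal_transfer[OF s, of "\<lambda>x. \<bar>x\<bar>"] iN False \<sigma> by (simp add: Z_def abs_mult del: abs_divide)
      qed (use \<sigma> in \<open>simp add: Z_def\<close>)
      then show "integrable M (Z N)" "expectation (\<lambda>\<omega>. \<bar>Z N \<omega>\<bar>) \<le> \<sigma> * (\<integral>x. \<bar>x\<bar> \<partial>\<N>)" by auto
    qed
    have bZ: "bounded_in_probability M Z" by (rule bounded_in_probability_L1[OF i(1)]) (auto intro: i(2) always_eventually)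
    have [measurable]: "Z N \<in> borel_measurable M" for N using i(1) by (rule borel_measurable_integrable)
    have "filterlim (\<lambda>N::nat. 2 * N) at_top sequentially"
      by (rule filterlim_at_top_mono[OF filterlim_ident]) (simp add: always_eventually)
    then have bA2: "bounded_in_probability M (\<lambda>N. A1 (2 * N))" by (rule bounded_in_probability_subseq[OF bA(1)])
    have "bounded_in_probability M (\<lambda>N \<omega>. \<bar>A1 (2 * N) \<omega>\<bar>)"
      by (rule bounded_in_probability_mono[OF bA2]) auto
    then have "bounded_in_probability M (\<lambda>N \<omega>. Z N \<omega> + \<bar>A1 (2 * N) \<omega>\<bar>)"
      by (intro bounded_in_probability_add bZ) auto
    then show ?thesis
    proof (rule bounded_in_probability_mono)
      show "(\<lambda>\<omega>. Z N \<omega> + \<bar>A1 (2 * N) \<omega>\<bar>) \<in> borel_measurable M" for N by measurable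
      show "\<forall>\<^sub>F N in sequentially. \<forall>\<omega>\<in>space M. \<bar>R N \<omega>\<bar> \<le> \<bar>Z N \<omega> + \<bar>A1 (2 * N) \<omega>\<bar>\<bar>"
        by (rule eventually_mono[OF eventually_ge_at_top[of 1]]) (auto simp: R_def Z_def)
    qed
  qed
  have R0: "0 \<le> R N \<omega>" for N \<omega> using \<sigma> by (simp add: R_def)
  \<comment> \<open>One random constant for both halves, already divided by \<open>\<sigma>\<close>,
    so that each term can be compared with the standard Wiener processes.\<close>
  define B where "B = (\<lambda>N \<omega>. (\<bar>A1 N \<omega>\<bar> + \<bar>A2 N \<omega>\<bar> + R N \<omega>) * (1 / \<sigma>))"
  have B0: "0 \<le> B N \<omega>" for N \<omega> using \<sigma> R0 by (simp add: B_def)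
  have B_meas [measurable]: "B N \<in> borel_measurable M" for N unfolding B_def by measurable
  have bB: "bounded_in_probability M B"
  proof -
    have "bounded_in_probability M (\<lambda>N \<omega>. \<bar>A1 N \<omega>\<bar>)" "bounded_in_probability M (\<lambda>N \<omega>. \<bar>A2 N \<omega>\<bar>)"
      by (rule bounded_in_probability_mono[OF bA(1)] bounded_in_probability_mono[OF bA(2)]; auto)+
    then have s: "bounded_in_probability M (\<lambda>N \<omega>. \<bar>A1 N \<omega>\<bar> + \<bar>A2 N \<omega>\<bar> + R N \<omega>)"
      by (intro bounded_in_probability_add bR) auto
    show ?thesis
      unfolding bounded_in_probability_def
    proof (intro allI impI)
      fix \<delta> :: real assume "0 < \<delta>"
      then obtain C where C: "\<forall>\<^sub>F N in sequentially. prob {\<omega>\<in>space M. \<bar>\<bar>A1 N \<omega>\<bar> + \<bar>A2 N \<omega>\<bar> + R N \<omega>\<bar> > C} < \<delta>"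
        using s unfolding bounded_in_probability_def by blast
      have "\<bar>B N \<omega>\<bar> > C * (1 / \<sigma>) \<longleftrightarrow> \<bar>\<bar>A1 N \<omega>\<bar> + \<bar>A2 N \<omega>\<bar> + R N \<omega>\<bar> > C" for N \<omega>
        using \<sigma> by (simp add: B_def abs_divide divide_less_cancel)
      then show "\<exists>C. \<forall>\<^sub>F N in sequentially. prob {\<omega>\<in>space M. \<bar>B N \<omega>\<bar> > C} < \<delta>"
        using C by (intro exI[of _ "C * (1 / \<sigma>)"]) simp
    qed
  qed

  define m1 m2 where "m1 = (\<lambda>N::nat. N div 2)" and "m2 = (\<lambda>N::nat. (N - 1) div 2)"
  define T1 where "T1 = (\<lambda>N \<omega>. walk_pow_sum p (m1 N) (\<lambda>k. W1 N (real k) \<omega>))"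
  define T2 where "T2 = (\<lambda>N \<omega>. walk_pow_sum p (m2 N) (\<lambda>k. W2 N (real k) \<omega>))"
  have m12: "2 * k \<le> N" if "k \<in> {1..<Suc (m1 N)} \<or> k \<in> {1..<Suc (m2 N)}" for k N using that by (auto simp: m1_def m2_def)
  have T1_meas [measurable]: "T1 N \<in> borel_measurable M" for N
    unfolding T1_def
  proof (rule walk_pow_sum_measurable)
    fix k assume "k \<in> {1..<Suc (m1 N)}"
    then show "W1 N (real k) \<in> borel_measurable M" using m12[of k N] by (intro W1_meas) auto
  qed
  have T2_meas [measurable]: "T2 N \<in> borel_measurable M" for N
    unfolding T2_def
  proof (rule walk_pow_sum_measurable)
    fix k assume "k \<in> {1..<Suc (m2 N)}"
    then show "W2 N (real k) \<in> borel_measurable M" using m12[of k N] by (intro W2_meas) auto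
  qed
  define Q1 where "Q1 = (\<lambda>N \<omega>. \<Sum>k\<in>{1..<Suc (m1 N)}. err_weight \<zeta> N k / k * (1 + \<bar>W1 N (real k) \<omega> / sqrt k\<bar>) powr p)"
  define Q2 where "Q2 = (\<lambda>N \<omega>. \<Sum>k\<in>{1..<Suc (m2 N)}. err_weight \<zeta> N k / k * (1 + \<bar>W2 N (real k) \<omega> / sqrt k\<bar>) powr p)"
  have Q0: "0 \<le> Q1 N \<omega>" "0 \<le> Q2 N \<omega>" for N \<omega>
    unfolding Q1_def Q2_def by (intro sum_nonneg mult_nonneg_nonneg divide_nonneg_nonneg err_weight_nonneg; simp)+
  obtain K where K: "0 \<le> K" "\<And>N m. 1 \<le> N \<Longrightarrow> 2 * m \<le> N \<Longrightarrow> (\<Sum>k\<in>{1..<Suc m}. err_weight \<zeta> N k / k) \<le> K"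
    using sum_err_weight_bounded[OF \<zeta>] by blast
  have Q1: "integrable M (Q1 N)" "1 \<le> N \<Longrightarrow> expectation (\<lambda>\<omega>. \<bar>Q1 N \<omega>\<bar>) \<le> K * (\<integral>x. (1 + \<bar>x\<bar>) powr p \<partial>\<N>)" for N
  proof -
    have s: "distributed M lborel (\<lambda>\<omega>. W1 N (real k) \<omega> / sqrt k) std_normal_density" if "k \<in> {1..<Suc (m1 N)}" for k
      using that m12[of k N] by (intro W1_std) auto
    show "integrable M (Q1 N)" unfolding Q1_def by (rule err_sum_L1(1)[OF s p])
    assume "1 \<le> N"
    have "expectation (\<lambda>\<omega>. \<bar>Q1 N \<omega>\<bar>) = (\<Sum>k\<in>{1..<Suc (m1 N)}. err_weight \<zeta> N k / k) * (\<integral>x. (1 + \<bar>x\<bar>) powr p \<partial>\<N>)"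
      unfolding abs_of_nonneg[OF Q0(1)] unfolding Q1_def by (rule err_sum_L1(2)[OF s p])
    also have "\<dots> \<le> K * (\<integral>x. (1 + \<bar>x\<bar>) powr p \<partial>\<N>)"
      using \<open>1 \<le> N\<close> by (intro mult_right_mono K integral_nonneg_AE) (auto simp: m1_def)
    finally show "expectation (\<lambda>\<omega>. \<bar>Q1 N \<omega>\<bar>) \<le> K * (\<integral>x. (1 + \<bar>x\<bar>) powr p \<partial>\<N>)" .
  qed
  have Q2: "integrable M (Q2 N)" "1 \<le> N \<Longrightarrow> expectation (\<lambda>\<omega>. \<bar>Q2 N \<omega>\<bar>) \<le> K * (\<integral>x. (1 + \<bar>x\<bar>) powr p \<partial>\<N>)" for N
  proof -
    have s: "distributed M lborel (\<lambda>\<omega>. W2 N (real k) \<omega> / sqrt k) std_normal_density" if "k \<in> {1..<Suc (m2 N)}" for k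
      using that m12[of k N] by (intro W2_std) auto
    show "integrable M (Q2 N)" unfolding Q2_def by (rule err_sum_L1(1)[OF s p])
    assume "1 \<le> N"
    have "expectation (\<lambda>\<omega>. \<bar>Q2 N \<omega>\<bar>) = (\<Sum>k\<in>{1..<Suc (m2 N)}. err_weight \<zeta> N k / k) * (\<integral>x. (1 + \<bar>x\<bar>) powr p \<partial>\<N>)"
      unfolding abs_of_nonneg[OF Q0(2)] unfolding Q2_def by (rule err_sum_L1(2)[OF s p])
    also have "\<dots> \<le> K * (\<integral>x. (1 + \<bar>x\<bar>) powr p \<partial>\<N>)"
      using \<open>1 \<le> N\<close> by (intro mult_right_mono K integral_nonneg_AE) (auto simp: m2_def)
    finally show "expectation (\<lambda>\<omega>. \<bar>Q2 N \<omega>\<bar>) \<le> K * (\<integral>x. (1 + \<bar>x\<bar>) powr p \<partial>\<N>)" .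
  qed
  have Q_meas [measurable]: "Q1 N \<in> borel_measurable M" "Q2 N \<in> borel_measurable M" for N
    using Q1(1) Q2(1) by (auto intro: borel_measurable_integrable)
  have bQ: "bounded_in_probability M (\<lambda>N \<omega>. Q1 N \<omega> + Q2 N \<omega>)"
    by (intro bounded_in_probability_add bounded_in_probability_L1 Q1(1) Q2(1) Q_meas)
      (rule eventually_mono[OF eventually_ge_at_top[of 1]], rule Q1(2) Q2(2), assumption)+

  define J where "J = (\<lambda>N \<omega>. 1 / \<sigma> powr p * (LBINT t:{0..1}. \<bar>cusum_process (\<lambda>i. X i \<omega>) N t\<bar> powr p / (t * (1 - t)) powr (1 + p/2)))"
  have J_sum: "J N \<omega> = (\<Sum>k\<in>{1..<N}. real N powr (- p / 2) * \<bar>cusum_at (\<lambda>i. \<epsilon> i \<omega>) N k / \<sigma>\<bar> powr p * cell_weight (1 + p / 2) N k)"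
    if N: "1 \<le> N" and w: "\<omega> \<in> space M" for N \<omega>
  proof -
    have c: "cusum_at (\<lambda>i. X i \<omega>) N k = cusum_at (\<lambda>i. \<epsilon> i \<omega>) N k" if "k \<in> {1..<N}" for k
    proof -
      have "cusum_at (\<lambda>i. X i \<omega>) N k = cusum_at (\<lambda>i. \<mu>\<^sub>0 + \<epsilon> i \<omega>) N k"
        unfolding cusum_at_def using X[OF _ w] by simp
      then show ?thesis using N that by (simp add: cusum_at_shift)
    qed
    have "J N \<omega> = (\<Sum>k\<in>{1..<N}. 1 / \<sigma> powr p * (real N powr (- p / 2) * \<bar>cusum_at (\<lambda>i. X i \<omega>) N k\<bar> powr p * cell_weight (1 + p / 2) N k))"
      unfolding J_def using p by (subst cusum_integral_eq_sum[OF N]) (auto simp only: sum_distrib_left)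
    also have "\<dots> = (\<Sum>k\<in>{1..<N}. real N powr (- p / 2) * \<bar>cusum_at (\<lambda>i. \<epsilon> i \<omega>) N k / \<sigma>\<bar> powr p * cell_weight (1 + p / 2) N k)"
    proof (rule sum.cong[OF refl])
      fix k assume "k \<in> {1..<N}"
      then have "\<bar>cusum_at (\<lambda>i. \<epsilon> i \<omega>) N k / \<sigma>\<bar> powr p = \<bar>cusum_at (\<lambda>i. X i \<omega>) N k\<bar> powr p / \<sigma> powr p"
        using c \<sigma> by (simp add: abs_divide powr_divide)
      then show "1 / \<sigma> powr p * (real N powr (- p / 2) * \<bar>cusum_at (\<lambda>i. X i \<omega>) N k\<bar> powr p * cell_weight (1 + p / 2) N k)
        = real N powr (- p / 2) * \<bar>cusum_at (\<lambda>i. \<epsilon> i \<omega>) N k / \<sigma>\<bar> powr p * cell_weight (1 + p / 2) N k" by simp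
    qed
    finally show ?thesis .
  qed
  have cu: "cusum_at (\<lambda>i. \<epsilon> i \<omega>) N k = S k \<omega> - real k / real N * S N \<omega>" for N k \<omega>
    by (simp add: cusum_at_def S_def)
  have SN: "\<bar>real k / real N * S N \<omega>\<bar> \<le> R N \<omega> * (real k / sqrt N)" if "1 \<le> N" for N k \<omega>
  proof -
    have "\<bar>real k / real N * S N \<omega>\<bar> = real k / real N * \<bar>S N \<omega>\<bar>" by (simp add: abs_mult)
    also have "\<dots> \<le> real k / real N * (R N \<omega> * sqrt N)" using S_R[OF that] by (intro mult_left_mono) auto
    also have "\<dots> = R N \<omega> * (real k * (sqrt N / N))" by simp
    also have "sqrt N / N = 1 / sqrt N" using that by (simp add: divide_eq_eq eq_divide_eq)
    finally show ?thesis by simp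
  qed
  \<comment> \<open>Common to both ends: \<open>y\<close> is a sum of errors counted from the nearer
    end, \<open>s\<close> the bridge term, \<open>w\<close> the Wiener value at distance
    \<open>k\<close> from that end.\<close>
  have combine: "\<bar>(y - s) / \<sigma> - w\<bar> \<le> B N \<omega> * (real k powr \<zeta> + real k / sqrt N)"
    if "\<bar>y - \<sigma> * w\<bar> \<le> A * real k powr \<zeta>" "\<bar>s\<bar> \<le> R N \<omega> * (real k / sqrt N)" "A \<le> \<bar>A1 N \<omega>\<bar> + \<bar>A2 N \<omega>\<bar>"
    for y s w A N \<omega> and k :: nat
  proof -
    let ?L = "\<bar>A1 N \<omega>\<bar> + \<bar>A2 N \<omega>\<bar> + R N \<omega>"
    have "(y - s) / \<sigma> - w = ((y - \<sigma> * w) - s) / \<sigma>" using \<sigma> by (simp add: field_simps)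
    then have "\<bar>(y - s) / \<sigma> - w\<bar> = \<bar>(y - \<sigma> * w) - s\<bar> / \<sigma>" using \<sigma> by (simp add: abs_divide)
    also have "\<dots> \<le> (\<bar>y - \<sigma> * w\<bar> + \<bar>s\<bar>) / \<sigma>" using \<sigma> by (intro divide_right_mono) auto
    also have "\<dots> \<le> (A * real k powr \<zeta> + R N \<omega> * (real k / sqrt N)) / \<sigma>" using that \<sigma> by (intro divide_right_mono) auto
    also have "\<dots> \<le> (?L * real k powr \<zeta> + ?L * (real k / sqrt N)) / \<sigma>"
      using that(3) R0[of N \<omega>] \<sigma> by (intro divide_right_mono add_mono mult_right_mono) auto
    also have "\<dots> = B N \<omega> * (real k powr \<zeta> + real k / sqrt N)"
      unfolding B_def distrib_left[symmetric] by simp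
    finally show ?thesis .
  qed
  have J_error: "\<bar>J N \<omega> - (T1 N \<omega> + T2 N \<omega>)\<bar> \<le> err_const p * (1 + B N \<omega>) powr p * (Q1 N \<omega> + Q2 N \<omega>)"
    if N: "1 \<le> N" and w: "\<omega> \<in> space M" for N \<omega>
  proof -
    let ?c = "\<lambda>k. cusum_at (\<lambda>i. \<epsilon> i \<omega>) N k"
    let ?t = "\<lambda>y k. real N powr (- p / 2) * \<bar>y\<bar> powr p * cell_weight (1 + p / 2) N k"
    let ?E = "err_const p * (1 + B N \<omega>) powr p"
    have b1: "\<bar>?t (?c k / \<sigma>) k - \<bar>W1 N (real k) \<omega> / sqrt k\<bar> powr p / k\<bar>
       \<le> ?E * (err_weight \<zeta> N k / k * (1 + \<bar>W1 N (real k) \<omega> / sqrt k\<bar>) powr p)" if k: "k \<in> {1..<Suc (m1 N)}" for k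
    proof (rule weighted_term_error[OF p B0 \<zeta>])
      show k1: "1 \<le> k" and k2: "2 * k \<le> N" using k m12[of k N] by auto
      have "k \<in> I1 N" using k1 k2 by (auto simp: I1_def)
      then show "\<bar>?c k / \<sigma> - W1 N (real k) \<omega>\<bar> \<le> B N \<omega> * (real k powr \<zeta> + real k / sqrt (real N))"
        unfolding cu by (intro combine[OF A1_bound SN[OF N]]) auto
    qed
    have b2: "\<bar>?t (?c (N - k) / \<sigma>) (N - k) - \<bar>W2 N (real k) \<omega> / sqrt k\<bar> powr p / k\<bar>
       \<le> ?E * (err_weight \<zeta> N k / k * (1 + \<bar>W2 N (real k) \<omega> / sqrt k\<bar>) powr p)" if k: "k \<in> {1..<Suc (m2 N)}" for k
    proof -
      have k1: "1 \<le> k" and k2: "2 * k \<le> N" "2 * k < N" using k by (auto simp: m2_def)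
      have I: "N - k \<in> I2 N" using k1 k2 by (auto simp: I2_def of_nat_diff)
      have Nk: "N - (N - k) = k" using k2 by simp
      \<comment> \<open>Seen from the right end the CUSUM is, up to sign, the sum of the last
        \<open>k\<close> errors minus \<open>k / N\<close> times the total; the sign disappears in
        the absolute power.\<close>
      have neg: "- ?c (N - k) = (S N \<omega> - S (N - k) \<omega>) - real k / real N * S N \<omega>"
        unfolding cu using N k2 by (simp add: of_nat_diff diff_divide_distrib left_diff_distrib)
      have "\<bar>- ?c (N - k) / \<sigma> - W2 N (real k) \<omega>\<bar> \<le> B N \<omega> * (real k powr \<zeta> + real k / sqrt (real N))"
        unfolding neg by (rule combine[OF A2_bound[OF I, of \<omega>, unfolded Nk] SN[OF N]]) simp
      from weighted_term_error[OF p B0 \<zeta> k1 k2(1) this]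
      show ?thesis using k2 by (simp add: cell_weight_symmetric)
    qed
    have Jsplit: "J N \<omega> = (\<Sum>k\<in>{1..<Suc (m1 N)}. ?t (?c k / \<sigma>) k) + (\<Sum>k\<in>{1..<Suc (m2 N)}. ?t (?c (N - k) / \<sigma>) (N - k))"
      unfolding J_sum[OF N w] m1_def m2_def by (rule sum_split_halves[OF N])
    have sum1: "\<bar>(\<Sum>k\<in>A. f k) - (\<Sum>k\<in>A. g k)\<bar> \<le> (\<Sum>k\<in>A. h k)"
      if "\<And>k. k \<in> A \<Longrightarrow> \<bar>f k - g k\<bar> \<le> h k" for f g h :: "nat \<Rightarrow> real" and A
      unfolding sum_subtractf[symmetric] by (rule order_trans[OF sum_abs sum_mono]) (rule that)
    have "\<bar>(\<Sum>k\<in>{1..<Suc (m1 N)}. ?t (?c k / \<sigma>) k) - T1 N \<omega>\<bar> \<le> ?E * Q1 N \<omega>"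
      unfolding T1_def walk_pow_sum_def Q1_def sum_distrib_left by (rule sum1[OF b1])
    moreover have "\<bar>(\<Sum>k\<in>{1..<Suc (m2 N)}. ?t (?c (N - k) / \<sigma>) (N - k)) - T2 N \<omega>\<bar> \<le> ?E * Q2 N \<omega>"
      unfolding T2_def walk_pow_sum_def Q2_def sum_distrib_left by (rule sum1[OF b2])
    ultimately show ?thesis unfolding Jsplit distrib_left by linarith
  qed

  define v where "v = (\<lambda>N::nat. sqrt (1 / (4 * a_const p * ln (real N))))"
  define f where "f = (\<lambda>N \<omega>. v N * (J N \<omega> - 2 * b_const p * ln (real N)))"
  define U where "U = (\<lambda>N \<omega>. v N * (T1 N \<omega> + T2 N \<omega> - 2 * b_const p * ln (real N)))"
  have a: "0 < a_const p" by (rule a_const_pos[OF p])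
  \<comment> \<open>The random integral is measurable because it is a finite sum of measurable
    terms; for \<open>N = 0\<close> the scaling \<open>0 powr (-1/2)\<close> is 0 and the process
    vanishes.\<close>
  have J_meas [measurable]: "J N \<in> borel_measurable M" for N
  proof (cases "N = 0")
    case True
    have "cusum_process x 0 t = 0" for x t by (simp add: cusum_process_def)
    then have "J N \<omega> = 0" for \<omega> using p True by (simp add: J_def)
    then have "J N = (\<lambda>\<omega>. 0)" by auto
    then show ?thesis by simp
  next
    case False
    then have N: "1 \<le> N" by simp
    show ?thesis
      by (subst measurable_cong[OF J_sum[OF N]]) (simp_all add: cu)
  qed
  have f_meas [measurable]: "f N \<in> borel_measurable M" for N unfolding f_def by measurable
  have U_meas [measurable]: "U N \<in> borel_measurable M" for N unfolding U_def by measurable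
  have v0: "v \<longlonglongrightarrow> 0"
  proof -
    have "(\<lambda>N::nat. 1 / (4 * a_const p) * (1 / ln (real N))) \<longlonglongrightarrow> 1 / (4 * a_const p) * 0"
      by (intro tendsto_mult tendsto_const) real_asymp
    then have "(\<lambda>N::nat. 1 / (4 * a_const p * ln (real N))) \<longlonglongrightarrow> 0" by simp
    from tendsto_real_sqrt[OF this] show ?thesis by (simp add: v_def)
  qed
  have fU: "(\<lambda>N. prob {\<omega>\<in>space M. \<bar>f N \<omega> - U N \<omega>\<bar> > e}) \<longlonglongrightarrow> 0" if "0 < e" for e
  proof (rule vanishing_in_probability[OF bB bQ _ _ _ _ _ _ that])
    show "(\<lambda>N. \<bar>v N\<bar> * err_const p) \<longlonglongrightarrow> 0" by (rule tendsto_mult_left_zero[OF tendsto_rabs_zero[OF v0]])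
    show "0 \<le> \<bar>v N\<bar> * err_const p" for N using err_const_nonneg[OF p] by simp
    show "\<forall>\<^sub>F N in sequentially. \<forall>\<omega>\<in>space M. \<bar>f N \<omega> - U N \<omega>\<bar> \<le> \<bar>v N\<bar> * err_const p * (1 + \<bar>B N \<omega>\<bar>) powr p * \<bar>Q1 N \<omega> + Q2 N \<omega>\<bar>"
      using eventually_ge_at_top[of 1]
    proof eventually_elim
      case (elim N)
      show ?case
      proof
        fix \<omega> assume w: "\<omega> \<in> space M"
        have "f N \<omega> - U N \<omega> = v N * (J N \<omega> - (T1 N \<omega> + T2 N \<omega>))" by (simp add: f_def U_def algebra_simps)
        then have "\<bar>f N \<omega> - U N \<omega>\<bar> = \<bar>v N\<bar> * \<bar>J N \<omega> - (T1 N \<omega> + T2 N \<omega>)\<bar>" by (simp add: abs_mult)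
        also have "\<dots> \<le> \<bar>v N\<bar> * (err_const p * (1 + B N \<omega>) powr p * (Q1 N \<omega> + Q2 N \<omega>))"
          using J_error[OF elim w] by (intro mult_left_mono) auto
        finally show "\<bar>f N \<omega> - U N \<omega>\<bar> \<le> \<bar>v N\<bar> * err_const p * (1 + \<bar>B N \<omega>\<bar>) powr p * \<bar>Q1 N \<omega> + Q2 N \<omega>\<bar>"
          using B0[of N \<omega>] Q0[of N \<omega>] by (simp add: mult.assoc)
      qed
    qed
  qed (use p in auto)
  have U_char: "(\<lambda>N. CLINT \<omega>|M. iexp (t * U N \<omega>)) \<longlonglongrightarrow> of_real (exp (- t\<^sup>2 / 2))" for t
  proof -
    define u where "u = (\<lambda>N::nat. t * sqrt (1 / (4 * a_const p * ln (real N))))"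
    define d where "d = (\<lambda>N::nat. b_const p * ln (real N))"
    have m1': "\<forall>\<^sub>F N in sequentially. real N / 4 \<le> real (m1 N) \<and> m1 N \<le> N"
      using eventually_ge_at_top[of 4]
    proof eventually_elim
      case (elim N)
      have "N \<le> 4 * m1 N" using elim unfolding m1_def by linarith
      then have "real N \<le> 4 * real (m1 N)" by linarith
      then show ?case by (simp add: m1_def)
    qed
    have m2': "\<forall>\<^sub>F N in sequentially. real N / 4 \<le> real (m2 N) \<and> m2 N \<le> N"
      using eventually_ge_at_top[of 4]
    proof eventually_elim
      case (elim N)
      have "N \<le> 4 * m2 N" using elim unfolding m2_def by linarith
      then have "real N \<le> 4 * real (m2 N)" by linarith
      moreover have "m2 N \<le> N" unfolding m2_def by linarith
      ultimately show ?case by simp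
    qed
    have c1: "(\<lambda>N. walk_char p (m1 N) (u N) (d N)) \<longlonglongrightarrow> of_real (exp (- (a_const p * (t / sqrt (4 * a_const p))\<^sup>2)))"
      unfolding u_def d_def by (rule walk_char_limit[OF p comparable_index_limits[OF m1' a]])
    have c2: "(\<lambda>N. walk_char p (m2 N) (u N) (d N)) \<longlonglongrightarrow> of_real (exp (- (a_const p * (t / sqrt (4 * a_const p))\<^sup>2)))"
      unfolding u_def d_def by (rule walk_char_limit[OF p comparable_index_limits[OF m2' a]])
    \<comment> \<open>Each end contributes the exponent \<open>t^2 / 4\<close>; by independence the
      two add up to the exponent of the standard normal law.\<close>
    have q: "a_const p * (t / sqrt (4 * a_const p))\<^sup>2 = t\<^sup>2 / 4" using a by (simp add: power_divide)
    have "(\<lambda>N. walk_char p (m1 N) (u N) (d N) * walk_char p (m2 N) (u N) (d N)) \<longlonglongrightarrow> of_real (exp (- (t\<^sup>2 / 4))) * of_real (exp (- (t\<^sup>2 / 4)))"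
      using tendsto_mult[OF c1 c2] unfolding q .
    also have "complex_of_real (exp (- (t\<^sup>2 / 4))) * of_real (exp (- (t\<^sup>2 / 4))) = of_real (exp (- t\<^sup>2 / 2))"
      by (simp flip: of_real_mult exp_add)
    finally have lim: "(\<lambda>N. walk_char p (m1 N) (u N) (d N) * walk_char p (m2 N) (u N) (d N)) \<longlonglongrightarrow> of_real (exp (- t\<^sup>2 / 2))" .
    have "\<forall>\<^sub>F N in sequentially. walk_char p (m1 N) (u N) (d N) * walk_char p (m2 N) (u N) (d N) = (CLINT \<omega>|M. iexp (t * U N \<omega>))"
      \<comment> \<open>From 3 on both ends have at least one term, as required by
        \<open>wiener_walk_char\<close>.\<close>
      using eventually_ge_at_top[of 3]
    proof eventually_elim
      case (elim N)
      have N: "1 \<le> N" using elim by simp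
      have m: "1 \<le> m1 N" "1 \<le> m2 N" "real (m1 N) \<le> real N / 2" "real (m2 N) \<le> real N / 2"
        using elim by (auto simp: m1_def m2_def)
      have ind: "indep_var borel (\<lambda>\<omega>. T1 N \<omega> - d N) borel (\<lambda>\<omega>. T2 N \<omega> - d N)"
        unfolding T1_def T2_def by (rule indep_walk_pow_sums[OF assms(10)[OF N] m(3,4)])
      have "t * U N \<omega> = u N * ((T1 N \<omega> - d N) + (T2 N \<omega> - d N))" for \<omega>
        by (simp add: U_def u_def v_def d_def algebra_simps)
      then have "(CLINT \<omega>|M. iexp (t * U N \<omega>)) = (CLINT \<omega>|M. iexp (u N * (T1 N \<omega> - d N))) * (CLINT \<omega>|M. iexp (u N * (T2 N \<omega> - d N)))"
        using expectation_iexp_indep[OF ind, of "u N"] by simp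
      then show ?case
        unfolding T1_def T2_def wiener_walk_char[OF W1[OF N] m(1,3)] wiener_walk_char[OF W2[OF N] m(2,4)] by simp
    qed
    with lim show ?thesis by (rule Lim_transform_eventually)
  qed
  have f_char: "(\<lambda>N. CLINT \<omega>|M. iexp (t * f N \<omega>)) \<longlonglongrightarrow> of_real (exp (- t\<^sup>2 / 2))" for t
    by (rule iexp_limit_transfer[OF f_meas U_meas fU U_char])
  have "weak_conv_m (\<lambda>N. distr M borel (f N)) std_normal_distribution"
  proof (rule levy_continuity)
    show "real_distribution (distr M borel (f N))" for N by (rule real_distribution_distr) simp
    show "real_distribution std_normal_distribution" by (rule real_dist_normal_dist)
    fix t
    have "char (distr M borel (f N)) t = (CLINT \<omega>|M. iexp (t * f N \<omega>))" for N
      unfolding char_def by (subst integral_distr) auto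
    then show "(\<lambda>N. char (distr M borel (f N)) t) \<longlonglongrightarrow> char std_normal_distribution t"
      using f_char[of t] by (simp add: char_std_normal_distribution)
  qed
  then show ?thesis unfolding f_def J_def v_def .
qed

end
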